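(* Let $a>1$. There exists a holomorphic function $\mathcal C_a:S_\pi\to\mathbb C$ such that, for every compact $K\subset S_\pi$, $$\log\mathbb E\exp(\theta N_a(L))=L\Lambda_a(\theta)+\mathcal C_a(\theta)+o(1),\qquad L\to\infty,$$ uniformly for $\theta\in K$.
   Context: Let $\mathbb H=\{z\in\mathbb C:\operatorname{Im}z>0\}$ with planar Lebesgue measure $\mathrm dA$. Let $\mathcal Z$ be the determinantal point process on $(\mathbb H,\mathrm dA)$ with Hermitian correlation kernel $K_{\mathbb H}(z,w)=-\frac{1}{\pi(z-\overline w)^2}$. For $a>1$ and $L>0$ set $N_a(L):=\#\{z\in\mathcal Z:0\le\operatorname{Re}z\le L,\ 1\le\operatorname{Im}z\le a\}$. Let $S_\pi:=\{\theta\in\mathbb C:|\operatorname{Im}\theta|<\pi\}$ and, for $\theta\in S_\pi$, $$\Lambda_a(\theta)=\frac{1}{2\pi}\int_0^\infty \log\left(1+(e^\theta-1)(e^{-2\xi}-e^{-2a\xi})\right)\,\mathrm d\xi ,$$ where the logarithm is the branch obtained by analytic continuation from $\theta=0$ (this is holomorphic on $S_\pi$). The function $\theta\mapsto\mathbb E\exp(\theta N_a(L))$ is entire and zero-free on $S_\pi$; $\log\mathbb E\exp(\theta N_a(L))$ denotes its holomorphic logarithm on $S_\pi$ that vanishes at $\theta=0$. *)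

theory Defs
  imports
    "HOL-Probability.Probability"
    "HOL-Complex_Analysis.Complex_Analysis"
    "Jordan_Normal_Form.Determinant"
begin

subsection \<open>Simple point processes and determinantal point processes\<close>

text \<open>A simple point process on a subset \<open>D\<close> of a topological space is a random locally finite
  subset of \<open>D\<close>; measurability means that all counting variables are measurable, with values in
  the extended nonnegative reals because \<open>B\<close> need not be relatively compact in \<open>D\<close>.\<close>

locale simple_point_process = prob_space M
  for M :: "'w measure" +
  fixes D :: "'x::topological_space set" and Z :: "'w \<Rightarrow> 'x set"
  assumes points_subset: "\<And>\<omega>. \<omega> \<in> space M \<Longrightarrow> Z \<omega> \<subseteq> D"
    and locally_finite:
      "\<And>\<omega> C. \<omega> \<in> space M \<Longrightarrow> compact C \<Longrightarrow> C \<subseteq> D \<Longrightarrow> finite (Z \<omega> \<inter> C)"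
    and measurable_count:
      "\<And>B. B \<in> sets borel \<Longrightarrow> B \<subseteq> D \<Longrightarrow>
        (\<lambda>\<omega>. emeasure (count_space UNIV) (Z \<omega> \<inter> B)) \<in> borel_measurable M"

text \<open>\<open>\<rho>\<close> is an \<open>n\<close>-point correlation function of \<open>Z\<close> with respect to the reference measure
  \<open>\<mu>\<close> on \<open>D\<close> if, for all measurable \<open>f \<ge> 0\<close>, the expected sum of \<open>f\<close> over the \<open>n\<close>-tuples of
  pairwise distinct points of \<open>Z\<close> equals the integral of \<open>f \<rho>\<close> against the \<open>n\<close>-fold product
  of \<open>\<mu>\<close>. An \<open>n\<close>-tuple is an extensional function on \<open>{..<n}\<close>.\<close>

definition correlation_function ::
  "'w measure \<Rightarrow> 'x set \<Rightarrow> 'x measure \<Rightarrow> ('w \<Rightarrow> 'x set) \<Rightarrow> nat \<Rightarrow> ((nat \<Rightarrow> 'x) \<Rightarrow> real) \<Rightarrow> bool"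
  where
  "correlation_function M D \<mu> Z n \<rho> \<longleftrightarrow>
     (let P = PiM {..<n} (\<lambda>_. restrict_space \<mu> D) in
       \<rho> \<in> borel_measurable P \<and> (\<forall>x \<in> space P. 0 \<le> \<rho> x) \<and>
       (\<forall>f \<in> borel_measurable P.
          (\<integral>\<^sup>+ \<omega>. (\<integral>\<^sup>+ x. f x
              \<partial>count_space {x \<in> {..<n} \<rightarrow>\<^sub>E Z \<omega>. inj_on x {..<n}}) \<partial>M)
          = (\<integral>\<^sup>+ x. f x * ennreal (\<rho> x) \<partial>P)))"

definition determinantal_point_process ::
  "'w measure \<Rightarrow> 'x::topological_space set \<Rightarrow> 'x measure \<Rightarrow> ('x \<Rightarrow> 'x \<Rightarrow> complex)
    \<Rightarrow> ('w \<Rightarrow> 'x set) \<Rightarrow> bool"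
  where
  "determinantal_point_process M D \<mu> K Z \<longleftrightarrow>
     simple_point_process M D Z \<and>
     (\<forall>n. \<exists>\<rho>. correlation_function M D \<mu> Z n \<rho> \<and>
       (\<forall>x \<in> {..<n} \<rightarrow>\<^sub>E D.
          complex_of_real (\<rho> x) = Determinant.det (Matrix.mat n n (\<lambda>(i, j). K (x i) (x j)))))"

subsection \<open>Holomorphic logarithms\<close>

text \<open>The holomorphic logarithm of \<open>F\<close> on \<open>S\<close> vanishing at \<open>z\<^sub>0\<close>. On an open connected \<open>S\<close>
  containing \<open>z\<^sub>0\<close> its values on \<open>S\<close> are uniquely determined as soon as it exists.\<close>

definition is_holomorphic_log ::
  "complex set \<Rightarrow> complex \<Rightarrow> (complex \<Rightarrow> complex) \<Rightarrow> (complex \<Rightarrow> complex) \<Rightarrow> bool" where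
  "is_holomorphic_log S z\<^sub>0 F g \<longleftrightarrow>
     g holomorphic_on S \<and> g z\<^sub>0 = 0 \<and> (\<forall>z \<in> S. exp (g z) = F z)"

definition holomorphic_log ::
  "complex set \<Rightarrow> complex \<Rightarrow> (complex \<Rightarrow> complex) \<Rightarrow> complex \<Rightarrow> complex" where
  "holomorphic_log S z\<^sub>0 F = (SOME g. is_holomorphic_log S z\<^sub>0 F g)"

lemma holomorphic_log_eq:
  assumes S: "open S" "connected S" "z\<^sub>0 \<in> S"
    and g: "is_holomorphic_log S z\<^sub>0 F g" and z: "z \<in> S"
  shows "holomorphic_log S z\<^sub>0 F z = g z"
proof -
  define h where "h = holomorphic_log S z\<^sub>0 F"
  have h: "is_holomorphic_log S z\<^sub>0 F h"
    unfolding h_def holomorphic_log_def using someI[of "is_holomorphic_log S z\<^sub>0 F", OF g] .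
  define d where "d = (\<lambda>w. h w - g w)"
  have hol: "d holomorphic_on S"
    using g h unfolding d_def is_holomorphic_log_def by (auto intro!: holomorphic_intros)
  have exp1: "exp (d w) = 1" if "w \<in> S" for w
    using g h that unfolding d_def is_holomorphic_log_def by (metis exp_diff exp_not_eq_zero divide_self)
  have deriv0: "(d has_field_derivative 0) (at w)" if w: "w \<in> S" for w
  proof -
    have D: "(d has_field_derivative deriv d w) (at w)"
      using hol S(1) w by (rule holomorphic_derivI)
    have "((\<lambda>w. exp (d w)) has_field_derivative exp (d w) * deriv d w) (at w)"
      by (rule DERIV_fun_exp[OF D])
    moreover have "((\<lambda>w. exp (d w)) has_field_derivative 0) (at w)"
      by (rule has_field_derivative_transform_within_open[where f = "\<lambda>_. 1" and S = S])
         (use exp1 w S(1) in auto)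
    ultimately have "exp (d w) * deriv d w = 0"
      by (rule DERIV_unique)
    with D show ?thesis by simp
  qed
  obtain c where c: "\<And>w. w \<in> S \<Longrightarrow> d w = c"
    using DERIV_zero_connected_constant[OF S(2,1) finite.emptyI, of d]
      holomorphic_on_imp_continuous_on[OF hol] deriv0 by auto
  have "d z = d z\<^sub>0" using c z S(3) by simp
  then show ?thesis
    using g h unfolding d_def h_def[symmetric] is_holomorphic_log_def by simp
qed

subsection \<open>The objects of the statement\<close>

definition upper_half_plane :: "complex set" where
  "upper_half_plane = {z. 0 < Im z}"

definition K_H :: "complex \<Rightarrow> complex \<Rightarrow> complex" where
  "K_H z w = - 1 / (of_real pi * (z - cnj w)\<^sup>2)"

definition N :: "('w \<Rightarrow> complex set) \<Rightarrow> real \<Rightarrow> real \<Rightarrow> 'w \<Rightarrow> nat" where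
  "N Z a L \<omega> = card {z \<in> Z \<omega>. 0 \<le> Re z \<and> Re z \<le> L \<and> 1 \<le> Im z \<and> Im z \<le> a}"

definition S_pi :: "complex set" where
  "S_pi = {\<theta>. \<bar>Im \<theta>\<bar> < pi}"

text \<open>The logarithm in the integrand is the branch in the variable \<open>\<theta>\<close> (for each fixed \<open>\<xi>\<close>)
  obtained by continuation over the strip from the value \<open>0\<close> at \<open>\<theta> = 0\<close>.\<close>

definition Lambda :: "real \<Rightarrow> complex \<Rightarrow> complex" where
  "Lambda a \<theta> = 1 / (2 * of_real pi) *
     (LINT \<xi>:{0..}|lborel.
        holomorphic_log S_pi 0
          (\<lambda>t. 1 + (exp t - 1) * of_real (exp (- 2 * \<xi>) - exp (- 2 * a * \<xi>))) \<theta>)"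

definition log_mgf :: "'w measure \<Rightarrow> ('w \<Rightarrow> nat) \<Rightarrow> complex \<Rightarrow> complex" where
  "log_mgf M X = holomorphic_log S_pi 0 (\<lambda>\<theta>. LINT \<omega>|M. exp (\<theta> * of_nat (X \<omega>)))"

end

theory Submission
  imports Defs "Jordan_Normal_Form.Schur_Decomposition"
begin

text \<open>The kernel is \<open>K(z, w) = (1 / \<pi>) \<integral> \<xi> exp (\<i> \<xi> (z - cnj w)) d\<xi>\<close> over \<open>\<xi> > 0\<close>, so its
  restriction to the rectangle \<open>[0, L] \<times> [1, a]\<close> is a truncated convolution operator whose rank-one
  symbol has squared norm \<open>\<lambda>(\<xi>) = exp (- 2 \<xi>) - exp (- 2 a \<xi>)\<close>. Compressing it to step functions
  on a fine mesh gives Hermitian block Toeplitz matrices \<open>A\<close> with spectrum in \<open>[0, 1]\<close>, and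
  \<open>det (1 + z A)\<close> converges to the factorial moment series of \<open>E (1 + z)^N\<close>.

  Each eigenvalue of \<open>A\<close> is the mean of \<open>\<lambda>\<close> under a subprobability density, and these densities
  add up to at most \<open>L / 2\<pi>\<close>. By Taylor's formula the sum of \<open>f\<close> over the eigenvalues differs from
  \<open>(L / 2\<pi>) \<integral> f (\<lambda>(\<xi>)) d\<xi>\<close> by at most \<open>sup \<bar>f''\<bar>\<close> times \<open>(L / 2\<pi>) \<integral> \<lambda>\<^sup>2 - tr A\<^sup>2\<close>, which
  stays bounded because \<open>\<integral> \<bar>x\<bar> \<bar>K\<bar>\<^sup>2 dx\<close> converges. Hence \<open>log E exp (\<theta> N) - L \<Lambda>(\<theta>)\<close> is bounded
  uniformly in \<open>L\<close>, locally uniformly in \<open>\<theta>\<close>.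

  For real \<open>\<theta> > 0\<close> the ratios of consecutive leading minors of the positive definite Toeplitz matrix
  \<open>1 + (exp \<theta> - 1) A\<close> decrease, so \<open>log E exp (\<theta> N)\<close> is a concave function of \<open>L\<close>; being concave
  and bounded after subtracting \<open>L \<Lambda>(\<theta>)\<close>, it converges. Vitali's theorem extends the convergence
  to the strip.\<close>

subsection \<open>Spectral decomposition of Hermitian matrices\<close>

text \<open>The densities come from the eigenvectors: \<open>q p\<close> is the squared modulus of
  the combination of modes given by eigenvector \<open>p\<close>, divided by the symbol. The mean of
  the symbol is then the eigenvalue by construction, and mass at most 1 is Bessel's inequality. It
  holds exactly at every mesh because the vertical parts of the modes sum to the symbol times an
  explicit factor. Mass that is missing may be put at 0, since \<open>f 0 = 0\<close>. The order of
  the limits shapes all estimates: \<open>L\<close> is fixed while the mesh shrinks, so an error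
  that grows with \<open>L\<close> is acceptable if it carries a factor \<open>h\<close> or
  \<open>w\<close>. What survives is a boundary term, and it gives the constant
  \<open>2 * (a - 1)\<^sup>2\<close>. The logarithm is a subsequential limit of sums of
  \<open>Ln\<close> over eigenvalues, which yields its existence, holomorphy and bound together.
  Concavity is available only along arithmetic progressions of widths, because a mesh compares
  widths that are multiples of one step; monotonicity in \<open>L\<close> fills the gaps.\<close>

lemma diag_sum_mult_commute:
  fixes A B :: "'a::comm_ring_1 Matrix.mat"
  assumes "A \<in> carrier_mat n n" "B \<in> carrier_mat n n"
  shows "(\<Sum>i<n. (A * B) $$ (i, i)) = (\<Sum>i<n. (B * A) $$ (i, i))"
proof -
  have "(\<Sum>i<n. (A * B) $$ (i, i)) = (\<Sum>i<n. \<Sum>j<n. A $$ (i, j) * B $$ (j, i))"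
    using assms by (auto simp: scalar_prod_def atLeast0LessThan intro!: sum.cong)
  also have "\<dots> = (\<Sum>j<n. \<Sum>i<n. B $$ (j, i) * A $$ (i, j))"
    by (subst sum.swap) (simp add: mult.commute)
  also have "\<dots> = (\<Sum>i<n. (B * A) $$ (i, i))"
    using assms by (auto simp: scalar_prod_def atLeast0LessThan intro!: sum.cong)
  finally show ?thesis .
qed

text \<open>Schur triangularisation is a similarity and the trace is invariant under cyclic
  permutation. Knowing the sum of the eigenvalues suffices to produce one that differs from a
  prescribed value.\<close>

lemma diag_sum_eq_sum_eigenvalues:
  fixes A :: "complex Matrix.mat"
  assumes A: "A \<in> carrier_mat n n"
  obtains es where "length es = n" "sum_list es = (\<Sum>i<n. A $$ (i, i))"
    "\<And>e. e \<in> set es \<Longrightarrow> eigenvalue A e"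
proof -
  obtain es where es: "char_poly A = (\<Prod>a\<leftarrow>es. [:- a, 1:])" "length es = n"
    using char_poly_factorized[OF A] by auto
  obtain B P Q where s: "schur_decomposition A es = (B, P, Q)"
    by (cases "schur_decomposition A es") auto
  have w: "similar_mat_wit A B P Q" and d: "diag_mat B = es"
    using schur_decomposition[OF A es(1) s] by auto
  note w' = similar_mat_witD2[OF A w]
  have c: "B \<in> carrier_mat n n" "P \<in> carrier_mat n n" "Q \<in> carrier_mat n n"
    using w' by auto
  have "(\<Sum>i<n. A $$ (i, i)) = (\<Sum>i<n. (P * (B * Q)) $$ (i, i))"
    using w' assoc_mult_mat[OF c(2,1,3)] by simp
  also have "\<dots> = (\<Sum>i<n. ((B * Q) * P) $$ (i, i))"
    using c by (intro diag_sum_mult_commute) auto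
  also have "(B * Q) * P = B"
    using w' assoc_mult_mat[OF c(1,3,2)] right_mult_one_mat[OF c(1)] by simp
  also have "(\<Sum>i<n. B $$ (i, i)) = sum_list es"
    using c unfolding d[symmetric] diag_mat_def
    by (simp add: sum_list_distinct_conv_sum_set atLeast0LessThan)
  finally have "sum_list es = (\<Sum>i<n. A $$ (i, i))" by simp
  moreover have "eigenvalue A e" if "e \<in> set es" for e
  proof -
    have "poly (char_poly A) e = 0"
      using that unfolding es(1) poly_prod_list by (auto simp: prod_list_zero_iff)
    then show ?thesis using eigenvalue_root_char_poly[OF A] by simp
  qed
  ultimately show ?thesis using es(2) that by blast
qed

text \<open>Deflation: replacing the known eigenvalues by a real number \<open>c\<close> different from the
  average of the remaining ones forces an eigenvalue other than \<open>c\<close>, whose eigenvector is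
  orthogonal to the known ones.\<close>

lemma hermitian_next_eigenvector:
  fixes H u :: "nat \<Rightarrow> nat \<Rightarrow> complex" and l :: "nat \<Rightarrow> real"
  assumes herm: "\<And>i j. i < n \<Longrightarrow> j < n \<Longrightarrow> H j i = cnj (H i j)"
    and k: "k < n"
    and orth: "\<And>p q. p < k \<Longrightarrow> q < k \<Longrightarrow> (\<Sum>i<n. u p i * cnj (u q i)) = (if p = q then 1 else 0)"
    and eig: "\<And>p i. p < k \<Longrightarrow> i < n \<Longrightarrow> (\<Sum>j<n. H i j * u p j) = of_real (l p) * u p i"
  obtains v c where "(\<Sum>i<n. v i * cnj (v i)) = 1"
    "\<And>p. p < k \<Longrightarrow> (\<Sum>i<n. v i * cnj (u p i)) = 0"
    "\<And>i. i < n \<Longrightarrow> (\<Sum>j<n. H i j * v j) = of_real c * v i"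
proof -
  define T where "T = (\<Sum>i<n. H i i) - (\<Sum>p<k. of_real (l p))"
  \<comment> \<open>The summand 1 moves \<open>c\<close> off the average of the remaining
    eigenvalues, so these cannot all be equal to \<open>c\<close>.\<close>
  define c where "c = Re T / real (n - k) + 1"
  have c: "of_nat (n - k) * of_real c \<noteq> T"
  proof
    assume *: "of_nat (n - k) * of_real c = T"
    have "Re (of_nat (n - k) * of_real c) = real (n - k) * c" by simp
    then have "real (n - k) * c = Re T" unfolding * by simp
    moreover have "real (n - k) * c = Re T + real (n - k)"
      using k by (simp add: c_def distrib_left del: of_nat_diff)
    ultimately show False using k by simp
  qed
  \<comment> \<open>Rank-one corrections move every known eigenvalue \<open>l p\<close> to
    \<open>c\<close> and do not change the action on the orthogonal complement of the known
    eigenvectors.\<close>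
  define A where "A = (\<lambda>i j. H i j + (\<Sum>p<k. of_real (c - l p) * u p i * cnj (u p j)))"
  define A' where "A' = Matrix.mat n n (\<lambda>(i, j). A i j)"
  have A': "A' \<in> carrier_mat n n" by (simp add: A'_def)
  obtain es where es: "length es = n" "sum_list es = (\<Sum>i<n. A' $$ (i, i))"
    "\<And>e. e \<in> set es \<Longrightarrow> eigenvalue A' e"
    using diag_sum_eq_sum_eigenvalues[OF A'] by blast
  have "(\<Sum>i<n. A' $$ (i, i)) = (\<Sum>i<n. H i i) + (\<Sum>i<n. \<Sum>p<k. of_real (c - l p) * (u p i * cnj (u p i)))"
    by (simp add: A'_def A_def sum.distrib mult.assoc)
  also have "(\<Sum>i<n. \<Sum>p<k. of_real (c - l p) * (u p i * cnj (u p i)))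
      = (\<Sum>p<k. of_real (c - l p) * (\<Sum>i<n. u p i * cnj (u p i)))"
    by (subst sum.swap) (simp add: sum_distrib_left)
  also have "\<dots> = (\<Sum>p<k. of_real (c - l p))"
    by (intro sum.cong) (auto simp: orth)
  also have "\<dots> = of_nat k * of_real c - (\<Sum>p<k. of_real (l p))"
    by (simp add: sum_subtractf)
  finally have tr: "(\<Sum>i<n. A' $$ (i, i)) = T + of_nat k * of_real c"
    by (simp add: T_def)
  \<comment> \<open>If every eigenvalue were \<open>c\<close>, the trace would be
    \<open>n * c\<close>; it is \<open>T + k * c\<close>.\<close>
  have "\<exists>e\<in>set es. e \<noteq> of_real c"
  proof (rule ccontr)
    assume "\<not> ?thesis"
    then have "\<And>e. e \<in> set es \<Longrightarrow> e = of_real c" by auto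
    then have "sum_list es = of_nat (length es) * of_real c"
      by (induction es) (auto simp: algebra_simps)
    then have "of_nat n * of_real c = T + of_nat k * of_real c" using es tr by simp
    then have "of_nat (n - k) * of_real c = T" using k by (simp add: of_nat_diff algebra_simps)
    then show False using c by simp
  qed
  then obtain e where e: "e \<in> set es" "e \<noteq> of_real c" by blast
  obtain w where w: "w \<in> carrier_vec n" "w \<noteq> 0\<^sub>v n" "A' *\<^sub>v w = e \<cdot>\<^sub>v w"
    using es(3)[OF e(1)] A' unfolding eigenvalue_def eigenvector_def by auto
  define x where "x = (\<lambda>i. vec_index w i)"
  have Ax: "(\<Sum>j<n. A i j * x j) = e * x i" if "i < n" for i
  proof -
    have "vec_index (A' *\<^sub>v w) i = vec_index (e \<cdot>\<^sub>v w) i" using w by simp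
    then show ?thesis using that w(1) A'
      by (simp add: x_def scalar_prod_def A'_def atLeast0LessThan)
  qed
  have hermA: "A j i = cnj (A i j)" if "i < n" "j < n" for i j
    using herm[OF that] by (simp add: A_def mult.commute mult.left_commute)
  have Au: "(\<Sum>j<n. A i j * u q j) = of_real c * u q i" if "q < k" "i < n" for q i
  proof -
    have "(\<Sum>j<n. A i j * u q j) = (\<Sum>j<n. H i j * u q j)
        + (\<Sum>j<n. \<Sum>p<k. of_real (c - l p) * u p i * (u q j * cnj (u p j)))"
      by (simp only: A_def distrib_right sum.distrib sum_distrib_right) (simp only: mult_ac)
    also have "(\<Sum>j<n. \<Sum>p<k. of_real (c - l p) * u p i * (u q j * cnj (u p j)))
       = (\<Sum>p<k. of_real (c - l p) * u p i * (\<Sum>j<n. u q j * cnj (u p j)))"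
      by (subst sum.swap) (simp add: sum_distrib_left)
    also have "\<dots> = (\<Sum>p<k. if p = q then of_real (c - l q) * u q i else 0)"
      using that by (intro sum.cong) (auto simp: orth)
    finally show ?thesis using that by (simp add: eig algebra_simps)
  qed
  have sym: "(\<Sum>i<n. (\<Sum>j<n. A i j * y j) * cnj (z i)) = (\<Sum>i<n. y i * cnj (\<Sum>j<n. A i j * z j))" for y z
  proof -
    have "(\<Sum>i<n. (\<Sum>j<n. A i j * y j) * cnj (z i)) = (\<Sum>i<n. \<Sum>j<n. A i j * y j * cnj (z i))"
      by (simp add: sum_distrib_right)
    also have "\<dots> = (\<Sum>j<n. \<Sum>i<n. A i j * y j * cnj (z i))" by (rule sum.swap)
    also have "\<dots> = (\<Sum>j<n. \<Sum>i<n. y j * cnj (A j i * z i))"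
      proof (intro sum.cong refl)
      fix i j assume "j \<in> {..<n}" "i \<in> {..<n}"
      then have "A i j = cnj (A j i)" using hermA[of j i] by simp
      then show "A i j * y j * cnj (z i) = y j * cnj (A j i * z i)" by simp
    qed
    finally show ?thesis by (simp add: sum_distrib_left)
  qed
  have ortho: "(\<Sum>i<n. x i * cnj (u p i)) = 0" if "p < k" for p
  proof -
    have "(\<Sum>i<n. e * x i * cnj (u p i)) = (\<Sum>i<n. x i * cnj (of_real c * u p i))"
      using sym[of x "u p"] that by (simp add: Ax Au)
    then have "e * (\<Sum>i<n. x i * cnj (u p i)) = of_real c * (\<Sum>i<n. x i * cnj (u p i))"
      by (simp add: sum_distrib_left mult_ac)
    then show ?thesis using e(2) by simp
  qed
  have Hx: "(\<Sum>j<n. H i j * x j) = e * x i" if "i < n" for i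
  proof -
    have "(\<Sum>j<n. A i j * x j) = (\<Sum>j<n. H i j * x j)
        + (\<Sum>j<n. \<Sum>p<k. of_real (c - l p) * u p i * (x j * cnj (u p j)))"
      by (simp only: A_def distrib_right sum.distrib sum_distrib_right) (simp only: mult_ac)
    also have "(\<Sum>j<n. \<Sum>p<k. of_real (c - l p) * u p i * (x j * cnj (u p j)))
       = (\<Sum>p<k. of_real (c - l p) * u p i * (\<Sum>j<n. x j * cnj (u p j)))"
      by (subst sum.swap) (simp add: sum_distrib_left)
    also have "\<dots> = 0" by (simp add: ortho)
    finally show ?thesis using Ax[OF that] by simp
  qed
  define S where "S = (\<Sum>i<n. (cmod (x i))\<^sup>2)"
  have S: "(\<Sum>i<n. x i * cnj (x i)) = of_real S"
    unfolding S_def of_real_sum complex_norm_square ..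
  have "\<exists>i<n. x i \<noteq> 0"
  proof (rule ccontr)
    assume "\<not> ?thesis"
    then have "w = 0\<^sub>v n" using w(1) by (intro eq_vecI) (auto simp: x_def)
    then show False using w(2) by simp
  qed
  then obtain i where "i < n" "x i \<noteq> 0" by blast
  then have S0: "S > 0"
    unfolding S_def by (intro sum_pos2[of _ i]) auto
  have "(\<Sum>i<n. e * x i * cnj (x i)) = (\<Sum>i<n. x i * cnj (e * x i))"
    using sym[of x x] by (simp add: Ax)
  then have "e * of_real S = cnj e * of_real S"
    unfolding S[symmetric] by (simp add: sum_distrib_left mult_ac)
  then have e_real: "e = of_real (Re e)" using S0 by (simp add: complex_eq_iff)
  define v where "v = (\<lambda>i. x i / of_real (sqrt S))"
  show ?thesis
  proof (rule that[of v "Re e"])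
    have "(\<Sum>i<n. v i * cnj (v i)) = (\<Sum>i<n. x i * cnj (x i)) / of_real (sqrt S * sqrt S)"
      unfolding sum_divide_distrib by (intro sum.cong refl) (simp add: v_def del: real_sqrt_mult_self)
    then show "(\<Sum>i<n. v i * cnj (v i)) = 1" using S S0 by simp
    show "(\<Sum>i<n. v i * cnj (u p i)) = 0" if "p < k" for p
      using ortho[OF that] by (simp add: v_def sum_divide_distrib[symmetric])
    show "(\<Sum>j<n. H i j * v j) = of_real (Re e) * v i" if "i < n" for i
      using Hx[OF that] e_real by (simp add: v_def sum_divide_distrib[symmetric])
  qed
qed

lemma hermitian_orthonormal_eigenvectors:
  fixes H :: "nat \<Rightarrow> nat \<Rightarrow> complex"
  assumes herm: "\<And>i j. i < n \<Longrightarrow> j < n \<Longrightarrow> H j i = cnj (H i j)"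
  shows "k \<le> n \<Longrightarrow> \<exists>u (l :: nat \<Rightarrow> real).
    (\<forall>p<k. \<forall>q<k. (\<Sum>i<n. u p i * cnj (u q i)) = (if p = q then 1 else 0)) \<and>
    (\<forall>p<k. \<forall>i<n. (\<Sum>j<n. H i j * u p j) = of_real (l p) * u p i)"
proof (induction k)
  case 0
  then show ?case by simp
next
  case (Suc k)
  then obtain u l where u: "\<And>p q. p < k \<Longrightarrow> q < k \<Longrightarrow> (\<Sum>i<n. u p i * cnj (u q i)) = (if p = q then 1 else 0)"
    and l: "\<And>p i. p < k \<Longrightarrow> i < n \<Longrightarrow> (\<Sum>j<n. H i j * u p j) = of_real (l p :: real) * u p i"
    using Suc_leD[OF Suc.prems] by blast
  have "k < n" using Suc by simp
  from hermitian_next_eigenvector[OF herm this u l] obtain v c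
    where v: "(\<Sum>i<n. v i * cnj (v i)) = 1"
      "\<And>p. p < k \<Longrightarrow> (\<Sum>i<n. v i * cnj (u p i)) = 0"
      "\<And>i. i < n \<Longrightarrow> (\<Sum>j<n. H i j * v j) = of_real c * v i"
    by blast
  have v': "(\<Sum>i<n. u p i * cnj (v i)) = 0" if "p < k" for p
  proof -
    have "(\<Sum>i<n. u p i * cnj (v i)) = cnj (\<Sum>i<n. v i * cnj (u p i))" by (simp add: mult.commute)
    then show ?thesis using v(2)[OF that] by simp
  qed
  show ?case
    by (rule exI[of _ "u(k := v)"], rule exI[of _ "l(k := c)"])
      (use u l v v' in \<open>auto simp: less_Suc_eq\<close>)
qed

text \<open>A square matrix with orthonormal columns is unitary, which gives the completeness
  relation. The determinant follows from \<open>?A * U = U * D\<close> with \<open>D\<close>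
  diagonal, by cancelling the nonzero determinant of \<open>U\<close>.\<close>

lemma hermitian_spectral:
  fixes H :: "nat \<Rightarrow> nat \<Rightarrow> complex"
  assumes herm: "\<And>i j. i < n \<Longrightarrow> j < n \<Longrightarrow> H j i = cnj (H i j)"
  obtains u :: "nat \<Rightarrow> nat \<Rightarrow> complex" and l :: "nat \<Rightarrow> real"
  where "\<And>p q. p < n \<Longrightarrow> q < n \<Longrightarrow> (\<Sum>i<n. u p i * cnj (u q i)) = (if p = q then 1 else 0)"
    "\<And>i j. i < n \<Longrightarrow> j < n \<Longrightarrow> (\<Sum>p<n. u p i * cnj (u p j)) = (if i = j then 1 else 0)"
    "\<And>p i. p < n \<Longrightarrow> i < n \<Longrightarrow> (\<Sum>j<n. H i j * u p j) = of_real (l p) * u p i"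
    "\<And>z. Determinant.det (Matrix.mat n n (\<lambda>(i, j). (if i = j then 1 else 0) + z * H i j))
       = (\<Prod>p<n. 1 + z * of_real (l p))"
proof -
  obtain u l where u: "\<And>p q. p < n \<Longrightarrow> q < n \<Longrightarrow> (\<Sum>i<n. u p i * cnj (u q i)) = (if p = q then 1 else 0)"
    and l: "\<And>p i. p < n \<Longrightarrow> i < n \<Longrightarrow> (\<Sum>j<n. H i j * u p j) = of_real (l p :: real) * u p i"
    using hermitian_orthonormal_eigenvectors[of n H, OF herm order_refl] by blast
  define U where "U = Matrix.mat n n (\<lambda>(i, p). u p i)"
  define V where "V = Matrix.mat n n (\<lambda>(p, i). cnj (u p i))"
  have carr: "U \<in> carrier_mat n n" "V \<in> carrier_mat n n" by (auto simp: U_def V_def)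
  have VU: "V * U = 1\<^sub>m n"
  proof (rule eq_matI)
    fix i j assume *: "i < dim_row (1\<^sub>m n :: complex Matrix.mat)" "j < dim_col (1\<^sub>m n :: complex Matrix.mat)"
    then have "(V * U) $$ (i, j) = (\<Sum>k<n. u j k * cnj (u i k))"
      by (simp add: U_def V_def scalar_prod_def atLeast0LessThan mult.commute)
    then show "(V * U) $$ (i, j) = 1\<^sub>m n $$ (i, j)" using u[of j i] * by auto
  qed (auto simp: U_def V_def)
  then have UV: "U * V = 1\<^sub>m n"
    using mat_mult_left_right_inverse[OF carr(2,1)] by blast
  have complete: "(\<Sum>p<n. u p i * cnj (u p j)) = (if i = j then 1 else 0)" if "i < n" "j < n" for i j
  proof -
    have "(U * V) $$ (i, j) = (\<Sum>p<n. u p i * cnj (u p j))"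
      using that by (simp add: U_def V_def scalar_prod_def atLeast0LessThan)
    then show ?thesis using UV that by simp
  qed
  have det: "Determinant.det (Matrix.mat n n (\<lambda>(i, j). (if i = j then 1 else 0) + z * H i j))
       = (\<Prod>p<n. 1 + z * of_real (l p))" (is "Determinant.det ?A = _") for z
  proof -
    define D where "D = Matrix.mat n n (\<lambda>(p, q). if p = q then 1 + z * of_real (l p) else 0)"
    have A: "?A \<in> carrier_mat n n" and D: "D \<in> carrier_mat n n" by (auto simp: D_def)
    have "?A * U = U * D"
    proof (rule eq_matI)
      fix i p assume "i < dim_row (U * D)" "p < dim_col (U * D)"
      then have ip: "i < n" "p < n" by (auto simp: U_def D_def)
      have "(?A * U) $$ (i, p) = (\<Sum>j<n. ((if i = j then 1 else 0) + z * H i j) * u p j)"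
        using ip by (simp add: U_def scalar_prod_def atLeast0LessThan)
      also have "\<dots> = (\<Sum>j<n. (if i = j then u p j else 0)) + z * (\<Sum>j<n. H i j * u p j)"
        unfolding sum_distrib_left sum.distrib[symmetric]
        by (intro sum.cong refl) (simp add: distrib_right mult.assoc)
      also have "\<dots> = u p i * (1 + z * of_real (l p))"
        using ip by (simp add: l algebra_simps)
      also have "\<dots> = (\<Sum>q<n. if q = p then u p i * (1 + z * of_real (l p)) else 0)"
        using ip by simp
      also have "\<dots> = (U * D) $$ (i, p)"
        using ip by (simp add: U_def D_def scalar_prod_def atLeast0LessThan if_distrib cong: if_cong)
      finally show "(?A * U) $$ (i, p) = (U * D) $$ (i, p)" .
    qed (auto simp: U_def D_def)
    then have "Determinant.det ?A * Determinant.det U = Determinant.det U * Determinant.det D"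
      unfolding det_mult[OF A carr(1), symmetric] det_mult[OF carr(1) D, symmetric] by (rule arg_cong)
    moreover have "Determinant.det U \<noteq> 0"
      using det_mult[OF carr(2,1)] VU by auto
    ultimately have "Determinant.det ?A = Determinant.det D" by simp
    also have "\<dots> = prod_list (diag_mat D)"
      by (rule det_upper_triangular[OF _ D]) (auto simp: D_def)
    also have "\<dots> = (\<Prod>p<n. 1 + z * of_real (l p))"
      unfolding diag_mat_def by (simp add: D_def prod.distinct_set_conv_list[symmetric] atLeast0LessThan)
    finally show ?thesis .
  qed
  show ?thesis using that[OF u complete l det] .
qed

subsection \<open>Principal minors\<close>

text \<open>Leibniz's formula for the principal minor with rows and columns in \<open>S\<close>;
  summing over permutations of the set itself spares an enumeration of \<open>S\<close>.\<close>

definition minor_sum :: "(nat \<Rightarrow> nat \<Rightarrow> complex) \<Rightarrow> nat set \<Rightarrow> complex" where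
  "minor_sum A S = (\<Sum>p | p permutes S. of_int (sign p) * (\<Prod>i\<in>S. A i (p i)))"

text \<open>Expanding the product over \<open>i\<close> of
  \<open>z * A i (p i) + (if i = p i then 1 else 0)\<close> selects a set \<open>S\<close> of
  indices for the first summand. The indicators on the complement leave exactly the permutations of
  \<open>S\<close>.\<close>

lemma det_one_plus_eq_sum_minors:
  fixes A :: "nat \<Rightarrow> nat \<Rightarrow> complex"
  shows "Determinant.det (Matrix.mat n n (\<lambda>(i, j). (if i = j then 1 else 0) + z * A i j))
    = (\<Sum>S\<in>Pow {..<n}. z ^ card S * minor_sum A S)"
proof -
  define P where "P = {p. p permutes {..<n}}"
  have finP: "finite P" unfolding P_def by (rule finite_permutations) simp
  have "Determinant.det (Matrix.mat n n (\<lambda>(i, j). (if i = j then 1 else 0) + z * A i j))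
    = (\<Sum>p\<in>P. of_int (sign p) * (\<Prod>i<n. z * A i (p i) + (if i = p i then 1 else 0)))"
    by (subst det_def') (auto simp: P_def atLeast0LessThan add.commute permutes_in_image intro!: sum.cong prod.cong)
  also have "\<dots> = (\<Sum>p\<in>P. of_int (sign p) * (\<Sum>S\<in>Pow {..<n}. (\<Prod>i\<in>S. z * A i (p i)) * (\<Prod>i\<in>{..<n} - S. if i = p i then 1 else 0)))"
    by (subst prod_add) auto
  also have "\<dots> = (\<Sum>S\<in>Pow {..<n}. \<Sum>p\<in>P. of_int (sign p) * ((\<Prod>i\<in>S. z * A i (p i)) * (\<Prod>i\<in>{..<n} - S. if i = p i then 1 else 0)))"
    unfolding sum_distrib_left by (rule sum.swap)
  also have "\<dots> = (\<Sum>S\<in>Pow {..<n}. z ^ card S * minor_sum A S)"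
  proof (intro sum.cong refl)
    fix S assume "S \<in> Pow {..<n}"
    then have S: "S \<subseteq> {..<n}" by simp
    have finS: "finite S" using S finite_subset by blast
    have "(\<Sum>p\<in>P. of_int (sign p) * ((\<Prod>i\<in>S. z * A i (p i)) * (\<Prod>i\<in>{..<n} - S. if i = p i then 1 else 0)))
      = (\<Sum>p | p permutes S. of_int (sign p) * ((\<Prod>i\<in>S. z * A i (p i)) * (\<Prod>i\<in>{..<n} - S. if i = p i then 1 else 0)))"
    proof (rule sum.mono_neutral_right[OF finP])
      show "{p. p permutes S} \<subseteq> P" using S permutes_subset unfolding P_def by blast
      show "\<forall>p\<in>P - {p. p permutes S}. complex_of_int (sign p) * ((\<Prod>i\<in>S. z * A i (p i)) * (\<Prod>i\<in>{..<n} - S. if i = p i then 1 else 0)) = 0"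
      proof
        fix p assume "p \<in> P - {p. p permutes S}"
        then have p: "p permutes {..<n}" "\<not> p permutes S" by (auto simp: P_def)
        have "\<exists>i\<in>{..<n} - S. i \<noteq> p i"
        proof (rule ccontr)
          assume "\<not> ?thesis"
          then have "\<And>i. i \<notin> S \<Longrightarrow> p i = i" using permutes_not_in[OF p(1)] by (metis DiffI)
          then have "p permutes S" using permutes_superset[OF p(1)] by blast
          then show False using p by simp
        qed
        then have "(\<Prod>i\<in>{..<n} - S. if i = p i then 1 else (0::complex)) = 0" by auto
        then show "complex_of_int (sign p) * ((\<Prod>i\<in>S. z * A i (p i)) * (\<Prod>i\<in>{..<n} - S. if i = p i then 1 else 0)) = 0" by simp
      qed
    qed
    also have "\<dots> = (\<Sum>p | p permutes S. z ^ card S * (of_int (sign p) * (\<Prod>i\<in>S. A i (p i))))"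
    proof (intro sum.cong refl)
      fix p assume "p \<in> {p. p permutes S}"
      then have "\<And>i. i \<notin> S \<Longrightarrow> p i = i" by (simp add: permutes_not_in)
      then have "(\<Prod>i\<in>{..<n} - S. if i = p i then 1 else (0::complex)) = 1" by (intro prod.neutral) auto
      then show "complex_of_int (sign p) * ((\<Prod>i\<in>S. z * A i (p i)) * (\<Prod>i\<in>{..<n} - S. if i = p i then 1 else 0))
        = z ^ card S * (of_int (sign p) * (\<Prod>i\<in>S. A i (p i)))"
        by (simp add: prod.distrib)
    qed
    finally show "(\<Sum>p\<in>P. of_int (sign p) * ((\<Prod>i\<in>S. z * A i (p i)) * (\<Prod>i\<in>{..<n} - S. if i = p i then 1 else 0)))
       = z ^ card S * minor_sum A S"
      by (simp add: minor_sum_def sum_distrib_left)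
  qed
  finally show ?thesis .
qed

text \<open>Conjugation by the bijection \<open>x\<close> carries permutations of
  \<open>{..<k}\<close> to permutations of \<open>S\<close> and preserves signs, so every
  enumeration of \<open>S\<close> gives the same determinant.\<close>

lemma det_reindexed_eq_minor_sum:
  assumes b: "bij_betw x {..<k} S"
  shows "Determinant.det (Matrix.mat k k (\<lambda>(i, j). A (x i) (x j))) = minor_sum A S"
proof -
  define y where "y = inv_into {..<k} x"
  have yx: "\<And>i. i < k \<Longrightarrow> y (x i) = i" and xy: "\<And>s. s \<in> S \<Longrightarrow> x (y s) = s"
    using b unfolding y_def bij_betw_def by (auto intro: f_inv_into_f)
  have S: "S = x ` {..<k}" and inj: "inj_on x {..<k}" using b by (auto simp: bij_betw_def)
  have conv: "bij_betw (\<lambda>p s. if s \<in> S then x (p (y s)) else s) {p. p permutes {..<k}} {p. p permutes S}"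
    (is "bij_betw ?F _ _")
    using bij_betw_permutations[OF b] unfolding y_def .
  have "minor_sum A S = (\<Sum>p | p permutes {..<k}. of_int (sign (?F p)) * (\<Prod>s\<in>S. A s (?F p s)))"
    unfolding minor_sum_def by (rule sum.reindex_bij_betw[OF conv, symmetric])
  also have "\<dots> = (\<Sum>p | p permutes {..<k}. of_int (sign p) * (\<Prod>i<k. A (x i) (x (p i))))"
  proof (intro sum.cong refl)
    fix p assume "p \<in> {p. p permutes {..<k}}"
    then have p: "p permutes {..<k}" by simp
    have "?F p = map_permutation {..<k} x p"
      by (simp add: S y_def map_permutation_def fun_eq_iff)
    then have "sign (?F p) = sign p"
      using sign_map_permutation[OF inj p] by simp
    moreover have "(\<Prod>s\<in>S. A s (?F p s)) = (\<Prod>i<k. A (x i) (x (p i)))"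
      using prod.reindex_bij_betw[OF b, of "\<lambda>s. A s (?F p s)", symmetric]
      by (auto intro!: prod.cong simp: yx S)
    ultimately show "of_int (sign (?F p)) * (\<Prod>s\<in>S. A s (?F p s)) = of_int (sign p) * (\<Prod>i<k. A (x i) (x (p i)))"
      by simp
  qed
  also have "\<dots> = Determinant.det (Matrix.mat k k (\<lambda>(i, j). A (x i) (x j)))"
    by (subst det_def') (auto simp: atLeast0LessThan permutes_in_image intro!: sum.cong prod.cong)
  finally show ?thesis by simp
qed

lemma card_bij_extensional:
  assumes "finite S" "card S = k"
  shows "card {x \<in> {..<k} \<rightarrow>\<^sub>E S. bij_betw x {..<k} S} = fact k"
proof -
  have "{x \<in> {..<k} \<rightarrow>\<^sub>E S. bij_betw x {..<k} S} = {x \<in> {..<k} \<rightarrow>\<^sub>E S. inj_on x {..<k}}"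
  proof (intro Collect_cong conj_cong refl iffI)
    fix x assume x: "x \<in> {..<k} \<rightarrow>\<^sub>E S" "inj_on x {..<k}"
    have "x ` {..<k} \<subseteq> S" using x by auto
    moreover have "card (x ` {..<k}) = card S" using x assms by (simp add: card_image)
    ultimately have "x ` {..<k} = S" using assms by (metis card_subset_eq)
    then show "bij_betw x {..<k} S" using x by (simp add: bij_betw_def)
  qed (auto simp: bij_betw_def)
  also have "card \<dots> = prod ((-) k) {0..<k}"
    using card_inj_on_subset_funcset[of "{..<k}" S "{..<k}"] assms by simp
  also have "\<dots> = fact k"
    by (simp add: fact_prod_rev atLeast0LessThan)
  finally show ?thesis .
qed

text \<open>A tuple with a repetition produces two equal rows, and a set of size \<open>k\<close> is
  the image of \<open>fact k\<close> injective tuples.\<close>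

lemma sum_minors_eq_sum_tuples:
  fixes A :: "nat \<Rightarrow> nat \<Rightarrow> complex"
  shows "(\<Sum>x\<in>{..<k} \<rightarrow>\<^sub>E {..<n}. Determinant.det (Matrix.mat k k (\<lambda>(i, j). A (x i) (x j))))
    = fact k * (\<Sum>S | S \<subseteq> {..<n} \<and> card S = k. minor_sum A S)"
proof -
  define F where "F = {x \<in> {..<k} \<rightarrow>\<^sub>E {..<n}. inj_on x {..<k}}"
  define T where "T = {S. S \<subseteq> {..<n} \<and> card S = k}"
  define B where "B = (\<lambda>S :: nat set. {x \<in> {..<k} \<rightarrow>\<^sub>E S. bij_betw x {..<k} S})"
  have finE: "finite ({..<k} \<rightarrow>\<^sub>E {..<n})" by (intro finite_PiE) auto
  have finT: "finite T" unfolding T_def by (rule finite_subset[of _ "Pow {..<n}"]) auto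
  have finB: "finite (B S)" if "S \<in> T" for S
    unfolding B_def
    by (rule finite_subset[of _ "{..<k} \<rightarrow>\<^sub>E S"]) (use that in \<open>auto simp: T_def intro!: finite_PiE finite_subset[of S]\<close>)
  have F: "F = (\<Union>S\<in>T. B S)"
  proof (rule subset_antisym; rule subsetI)
    fix x assume "x \<in> F"
    then have "x ` {..<k} \<in> T" "x \<in> B (x ` {..<k})"
      by (auto simp: F_def T_def B_def card_image bij_betw_def PiE_iff)
    then show "x \<in> (\<Union>S\<in>T. B S)" by blast
  qed (auto simp: F_def T_def B_def bij_betw_def PiE_iff)
  have "(\<Sum>x\<in>{..<k} \<rightarrow>\<^sub>E {..<n}. Determinant.det (Matrix.mat k k (\<lambda>(i, j). A (x i) (x j))))
    = (\<Sum>x\<in>F. Determinant.det (Matrix.mat k k (\<lambda>(i, j). A (x i) (x j))))"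
  proof (rule sum.mono_neutral_right[OF finE])
    show "\<forall>x\<in>({..<k} \<rightarrow>\<^sub>E {..<n}) - F. Determinant.det (Matrix.mat k k (\<lambda>(i, j). A (x i) (x j))) = 0"
    proof
      fix x assume "x \<in> ({..<k} \<rightarrow>\<^sub>E {..<n}) - F"
      then obtain i j where "i < k" "j < k" "i \<noteq> j" "x i = x j"
        by (auto simp: F_def inj_on_def)
      then show "Determinant.det (Matrix.mat k k (\<lambda>(i, j). A (x i) (x j))) = 0"
        by (intro det_identical_rows[of _ k i j]) (auto intro!: eq_vecI)
    qed
  qed (auto simp: F_def)
  also have "\<dots> = (\<Sum>S\<in>T. \<Sum>x\<in>B S. Determinant.det (Matrix.mat k k (\<lambda>(i, j). A (x i) (x j))))"
    unfolding F
  proof (rule sum.UNION_disjoint[OF finT])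
    show "\<forall>S\<in>T. \<forall>S'\<in>T. S \<noteq> S' \<longrightarrow> B S \<inter> B S' = {}"
      by (auto simp: B_def bij_betw_def)
  qed (use finB in auto)
  also have "\<dots> = (\<Sum>S\<in>T. \<Sum>x\<in>B S. minor_sum A S)"
    by (intro sum.cong refl det_reindexed_eq_minor_sum) (auto simp: B_def)
  also have "\<dots> = (\<Sum>S\<in>T. fact k * minor_sum A S)"
  proof (intro sum.cong refl)
    fix S assume "S \<in> T"
    then have "finite S" "card S = k" by (auto simp: T_def intro: finite_subset)
    from card_bij_extensional[OF this] show "(\<Sum>x\<in>B S. minor_sum A S) = fact k * minor_sum A S"
      by (simp add: B_def)
  qed
  finally show ?thesis by (simp add: T_def sum_distrib_left)
qed

text \<open>The Fredholm expansion in finite form. Sums over tuples instead of sets match the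
  integrals over tuples in \<open>correlation_function\<close>.\<close>

lemma det_one_plus_eq_sum_tuples:
  fixes A :: "nat \<Rightarrow> nat \<Rightarrow> complex"
  shows "Determinant.det (Matrix.mat n n (\<lambda>(i, j). (if i = j then 1 else 0) + z * A i j))
    = (\<Sum>k\<le>n. z ^ k / fact k *
        (\<Sum>x\<in>{..<k} \<rightarrow>\<^sub>E {..<n}. Determinant.det (Matrix.mat k k (\<lambda>(i, j). A (x i) (x j)))))"
proof -
  have "(\<Sum>S\<in>Pow {..<n}. z ^ card S * minor_sum A S)
    = (\<Sum>k\<le>n. \<Sum>S | S \<in> Pow {..<n} \<and> card S = k. z ^ card S * minor_sum A S)"
  proof (rule sum.group[symmetric])
    show "card ` Pow {..<n} \<subseteq> {..n}"
    proof
      fix k assume "k \<in> card ` Pow {..<n}"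
      then obtain S where "S \<subseteq> {..<n}" "k = card S" by auto
      then show "k \<in> {..n}" using card_mono[of "{..<n}" S] by simp
    qed
  qed auto
  also have "\<dots> = (\<Sum>k\<le>n. z ^ k * (\<Sum>S | S \<subseteq> {..<n} \<and> card S = k. minor_sum A S))"
  proof (intro sum.cong refl)
    fix k
    have "(\<Sum>S | S \<in> Pow {..<n} \<and> card S = k. z ^ card S * minor_sum A S)
      = (\<Sum>S | S \<subseteq> {..<n} \<and> card S = k. z ^ k * minor_sum A S)"
      by (intro sum.cong) auto
    then show "(\<Sum>S | S \<in> Pow {..<n} \<and> card S = k. z ^ card S * minor_sum A S)
      = z ^ k * (\<Sum>S | S \<subseteq> {..<n} \<and> card S = k. minor_sum A S)"
      by (simp only: sum_distrib_left)
  qed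
  finally show ?thesis
    unfolding det_one_plus_eq_sum_minors sum_minors_eq_sum_tuples by simp
qed

lemma tuple_sum_eq_0_of_gt:
  fixes A :: "nat \<Rightarrow> nat \<Rightarrow> complex"
  assumes "n < k"
  shows "(\<Sum>x\<in>{..<k} \<rightarrow>\<^sub>E {..<n}. Determinant.det (Matrix.mat k k (\<lambda>(i, j). A (x i) (x j)))) = 0"
proof -
  have "{S. S \<subseteq> {..<n} \<and> card S = k} = {}"
  proof (rule ccontr)
    assume "\<not> ?thesis"
    then obtain S where "S \<subseteq> {..<n}" "card S = k" by blast
    then show False using assms card_mono[of "{..<n}" S] by simp
  qed
  then show ?thesis unfolding sum_minors_eq_sum_tuples by (simp only: sum.empty mult_zero_right)
qed

subsection \<open>Leading minors of Toeplitz matrices\<close>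

definition herm_form :: "(nat \<Rightarrow> nat \<Rightarrow> complex) \<Rightarrow> nat \<Rightarrow> (nat \<Rightarrow> complex) \<Rightarrow> complex" where
  "herm_form H n v = (\<Sum>i<n. cnj (v i) * (\<Sum>j<n. H i j * v j))"

text \<open>For the Hermitian matrices considered here the determinant is real, so the real part
  discards nothing.\<close>

definition leading_minor :: "(nat \<Rightarrow> nat \<Rightarrow> complex) \<Rightarrow> nat \<Rightarrow> real" where
  "leading_minor H n = Re (Determinant.det (Matrix.mat n n (\<lambda>(i, j). H i j)))"

text \<open>Indices run over all naturals so that one matrix contains the sections of every size.
  The lower bound 1 is the one met by the identity plus a positive semidefinite matrix; it keeps all
  leading minors at least 1, so their quotients make sense.\<close>

locale coercive_hermitian =
  fixes H :: "nat \<Rightarrow> nat \<Rightarrow> complex"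
  assumes herm: "\<And>i j. H j i = cnj (H i j)"
    and coercive: "\<And>n v. (\<Sum>i<n. (cmod (v i))\<^sup>2) \<le> Re (herm_form H n v)"
begin

text \<open>The spectral theorem is applied to \<open>H\<close> minus the identity, because its
  determinant formula has the shape \<open>1 + z * M\<close>; \<open>z = 1\<close> gives back
  \<open>H\<close>.\<close>

lemma spectral:
  obtains u :: "nat \<Rightarrow> nat \<Rightarrow> complex" and m :: "nat \<Rightarrow> real"
  where "\<And>i j. i < n \<Longrightarrow> j < n \<Longrightarrow> (\<Sum>p<n. u p i * cnj (u p j)) = (if i = j then 1 else 0)"
    "\<And>p i. p < n \<Longrightarrow> i < n \<Longrightarrow> (\<Sum>j<n. H i j * u p j) = of_real (m p) * u p i"
    "\<And>p. p < n \<Longrightarrow> m p \<ge> 1"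
    "Determinant.det (Matrix.mat n n (\<lambda>(i, j). H i j)) = of_real (\<Prod>p<n. m p)"
proof -
  define M where "M = (\<lambda>i j. H i j - (if i = j then 1 else 0))"
  have hM: "M j i = cnj (M i j)" for i j using herm[of i j] by (simp add: M_def)
  obtain u l where
    o: "\<And>p q. p < n \<Longrightarrow> q < n \<Longrightarrow> (\<Sum>i<n. u p i * cnj (u q i)) = (if p = q then 1 else 0)" and
    c: "\<And>i j. i < n \<Longrightarrow> j < n \<Longrightarrow> (\<Sum>p<n. u p i * cnj (u p j)) = (if i = j then 1 else 0)" and
    e: "\<And>p i. p < n \<Longrightarrow> i < n \<Longrightarrow> (\<Sum>j<n. M i j * u p j) = of_real (l p :: real) * u p i" and
    d: "\<And>z. Determinant.det (Matrix.mat n n (\<lambda>(i, j). (if i = j then 1 else 0) + z * M i j))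
       = (\<Prod>p<n. 1 + z * of_real (l p))"
    using hermitian_spectral[of n M] hM by blast
  have e': "(\<Sum>j<n. H i j * u p j) = of_real (1 + l p) * u p i" if "p < n" "i < n" for p i
  proof -
    have "(\<Sum>j<n. H i j * u p j) = (\<Sum>j<n. M i j * u p j) + (\<Sum>j<n. if i = j then u p j else 0)"
      unfolding sum.distrib[symmetric] by (intro sum.cong refl) (simp add: M_def left_diff_distrib)
    then show ?thesis using that by (simp add: e algebra_simps)
  qed
  have m: "1 + l p \<ge> 1" if p: "p < n" for p
  proof -
    have "complex_of_real (\<Sum>i<n. (cmod (u p i))\<^sup>2) = (\<Sum>i<n. u p i * cnj (u p i))"
      unfolding of_real_sum complex_norm_square ..
    then have n1: "(\<Sum>i<n. (cmod (u p i))\<^sup>2) = 1"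
      using o[OF p p] by (simp del: of_real_sum)
    have "herm_form H n (u p) = of_real (1 + l p) * (\<Sum>i<n. u p i * cnj (u p i))"
      unfolding herm_form_def sum_distrib_left[of _ "\<lambda>i. u p i * cnj (u p i)"]
      by (intro sum.cong refl) (use p in \<open>simp add: e'\<close>)
    then have "herm_form H n (u p) = of_real (1 + l p)" using o[OF p p] by simp
    then show ?thesis using coercive[where n = n and v = "u p"] n1 by simp
  qed
  have d': "Determinant.det (Matrix.mat n n (\<lambda>(i, j). H i j)) = of_real (\<Prod>p<n. 1 + l p)"
    using d[of 1] by (simp add: M_def)
  show ?thesis by (rule that[OF c e' m d'])
qed

lemma leading_minor:
  shows "leading_minor H n \<ge> 1"
    and "Determinant.det (Matrix.mat n n (\<lambda>(i, j). H i j)) = of_real (leading_minor H n)"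
proof -
  obtain u :: "nat \<Rightarrow> nat \<Rightarrow> complex" and m where
    "\<And>i j. i < n \<Longrightarrow> j < n \<Longrightarrow> (\<Sum>p<n. u p i * cnj (u p j)) = (if i = j then 1 else 0)" and
    "\<And>p i. p < n \<Longrightarrow> i < n \<Longrightarrow> (\<Sum>j<n. H i j * u p j) = of_real (m p) * u p i" and
    m: "\<And>p. p < n \<Longrightarrow> m p \<ge> (1::real)"
    "Determinant.det (Matrix.mat n n (\<lambda>(i, j). H i j)) = of_real (\<Prod>p<n. m p)"
    by (rule spectral[of n]; rule that)
  have "(\<Prod>p<n. m p) \<ge> 1" by (rule prod_ge_1) (use m in auto)
  then show "leading_minor H n \<ge> 1" by (simp only: leading_minor_def m Re_complex_of_real)
  show "Determinant.det (Matrix.mat n n (\<lambda>(i, j). H i j)) = of_real (leading_minor H n)"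
    by (simp only: leading_minor_def m Re_complex_of_real)
qed

text \<open>The ratio of consecutive leading minors is a Schur complement, and a Schur complement is
  the minimum of the quadratic form over vectors with last coordinate 1. The minimiser
  \<open>w\<close> solves the first \<open>n\<close> equations of \<open>H w = 0\<close>.\<close>

lemma minor_ratio_minimal:
  obtains w where "w n = 1" "leading_minor H (Suc n) = leading_minor H n * Re (herm_form H (Suc n) w)"
    "\<And>v. v n = 1 \<Longrightarrow> Re (herm_form H (Suc n) w) \<le> Re (herm_form H (Suc n) v)"
proof -
  obtain u m where
    c: "\<And>i j. i < n \<Longrightarrow> j < n \<Longrightarrow> (\<Sum>p<n. u p i * cnj (u p j)) = (if i = j then 1 else 0)" and
    e: "\<And>p i. p < n \<Longrightarrow> i < n \<Longrightarrow> (\<Sum>j<n. H i j * u p j) = of_real (m p) * u p i" and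
    m: "\<And>p. p < n \<Longrightarrow> m p \<ge> (1::real)" and
    "Determinant.det (Matrix.mat n n (\<lambda>(i, j). H i j)) = of_real (\<Prod>p<n. m p)"
    by (rule spectral[of n]; rule that)
  \<comment> \<open>Coefficients in the eigenbasis of the solution \<open>y\<close> of the system
    with right-hand side column \<open>n\<close>; every \<open>m p\<close> is at least 1, so the
    division is harmless.\<close>
  define b where "b = (\<lambda>p. (\<Sum>k<n. H k n * cnj (u p k)) / of_real (m p))"
  define y where "y = (\<lambda>j. \<Sum>p<n. b p * u p j)"
  have y: "(\<Sum>j<n. H i j * y j) = H i n" if i: "i < n" for i
  proof -
    have "(\<Sum>j<n. H i j * y j) = (\<Sum>p<n. \<Sum>j<n. b p * (H i j * u p j))"
      unfolding y_def sum_distrib_left by (subst sum.swap) (simp only: mult_ac)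
    also have "\<dots> = (\<Sum>p<n. b p * (of_real (m p) * u p i))"
      unfolding sum_distrib_left[symmetric] by (intro sum.cong refl) (use i e in simp)
    also have "\<dots> = (\<Sum>p<n. \<Sum>k<n. H k n * (u p i * cnj (u p k)))"
    proof (intro sum.cong refl)
      fix p assume "p \<in> {..<n}"
      then have "m p \<noteq> 0" using m[of p] by auto
      then have "b p * (of_real (m p) * u p i) = (\<Sum>k<n. H k n * cnj (u p k)) * u p i"
        by (simp add: b_def)
      then show "b p * (of_real (m p) * u p i) = (\<Sum>k<n. H k n * (u p i * cnj (u p k)))"
        by (simp only: sum_distrib_right) (simp only: mult_ac)
    qed
    also have "\<dots> = (\<Sum>k<n. H k n * (\<Sum>p<n. u p i * cnj (u p k)))"
      by (subst sum.swap) (simp only: sum_distrib_left)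
    also have "\<dots> = (\<Sum>k<n. if k = i then H k n else 0)"
    proof (intro sum.cong refl)
      fix k assume "k \<in> {..<n}"
      then show "H k n * (\<Sum>p<n. u p i * cnj (u p k)) = (if k = i then H k n else 0)"
        using c[OF i, of k] by (cases "k = i") auto
    qed
    finally show ?thesis using i by simp
  qed
  define w where "w = (\<lambda>i. if i < n then - y i else 1)"
  have w_sum: "(\<Sum>j<Suc n. H i j * w j) = - (\<Sum>j<n. H i j * y j) + H i n" for i
    by (simp add: w_def sum_negf)
  have Hw0: "(\<Sum>j<Suc n. H i j * w j) = 0" if "i < n" for i
    unfolding w_sum using y[OF that] by simp
  define s where "s = (\<Sum>j<Suc n. H n j * w j)"
  have form_w: "(\<Sum>i<Suc n. cnj (v i) * (\<Sum>j<Suc n. H i j * w j)) = cnj (v n) * s" for v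
    unfolding s_def using Hw0 by simp
  have Q_w: "herm_form H (Suc n) w = s"
    unfolding herm_form_def form_w by (simp add: w_def)
  define A where "A = Matrix.mat (Suc n) (Suc n) (\<lambda>(i, j). H i j)"
  \<comment> \<open>Right multiplication by this unipotent matrix replaces the last column of
    \<open>A\<close> by \<open>H w\<close>, which vanishes except for its last entry
    \<open>s\<close>. Expansion along that column leaves \<open>s\<close> times the smaller
    minor.\<close>
  define U where "U = Matrix.mat (Suc n) (Suc n) (\<lambda>(i, j). if j = n then w i else if i = j then 1 else 0)"
  have carr: "A \<in> carrier_mat (Suc n) (Suc n)" "U \<in> carrier_mat (Suc n) (Suc n)"
    by (auto simp: A_def U_def)
  have detU: "Determinant.det U = 1"
  proof -
    have "Determinant.det U = prod_list (diag_mat U)"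
      by (rule det_upper_triangular[OF _ carr(2)]) (auto simp: U_def)
    also have "diag_mat U = map (\<lambda>i. 1) [0..<Suc n]"
      unfolding diag_mat_def by (intro map_cong) (auto simp: U_def w_def)
    also have "prod_list \<dots> = 1" by (induction n) auto
    finally show ?thesis .
  qed
  define C where "C = A * U"
  have C: "C \<in> carrier_mat (Suc n) (Suc n)" using carr by (simp add: C_def)
  have Cij: "C $$ (i, j) = (if j = n then (\<Sum>k<Suc n. H i k * w k) else H i j)"
    if "i < Suc n" "j < Suc n" for i j
  proof -
    have "C $$ (i, j) = (\<Sum>k<Suc n. H i k * (if j = n then w k else if k = j then 1 else 0))"
      using that by (simp add: C_def A_def U_def scalar_prod_def atLeast0LessThan del: sum.lessThan_Suc)
    also have "\<dots> = (if j = n then (\<Sum>k<Suc n. H i k * w k) else (\<Sum>k<Suc n. if k = j then H i k else 0))"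
    proof (cases "j = n")
      case False
      then show ?thesis by (simp only: if_False) (intro sum.cong refl, simp)
    qed (simp only: if_True simp_thms)
    also have "(\<Sum>k<Suc n. if k = j then H i k else 0) = H i j"
      using that by (simp del: sum.lessThan_Suc)
    finally show ?thesis .
  qed
  have "Determinant.det A = Determinant.det C"
    unfolding C_def det_mult[OF carr] detU by simp
  also have "\<dots> = (\<Sum>i<Suc n. C $$ (i, n) * cofactor C i n)"
    by (rule laplace_expansion_column[OF C]) simp
  also have "\<dots> = s * cofactor C n n"
  proof -
    have "(\<Sum>i<Suc n. C $$ (i, n) * cofactor C i n) = (\<Sum>i<Suc n. if i = n then s * cofactor C n n else 0)"
    proof (intro sum.cong refl)
      fix i assume "i \<in> {..<Suc n}"
      then show "C $$ (i, n) * cofactor C i n = (if i = n then s * cofactor C n n else 0)"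
        using Cij[of i n] Hw0[of i] by (cases "i = n") (simp_all only: s_def lessThan_iff less_Suc_eq if_True if_False refl simp_thms mult_zero_left)
    qed
    then show ?thesis by simp
  qed
  also have "mat_delete C n n = Matrix.mat n n (\<lambda>(i, j). H i j)"
    by (rule eq_matI) (use C Cij in \<open>auto simp: mat_delete_def\<close>)
  then have "cofactor C n n = Determinant.det (Matrix.mat n n (\<lambda>(i, j). H i j))"
    by (simp add: cofactor_def)
  finally have "of_real (leading_minor H (Suc n)) = s * of_real (leading_minor H n)"
    unfolding A_def leading_minor(2) by simp
  then have "Re (of_real (leading_minor H (Suc n))) = Re (s * of_real (leading_minor H n))" by simp
  then have "leading_minor H (Suc n) = leading_minor H n * Re s" by simp
  moreover have "Re s \<le> Re (herm_form H (Suc n) v)" if v: "v n = 1" for v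
  proof -
    \<comment> \<open>Since \<open>x n = 0\<close> and \<open>H w\<close> is supported at index
      \<open>n\<close>, both cross terms vanish and the form of \<open>v\<close> is the form of
      \<open>x\<close> plus \<open>s\<close>.\<close>
    define x where "x = (\<lambda>i. v i - w i)"
    have xn: "x n = 0" by (simp add: x_def v w_def)
    have vx: "v = (\<lambda>i. x i + w i)" by (simp add: x_def)
    have swap: "(\<Sum>i<Suc n. cnj (w i) * (\<Sum>j<Suc n. H i j * x j))
      = cnj (\<Sum>i<Suc n. cnj (x i) * (\<Sum>j<Suc n. H i j * w j))"
    proof -
      have "(\<Sum>i<Suc n. cnj (w i) * (\<Sum>j<Suc n. H i j * x j))
        = (\<Sum>i<Suc n. \<Sum>j<Suc n. cnj (w i) * (H i j * x j))"
        by (simp only: sum_distrib_left)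
      also have "\<dots> = (\<Sum>j<Suc n. \<Sum>i<Suc n. cnj (w i) * (H i j * x j))" by (rule sum.swap)
      also have "\<dots> = (\<Sum>j<Suc n. \<Sum>i<Suc n. cnj (cnj (x j) * (H j i * w i)))"
      proof (intro sum.cong refl)
        fix i j
        show "cnj (w i) * (H i j * x j) = cnj (cnj (x j) * (H j i * w i))"
          using herm[of j i] by simp
      qed
      finally show ?thesis by (simp only: cnj_sum sum_distrib_left)
    qed
    have "herm_form H (Suc n) v = herm_form H (Suc n) x + herm_form H (Suc n) w
      + (\<Sum>i<Suc n. cnj (x i) * (\<Sum>j<Suc n. H i j * w j)) + (\<Sum>i<Suc n. cnj (w i) * (\<Sum>j<Suc n. H i j * x j))"
      unfolding herm_form_def vx
      by (simp only: complex_cnj_add distrib_left distrib_right sum.distrib ac_simps)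
    also have "\<dots> = herm_form H (Suc n) x + s"
      unfolding swap form_w xn Q_w by simp
    finally have "Re (herm_form H (Suc n) v) = Re (herm_form H (Suc n) x) + Re s" by simp
    moreover have "0 \<le> Re (herm_form H (Suc n) x)"
      using coercive[where n = "Suc n" and v = x] by (meson order_trans sum_nonneg zero_le_power2)
    ultimately show ?thesis by simp
  qed
  ultimately show ?thesis using that[of w] Q_w by (simp add: w_def)
qed

text \<open>The ratio of consecutive leading minors is a squared distance to a span, and by
  translation invariance the span grows with the index.\<close>

lemma toeplitz_minor_ratio_antimono:
  assumes shift: "\<And>i j. H (i + r) (j + r) = H i j"
  shows "leading_minor H (Suc (n + r)) / leading_minor H (n + r) \<le> leading_minor H (Suc n) / leading_minor H n"
proof -
  have pos: "leading_minor H k > 0" for k using leading_minor(1)[of k] by simp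
  obtain w where w: "w n = 1" "leading_minor H (Suc n) = leading_minor H n * Re (herm_form H (Suc n) w)"
    "\<And>v. v n = 1 \<Longrightarrow> Re (herm_form H (Suc n) w) \<le> Re (herm_form H (Suc n) v)"
    by (rule minor_ratio_minimal[of n]; rule that)
  obtain w' where "w' (n + r) = 1" and w': "leading_minor H (Suc (n + r)) = leading_minor H (n + r) * Re (herm_form H (Suc (n + r)) w')"
    "\<And>v. v (n + r) = 1 \<Longrightarrow> Re (herm_form H (Suc (n + r)) w') \<le> Re (herm_form H (Suc (n + r)) v)"
    by (rule minor_ratio_minimal[of "n + r"]; rule that)
  \<comment> \<open>The competitor for the larger minor: \<open>w\<close> moved by \<open>r\<close>
    places and padded with zeros. Translation invariance keeps the value of the form.\<close>
  define v where "v = (\<lambda>i. if i < r then 0 else w (i - r))"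
  have sh: "(\<Sum>i<Suc (n + r). f i) = (\<Sum>i<Suc n. f (i + r))" if "\<And>i. i < r \<Longrightarrow> f i = 0" for f :: "nat \<Rightarrow> complex"
  proof -
    have "(\<Sum>i<Suc (n + r). f i) = (\<Sum>i\<in>{r..<Suc n + r}. f i)"
      by (rule sum.mono_neutral_right) (use that in auto)
    also have "\<dots> = (\<Sum>i\<in>{0..<Suc n}. f (i + r))"
      using sum.shift_bounds_nat_ivl[of f 0 r "Suc n"] by simp
    finally show ?thesis by (simp add: atLeast0LessThan)
  qed
  have "herm_form H (Suc (n + r)) v = herm_form H (Suc n) w"
    unfolding herm_form_def by (subst sh, simp add: v_def, subst sh) (auto simp: v_def shift)
  then have "Re (herm_form H (Suc (n + r)) w') \<le> Re (herm_form H (Suc n) w)"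
    using w'(2)[of v] w(1) by (simp add: v_def)
  then show ?thesis using w(2) w'(1) pos[of n] pos[of "n + r"] by simp
qed

end

subsection \<open>The modes of a mesh\<close>

text \<open>Write \<open>1 / x\<^sup>2\<close> as the integral of \<open>s * exp (- s * x)\<close>
  over \<open>s\<close> and exchange the two integrals of a nonnegative function. Integrating over
  \<open>x\<close> leaves \<open>a\<^sup>2 / (s\<^sup>2 + a\<^sup>2)\<close>, whose primitive is an
  arctangent.\<close>

lemma nn_integral_one_minus_cos_over_square:
  fixes a :: real
  assumes a: "a > 0"
  shows "(\<integral>\<^sup>+ x. ennreal ((1 - cos (a * x)) / x\<^sup>2) * indicator {0..} x \<partial>lborel) = ennreal (pi * a / 2)"
proof -
  define f where "f = (\<lambda>x s. ennreal ((1 - cos (a * x)) * (s * exp (- s * x))) * indicator {0..} x * indicator {0..} s)"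
  have [measurable]: "(\<lambda>(x, s). f x s) \<in> borel_measurable (lborel \<Otimes>\<^sub>M lborel)"
    unfolding f_def by measurable
  have inner: "(\<integral>\<^sup>+ s. f x s \<partial>lborel) = ennreal ((1 - cos (a * x)) / x\<^sup>2) * indicator {0..} x" if "x \<noteq> 0" for x
  proof (cases "x > 0")
    case True
    have "(\<integral>\<^sup>+ s. ennreal (s * exp (- s * x)) * indicator {0..} s \<partial>lborel) = ennreal (0 - (- (0 / x + 1 / x\<^sup>2) * exp (- 0 * x)))"
    proof (rule nn_integral_FTC_atLeast[where F = "\<lambda>s. - (s / x + 1 / x\<^sup>2) * exp (- s * x)"])
      show "((\<lambda>s. - (s / x + 1 / x\<^sup>2) * exp (- s * x)) has_real_derivative s * exp (- s * x)) (at s)" for s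
        using True by (auto intro!: derivative_eq_intros simp: field_simps power2_eq_square)
      show "((\<lambda>s. - (s / x + 1 / x\<^sup>2) * exp (- s * x)) \<longlongrightarrow> 0) at_top"
        using True by real_asymp
    qed auto
    then have I: "(\<integral>\<^sup>+ s. ennreal (s * exp (- s * x)) * indicator {0..} s \<partial>lborel) = ennreal (1 / x\<^sup>2)" by simp
    have "(\<integral>\<^sup>+ s. f x s \<partial>lborel) = (\<integral>\<^sup>+ s. ennreal (1 - cos (a * x)) * (ennreal (s * exp (- s * x)) * indicator {0..} s) \<partial>lborel)"
      using True by (intro nn_integral_cong) (auto simp: f_def ennreal_mult indicator_def)
    also have "\<dots> = ennreal (1 - cos (a * x)) * ennreal (1 / x\<^sup>2)"
      using I by (subst nn_integral_cmult) auto
    also have "\<dots> = ennreal ((1 - cos (a * x)) / x\<^sup>2)" by (subst ennreal_mult[symmetric]) auto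
    finally show ?thesis using True by simp
  qed (use that in \<open>simp add: f_def\<close>)
  have outer: "(\<integral>\<^sup>+ x. f x s \<partial>lborel) = ennreal (a\<^sup>2 / (s\<^sup>2 + a\<^sup>2)) * indicator {0..} s" if "s \<noteq> 0" for s
  proof (cases "s > 0")
    case True
    let ?F = "\<lambda>x. - exp (- s * x) / s - exp (- s * x) * (a * sin (a * x) - s * cos (a * x)) / (s\<^sup>2 + a\<^sup>2)"
    have sa: "s\<^sup>2 + a\<^sup>2 > 0" using True by (simp add: add_pos_nonneg)
    have "(\<integral>\<^sup>+ x. ennreal ((1 - cos (a * x)) * exp (- s * x)) * indicator {0..} x \<partial>lborel) = ennreal (0 - ?F 0)"
    proof (rule nn_integral_FTC_atLeast)
      show "(?F has_real_derivative (1 - cos (a * x)) * exp (- s * x)) (at x)" for x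
      proof -
        have F: "?F = (\<lambda>x. (- 1 / s) * exp (- s * x) - exp (- s * x) * (a * sin (a * x) - s * cos (a * x)) * (1 / (s\<^sup>2 + a\<^sup>2)))"
          by simp
        have "(?F has_real_derivative (- 1 / s) * (exp (- s * x) * (- s)) - (- s * exp (- s * x) * (a * sin (a * x) - s * cos (a * x))
          + exp (- s * x) * (a * (a * cos (a * x)) + s * (a * sin (a * x)))) * (1 / (s\<^sup>2 + a\<^sup>2))) (at x)"
          unfolding F by (rule derivative_eq_intros refl)+ (simp add: algebra_simps)
        also have "(- 1 / s) * (exp (- s * x) * (- s)) = exp (- s * x)" using True by simp
        also have "A * (1 / (s\<^sup>2 + a\<^sup>2)) = A / (s\<^sup>2 + a\<^sup>2)" for A by simp
        also have "exp (- s * x) - (- s * exp (- s * x) * (a * sin (a * x) - s * cos (a * x))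
          + exp (- s * x) * (a * (a * cos (a * x)) + s * (a * sin (a * x)))) / (s\<^sup>2 + a\<^sup>2)
          = exp (- s * x) - exp (- s * x) * (cos (a * x) * (s\<^sup>2 + a\<^sup>2)) / (s\<^sup>2 + a\<^sup>2)"
          by (simp add: algebra_simps power2_eq_square)
        also have "exp (- s * x) * (cos (a * x) * (s\<^sup>2 + a\<^sup>2)) / (s\<^sup>2 + a\<^sup>2) = exp (- s * x) * cos (a * x)"
          using sa by (simp only: mult.assoc[symmetric] nonzero_mult_div_cancel_right)
        also have "exp (- s * x) - exp (- s * x) * cos (a * x) = (1 - cos (a * x)) * exp (- s * x)"
          by (simp only: algebra_simps)
        finally show ?thesis .
      qed
      show "(?F \<longlongrightarrow> 0) at_top"
      proof -
        have e: "((\<lambda>x. exp (- s * x)) \<longlongrightarrow> 0) at_top" using True by real_asymp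
        have "((\<lambda>x. exp (- s * x) * ((a * sin (a * x) - s * cos (a * x)) / (s\<^sup>2 + a\<^sup>2))) \<longlongrightarrow> 0) at_top"
        proof (rule Lim_null_comparison[where g = "\<lambda>x. exp (- s * x) * ((a + s) / (s\<^sup>2 + a\<^sup>2))"])
          show "\<forall>\<^sub>F x in at_top. norm (exp (- s * x) * ((a * sin (a * x) - s * cos (a * x)) / (s\<^sup>2 + a\<^sup>2)))
            \<le> exp (- s * x) * ((a + s) / (s\<^sup>2 + a\<^sup>2))"
          proof (intro always_eventually allI)
            fix x
            have "\<bar>a * sin (a * x) - s * cos (a * x)\<bar> \<le> \<bar>a * sin (a * x)\<bar> + \<bar>s * cos (a * x)\<bar>" by (rule abs_triangle_ineq4)
            also have "\<dots> \<le> a * 1 + s * 1"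
              unfolding abs_mult using a True by (intro add_mono mult_mono) auto
            finally show "norm (exp (- s * x) * ((a * sin (a * x) - s * cos (a * x)) / (s\<^sup>2 + a\<^sup>2)))
            \<le> exp (- s * x) * ((a + s) / (s\<^sup>2 + a\<^sup>2))"
              using sa by (simp add: abs_mult divide_right_mono)
          qed
          show "((\<lambda>x. exp (- s * x) * ((a + s) / (s\<^sup>2 + a\<^sup>2))) \<longlongrightarrow> 0) at_top"
            using tendsto_mult_right[OF e, of "(a + s) / (s\<^sup>2 + a\<^sup>2)"] by simp
        qed
        from tendsto_diff[OF tendsto_divide[OF tendsto_minus[OF e] tendsto_const[of s]] this] show ?thesis
          using True by simp
      qed
    qed auto
    moreover have "0 - ?F 0 = a\<^sup>2 / (s * (s\<^sup>2 + a\<^sup>2))" using True sa by (simp add: field_simps power2_eq_square)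
    ultimately have I: "(\<integral>\<^sup>+ x. ennreal ((1 - cos (a * x)) * exp (- s * x)) * indicator {0..} x \<partial>lborel) = ennreal (a\<^sup>2 / (s * (s\<^sup>2 + a\<^sup>2)))"
      by simp
    have "(\<integral>\<^sup>+ x. f x s \<partial>lborel) = (\<integral>\<^sup>+ x. ennreal s * (ennreal ((1 - cos (a * x)) * exp (- s * x)) * indicator {0..} x) \<partial>lborel)"
      using True by (intro nn_integral_cong) (auto simp: f_def ennreal_mult[symmetric] indicator_def mult_ac)
    also have "\<dots> = ennreal s * ennreal (a\<^sup>2 / (s * (s\<^sup>2 + a\<^sup>2)))"
      using I by (subst nn_integral_cmult) auto
    also have "\<dots> = ennreal (a\<^sup>2 / (s\<^sup>2 + a\<^sup>2))" using True sa by (subst ennreal_mult[symmetric]) auto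
    finally show ?thesis using True by simp
  qed (use that in \<open>simp add: f_def\<close>)
  have "(\<integral>\<^sup>+ x. ennreal ((1 - cos (a * x)) / x\<^sup>2) * indicator {0..} x \<partial>lborel) = (\<integral>\<^sup>+ x. \<integral>\<^sup>+ s. f x s \<partial>lborel \<partial>lborel)"
    by (rule nn_integral_cong_AE) (use AE_lborel_singleton[of "0::real"] in \<open>eventually_elim, simp add: inner\<close>)
  also have "\<dots> = (\<integral>\<^sup>+ s. \<integral>\<^sup>+ x. f x s \<partial>lborel \<partial>lborel)"
    by (rule lborel_pair.Fubini'[symmetric]) measurable
  also have "\<dots> = (\<integral>\<^sup>+ s. ennreal (a\<^sup>2 / (s\<^sup>2 + a\<^sup>2)) * indicator {0..} s \<partial>lborel)"
    by (rule nn_integral_cong_AE) (use AE_lborel_singleton[of "0::real"] in \<open>eventually_elim, simp add: outer\<close>)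
  also have "\<dots> = ennreal (a * (pi / 2) - a * arctan (0 / a))"
  proof (rule nn_integral_FTC_atLeast)
    show "((\<lambda>s. a * arctan (s / a)) has_real_derivative a\<^sup>2 / (s\<^sup>2 + a\<^sup>2)) (at s)" for s
    proof -
      have "a\<^sup>2 + s\<^sup>2 > 0" using a by (simp add: add_pos_nonneg)
      then have "a * (inverse (1 + (s * (1 / a))\<^sup>2) * (1 * (1 / a))) = a\<^sup>2 / (s\<^sup>2 + a\<^sup>2)"
        using a by (simp add: divide_simps power2_eq_square algebra_simps)
      moreover have "((\<lambda>s. a * arctan (s * (1 / a))) has_real_derivative a * (inverse (1 + (s * (1 / a))\<^sup>2) * (1 * (1 / a)))) (at s)"
        by (rule derivative_eq_intros refl)+ simp
      ultimately show ?thesis by simp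
    qed
    show "((\<lambda>s. a * arctan (s / a)) \<longlongrightarrow> a * (pi / 2)) at_top"
      using a by real_asymp
  qed auto
  finally show ?thesis by (simp add: mult.commute)
qed

text \<open>Open at 0, because the formulas divide by \<open>\<xi>\<close> and by the symbol, which
  vanishes at 0. Positivity then holds at every point of the space and not merely almost
  everywhere.\<close>

abbreviation half_line :: "real measure" where
  "half_line \<equiv> restrict_space lborel {0<..}"

lemma nn_integral_half_line:
  "(\<integral>\<^sup>+ x. f x \<partial>half_line) = (\<integral>\<^sup>+ x. f x * indicator {0..} x \<partial>lborel)"
proof -
  have "(\<integral>\<^sup>+ x. f x \<partial>half_line) = (\<integral>\<^sup>+ x. f x * indicator {0<..} x \<partial>lborel)"
    by (rule nn_integral_restrict_space) simp
  also have "\<dots> = (\<integral>\<^sup>+ x. f x * indicator {0..} x \<partial>lborel)"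
    by (rule nn_integral_cong_AE) (use AE_lborel_singleton[of "0::real"] in \<open>eventually_elim, auto simp: indicator_def\<close>)
  finally show ?thesis .
qed

lemma integral_one_minus_cos_over_square:
  fixes a :: real
  shows "integrable half_line (\<lambda>x. (1 - cos (a * x)) / x\<^sup>2)" (is ?int)
    and "(LINT x|half_line. (1 - cos (a * x)) / x\<^sup>2) = pi * \<bar>a\<bar> / 2"
proof -
  have "has_bochner_integral half_line (\<lambda>x. (1 - cos (a * x)) / x\<^sup>2) (pi * \<bar>a\<bar> / 2)"
  proof (rule has_bochner_integral_nn_integral)
    show "(\<integral>\<^sup>+ x. ennreal ((1 - cos (a * x)) / x\<^sup>2) \<partial>half_line) = ennreal (pi * \<bar>a\<bar> / 2)"
    proof (cases "a = 0")
      case False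
      have c: "cos (a * x) = cos (\<bar>a\<bar> * x)" for x by (simp add: abs_if)
      show ?thesis unfolding c nn_integral_half_line
        by (rule nn_integral_one_minus_cos_over_square) (use False in simp)
    qed simp
  qed (auto intro!: measurable_restrict_space1)
  then show ?int and "(LINT x|half_line. (1 - cos (a * x)) / x\<^sup>2) = pi * \<bar>a\<bar> / 2"
    by (auto simp: has_bochner_integral_iff)
qed

text \<open>The integrand is a second difference, in the frequency, of
  \<open>(1 - cos (a * x)) / x\<^sup>2\<close>. The integral is therefore a second difference of the
  absolute value at integers, which is nonzero only at \<open>j = 0\<close>. This is the
  orthogonality of the horizontal modes.\<close>

lemma integral_fejer_cos:
  fixes h :: real and j :: int
  assumes h: "h > 0"
  shows "integrable half_line (\<lambda>x. cos (of_int j * h * x) * ((2 - 2 * cos (h * x)) / (h * x\<^sup>2)))"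
    and "(LINT x|half_line. cos (of_int j * h * x) * ((2 - 2 * cos (h * x)) / (h * x\<^sup>2))) = (if j = 0 then pi else 0)"
proof -
  let ?g = "\<lambda>a x. (1 - cos (a * x)) / x\<^sup>2"
  have eq: "cos (of_int j * h * x) * ((2 - 2 * cos (h * x)) / (h * x\<^sup>2))
    = (1 / h) * (?g (of_int (j + 1) * h) x + ?g (of_int (j - 1) * h) x - 2 * ?g (of_int j * h) x)" for x
  proof -
    have "cos (of_int (j + 1) * h * x) + cos (of_int (j - 1) * h * x) = 2 * cos (of_int j * h * x) * cos (h * x)"
      by (simp add: algebra_simps cos_add cos_diff)
    then have "(1 - cos (of_int (j + 1) * h * x)) + (1 - cos (of_int (j - 1) * h * x)) - 2 * (1 - cos (of_int j * h * x))
      = cos (of_int j * h * x) * (2 - 2 * cos (h * x))" by (simp only: algebra_simps)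
    then show ?thesis using h by (simp add: add_divide_distrib[symmetric] diff_divide_distrib[symmetric] mult.assoc)
  qed
  have I: "has_bochner_integral half_line (?g a) (pi * \<bar>a\<bar> / 2)" for a
    using integral_one_minus_cos_over_square[of a] by (simp add: has_bochner_integral_iff)
  have "has_bochner_integral half_line (\<lambda>x. cos (of_int j * h * x) * ((2 - 2 * cos (h * x)) / (h * x\<^sup>2)))
    ((1 / h) * (pi * \<bar>of_int (j + 1) * h\<bar> / 2 + pi * \<bar>of_int (j - 1) * h\<bar> / 2 - 2 * (pi * \<bar>of_int j * h\<bar> / 2)))"
    unfolding eq by (intro has_bochner_integral_mult_right has_bochner_integral_diff has_bochner_integral_add I)
  then have int: "integrable half_line (\<lambda>x. cos (of_int j * h * x) * ((2 - 2 * cos (h * x)) / (h * x\<^sup>2)))"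
    and val: "(LINT x|half_line. cos (of_int j * h * x) * ((2 - 2 * cos (h * x)) / (h * x\<^sup>2)))
    = (1 / h) * (pi * \<bar>of_int (j + 1) * h\<bar> / 2 + pi * \<bar>of_int (j - 1) * h\<bar> / 2 - 2 * (pi * \<bar>of_int j * h\<bar> / 2))"
    by (simp_all only: has_bochner_integral_iff)
  show "integrable half_line (\<lambda>x. cos (of_int j * h * x) * ((2 - 2 * cos (h * x)) / (h * x\<^sup>2)))" by (rule int)
  have "(LINT x|half_line. cos (of_int j * h * x) * ((2 - 2 * cos (h * x)) / (h * x\<^sup>2)))
    = (1 / h) * (pi * \<bar>of_int (j + 1) * h\<bar> / 2 + pi * \<bar>of_int (j - 1) * h\<bar> / 2 - 2 * (pi * \<bar>of_int j * h\<bar> / 2))"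
    by (rule val)
  also have "\<dots> = pi / 2 * (\<bar>of_int (j + 1)\<bar> + \<bar>of_int (j - 1)\<bar> - 2 * \<bar>of_int j\<bar>)"
    using h by (simp add: abs_mult field_simps del: of_int_add of_int_diff)
  also have "\<dots> = (if j = 0 then pi else 0)"
    by (cases j "0::int" rule: linorder_cases) (auto simp: abs_if)
  finally show "(LINT x|half_line. cos (of_int j * h * x) * ((2 - 2 * cos (h * x)) / (h * x\<^sup>2))) = (if j = 0 then pi else 0)" .
qed

text \<open>The squared norm of the rank-one symbol: \<open>2 * \<xi>\<close> times the integral of
  \<open>exp (- 2 * \<xi> * y)\<close> over heights \<open>y\<close> from 1 to
  \<open>a\<close>.\<close>

definition strip_symbol :: "real \<Rightarrow> real \<Rightarrow> real" where
  "strip_symbol a \<xi> = exp (- 2 * \<xi>) - exp (- 2 * a * \<xi>)"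

lemma strip_symbol_pos: "a > 1 \<Longrightarrow> \<xi> > 0 \<Longrightarrow> strip_symbol a \<xi> > 0"
  by (simp add: strip_symbol_def)

lemma strip_symbol_less_1: "\<xi> > 0 \<Longrightarrow> strip_symbol a \<xi> < 1"
  unfolding strip_symbol_def by (smt (verit) exp_gt_zero exp_less_one_iff)

lemma measurable_half_line:
  "f \<in> borel_measurable lborel \<Longrightarrow> f \<in> borel_measurable half_line"
  by (rule measurable_restrict_space1)

text \<open>\<open>h\<close> and \<open>w\<close> are the width and the height of a cell, and
  \<open>r\<close> is the number of cells in a column. The horizontal extent stays free: a rectangle
  of width \<open>n * h\<close> uses the leading \<open>n * r\<close> indices of one infinite
  matrix.\<close>

locale mesh =
  fixes a h w :: real and r :: nat
  assumes a: "a > 1" and h: "h > 0" and r: "r > 0" and w_def: "w = (a - 1) / real r"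
begin

lemma w: "w > 0" using a r by (simp add: w_def)

lemma rw: "real r * w = a - 1" using r by (simp add: w_def)

text \<open>Cell number \<open>i = k * r + l\<close> is \<open>[k h, (k + 1) h] \<times> [1 + l w, 1 + (l + 1) w]\<close>, and \<open>mode i \<xi>\<close> is the
  \<open>L\<^sup>2\<close> pairing of its normalised indicator with \<open>sqrt (\<xi> / \<pi>) exp (\<i> \<xi> z)\<close>; the formulas are meant for
  \<open>\<xi> > 0\<close>.\<close>

definition xmode :: "nat \<Rightarrow> real \<Rightarrow> complex" where
  "xmode k \<xi> = cis (\<xi> * real k * h) * ((cis (\<xi> * h) - 1) / (\<i> * of_real (\<xi> * sqrt h)))"

definition ymode :: "nat \<Rightarrow> real \<Rightarrow> real" where
  "ymode l \<xi> = exp (- \<xi> * (1 + real l * w)) * ((1 - exp (- \<xi> * w)) / (\<xi> * sqrt w))"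

definition mode :: "nat \<Rightarrow> real \<Rightarrow> complex" where
  "mode i \<xi> = of_real (sqrt (\<xi> / pi) * ymode (i mod r) \<xi>) * xmode (i div r) \<xi>"

text \<open>The squared modulus common to all \<open>xmode k\<close>: a Fejer kernel, coming from
  the transform of the normalised indicator of an interval of length \<open>h\<close>.\<close>

definition fejer :: "real \<Rightarrow> real" where
  "fejer \<xi> = (2 - 2 * cos (h * \<xi>)) / (h * \<xi>\<^sup>2)"

definition gram :: "nat \<Rightarrow> nat \<Rightarrow> complex" where
  "gram i j = (LINT \<xi>|half_line. mode i \<xi> * cnj (mode j \<xi>))"

lemma xmode_measurable: "xmode k \<in> borel_measurable borel"
  unfolding xmode_def[abs_def]
  by (rule borel_measurable_times[OF _ borel_measurable_divide];
      rule borel_measurable_continuous_onI; intro continuous_intros)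

lemma ymode_measurable: "ymode l \<in> borel_measurable borel"
  unfolding ymode_def[abs_def] by measurable

lemma mode_measurable: "mode i \<in> borel_measurable borel"
proof -
  have [measurable]: "xmode (i div r) \<in> borel_measurable borel" "ymode (i mod r) \<in> borel_measurable borel"
    by (rule xmode_measurable ymode_measurable)+
  show ?thesis unfolding mode_def[abs_def] by measurable
qed

lemma norm_cis_minus_1_square: "(cmod (cis x - 1))\<^sup>2 = 2 - 2 * cos x"
proof -
  have "(cmod (cis x - 1))\<^sup>2 = (cos x - 1)\<^sup>2 + (sin x)\<^sup>2" by (simp add: cmod_power2)
  also have "\<dots> = 2 - 2 * cos x" using sin_cos_squared_add[of x] by (simp add: power2_eq_square algebra_simps)
  finally show ?thesis .
qed

lemma norm_xmode_square: "(cmod (xmode k \<xi>))\<^sup>2 = fejer \<xi>"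
  using h by (simp add: xmode_def fejer_def norm_mult norm_divide power_mult_distrib power_divide
      norm_cis_minus_1_square mult_ac)

lemma fejer_nonneg: "0 \<le> fejer \<xi>" by (simp add: norm_xmode_square[of 0, symmetric])

lemma fejer_le: "fejer \<xi> \<le> h"
proof (cases "\<xi> = 0")
  case False
  have "(sin (h * \<xi> / 2))\<^sup>2 \<le> (h * \<xi> / 2)\<^sup>2"
    using abs_sin_x_le_abs_x[of "h * \<xi> / 2"] by (simp only: abs_le_square_iff)
  moreover have "cos (h * \<xi>) = 1 - 2 * (sin (h * \<xi> / 2))\<^sup>2" using cos_double_sin[of "h * \<xi> / 2"] by simp
  ultimately have "1 - (h * \<xi>)\<^sup>2 / 2 \<le> cos (h * \<xi>)" by (simp add: power_divide)
  then have "2 - 2 * cos (h * \<xi>) \<le> h * (h * \<xi>\<^sup>2)" by (simp add: power2_eq_square algebra_simps)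
  then show ?thesis using h False by (simp add: fejer_def divide_le_eq)
qed (use h in \<open>simp add: fejer_def\<close>)

lemma ymode_nonneg: "\<xi> > 0 \<Longrightarrow> 0 \<le> ymode l \<xi>"
  using w by (auto simp: ymode_def)

text \<open>A geometric series in \<open>exp (- 2 * \<xi> * w)\<close>. The symbol splits off
  exactly at every mesh and not only in the limit, so that the later division by it produces no
  error.\<close>

lemma sum_ymode_square:
  assumes "\<xi> > 0"
  shows "(\<Sum>l<r. (ymode l \<xi>)\<^sup>2)
    = strip_symbol a \<xi> * ((1 - exp (- \<xi> * w)) / (w * \<xi>\<^sup>2 * (1 + exp (- \<xi> * w))))"
proof -
  define E where "E = exp (- \<xi> * w)"
  have E: "0 < E" "E < 1" using assms w by (auto simp: E_def)
  have e: "exp (- \<xi> * (1 + real l * w)) = exp (- \<xi>) * E ^ l" for l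
    by (simp add: E_def exp_of_nat_mult[symmetric] exp_add[symmetric] algebra_simps)
  have "(\<Sum>l<r. (ymode l \<xi>)\<^sup>2) = (\<Sum>l<r. (E\<^sup>2) ^ l) * ((exp (- \<xi>))\<^sup>2 * ((1 - E)\<^sup>2 / (\<xi>\<^sup>2 * w)))"
    unfolding sum_distrib_right ymode_def e E_def[symmetric]
    by (intro sum.cong refl) (use w in \<open>simp add: power_mult_distrib power_divide power_mult[symmetric] mult_ac\<close>)
  also have "(\<Sum>l<r. (E\<^sup>2) ^ l) = (1 - (E\<^sup>2) ^ r) / (1 - E\<^sup>2)"
    using E by (subst sum_gp_strict) (auto simp: power2_eq_1_iff)
  also have "(E\<^sup>2) ^ r = exp (- 2 * (a - 1) * \<xi>)"
  proof -
    have "(E\<^sup>2) ^ r = exp (real r * (2 * (- \<xi> * w)))"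
      by (simp only: E_def exp_of_nat_mult exp_double)
    also have "real r * (2 * (- \<xi> * w)) = - 2 * (real r * w) * \<xi>" by simp
    finally show ?thesis by (simp only: rw)
  qed
  also have "(1 - exp (- 2 * (a - 1) * \<xi>)) / (1 - E\<^sup>2) * ((exp (- \<xi>))\<^sup>2 * ((1 - E)\<^sup>2 / (\<xi>\<^sup>2 * w)))
    = ((exp (- \<xi>))\<^sup>2 * (1 - exp (- 2 * (a - 1) * \<xi>))) * ((1 - E) * (1 - E) / ((1 - E) * (1 + E)) / (\<xi>\<^sup>2 * w))"
  proof -
    have "1 - E\<^sup>2 = (1 - E) * (1 + E)" by (simp add: power2_eq_square algebra_simps)
    then show ?thesis unfolding power2_eq_square[of "1 - E"] by (simp add: mult_ac)
  qed
  also have "(exp (- \<xi>))\<^sup>2 * (1 - exp (- 2 * (a - 1) * \<xi>)) = strip_symbol a \<xi>"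
    by (simp add: strip_symbol_def exp_double[symmetric] right_diff_distrib exp_add[symmetric] algebra_simps)
  also have "(1 - E) * (1 - E) / ((1 - E) * (1 + E)) = (1 - E) / (1 + E)" using E by simp
  finally show ?thesis by (simp add: E_def mult_ac)
qed

text \<open>With \<open>v = \<xi> * w\<close> the left side is
  \<open>tanh (v / 2) / (w * \<xi>\<^sup>2)\<close>, and \<open>tanh (v / 2) \<le> v / 2\<close>.
  Nonnegativity of \<open>?f\<close> is this inequality cleared of denominators.\<close>

lemma ydens_le:
  assumes "\<xi> > 0"
  shows "(1 - exp (- \<xi> * w)) / (w * \<xi>\<^sup>2 * (1 + exp (- \<xi> * w))) \<le> 1 / (2 * \<xi>)"
proof -
  let ?f = "\<lambda>v::real. v * (1 + exp (- v)) - 2 * (1 - exp (- v))"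
  have "?f 0 \<le> ?f (\<xi> * w)"
  proof (rule DERIV_nonneg_imp_nondecreasing[where f = ?f])
    fix v :: real assume v: "0 \<le> v" "v \<le> \<xi> * w"
    have "(?f has_real_derivative (1 + exp (- v)) + v * (- exp (- v)) - 2 * exp (- v)) (at v)"
      by (auto intro!: derivative_eq_intros)
    moreover have "(1 + v) * exp (- v) \<le> exp v * exp (- v)"
      by (intro mult_right_mono exp_ge_add_one_self) auto
    then have "0 \<le> (1 + exp (- v)) + v * (- exp (- v)) - 2 * exp (- v)"
      by (simp add: exp_add[symmetric] algebra_simps)
    ultimately show "\<exists>y. (?f has_real_derivative y) (at v) \<and> 0 \<le> y" by blast
  qed (use assms w in simp)
  then have *: "2 * (1 - exp (- \<xi> * w)) \<le> \<xi> * w * (1 + exp (- \<xi> * w))" by simp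
  have p: "0 < w * \<xi>\<^sup>2 * (1 + exp (- \<xi> * w))" using assms w by (simp add: add_pos_pos)
  have "2 * \<xi> * (1 - exp (- \<xi> * w)) \<le> w * \<xi>\<^sup>2 * (1 + exp (- \<xi> * w))"
    using mult_left_mono[OF *, of \<xi>] assms by (simp add: power2_eq_square algebra_simps)
  then show ?thesis using p assms by (simp add: divide_le_eq mult.commute pos_le_divide_eq)
qed

text \<open>The sum is a trigonometric polynomial in \<open>h * \<xi>\<close> times
  \<open>xmode 0\<close>. Over the whole line the functions \<open>xmode k\<close> are orthogonal
  with squared norm \<open>2 * pi\<close>; restriction to the half line leaves an upper
  bound.\<close>

lemma xmode_bessel:
  fixes c :: "nat \<Rightarrow> complex"
  shows "integrable half_line (\<lambda>\<xi>. (cmod (\<Sum>k<n. c k * xmode k \<xi>))\<^sup>2)"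
    and "(LINT \<xi>|half_line. (cmod (\<Sum>k<n. c k * xmode k \<xi>))\<^sup>2) \<le> 2 * pi * (\<Sum>k<n. (cmod (c k))\<^sup>2)"
proof -
  define T where "T = (\<lambda>x. \<Sum>k<n. c k * cis (real k * x))"
  have fac: "(cmod (\<Sum>k<n. c k * xmode k \<xi>))\<^sup>2 = fejer \<xi> * (cmod (T (h * \<xi>)))\<^sup>2" for \<xi>
  proof -
    have x: "xmode k \<xi> = cis (real k * (h * \<xi>)) * xmode 0 \<xi>" for k
      by (simp add: xmode_def mult_ac)
    have "(\<Sum>k<n. c k * xmode k \<xi>) = T (h * \<xi>) * xmode 0 \<xi>"
      unfolding T_def sum_distrib_right by (subst x) (simp only: mult.assoc)
    then show ?thesis by (simp add: norm_mult power_mult_distrib norm_xmode_square)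
  qed
  have T2: "complex_of_real ((cmod (T x))\<^sup>2) = (\<Sum>k<n. \<Sum>k'<n. c k * cnj (c k') * cis ((real k - real k') * x))" for x
  proof -
    have "complex_of_real ((cmod (T x))\<^sup>2) = T x * cnj (T x)" by (rule complex_norm_square)
    also have "\<dots> = (\<Sum>k<n. \<Sum>k'<n. (c k * cis (real k * x)) * cnj (c k' * cis (real k' * x)))"
      by (simp only: T_def cnj_sum sum_product)
    also have "\<dots> = (\<Sum>k<n. \<Sum>k'<n. c k * cnj (c k') * (cis (real k * x) * cis (- (real k' * x))))"
      by (simp only: complex_cnj_mult cis_cnj mult_ac)
    finally show ?thesis by (simp add: cis_mult left_diff_distrib)
  qed
  \<comment> \<open>Adding the value at the reflected point cancels the sines. The remaining cosines
    have known integrals against \<open>fejer\<close> over the half line.\<close>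
  have sum2: "(cmod (T x))\<^sup>2 + (cmod (T (- x)))\<^sup>2
      = (\<Sum>k<n. \<Sum>k'<n. 2 * Re (c k * cnj (c k')) * cos (of_int (int k - int k') * x))" for x
  proof -
    have Re: "(cmod (T x))\<^sup>2 = (\<Sum>k<n. \<Sum>k'<n. Re (c k * cnj (c k') * cis ((real k - real k') * x)))" for x
      using arg_cong[OF T2[of x], of Re] by (simp only: Re_complex_of_real Re_sum)
    have "Re (A * cis y) + Re (A * cis (- y)) = 2 * Re A * cos y" for A y by simp
    then show ?thesis unfolding Re sum.distrib[symmetric]
      by (simp only: of_int_diff of_int_of_nat_eq mult_minus_right)
  qed
  let ?B = "\<lambda>\<xi>. \<Sum>k<n. \<Sum>k'<n. 2 * Re (c k * cnj (c k')) * (cos (of_int (int k - int k') * h * \<xi>) * ((2 - 2 * cos (h * \<xi>)) / (h * \<xi>\<^sup>2)))"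
  have bound: "(cmod (\<Sum>k<n. c k * xmode k \<xi>))\<^sup>2 \<le> ?B \<xi>" for \<xi>
  proof -
    have "(cmod (\<Sum>k<n. c k * xmode k \<xi>))\<^sup>2 \<le> fejer \<xi> * ((cmod (T (h * \<xi>)))\<^sup>2 + (cmod (T (- (h * \<xi>))))\<^sup>2)"
      unfolding fac using fejer_nonneg by (intro mult_left_mono) auto
    also have "\<dots> = ?B \<xi>"
      unfolding sum2 sum_distrib_left by (simp only: fejer_def mult_ac)
    finally show ?thesis .
  qed
  note F = integral_fejer_cos[OF h]
  have intB: "integrable half_line ?B"
    by (intro Bochner_Integration.integrable_sum Bochner_Integration.integrable_mult_right F)
  show int: "integrable half_line (\<lambda>\<xi>. (cmod (\<Sum>k<n. c k * xmode k \<xi>))\<^sup>2)"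
  proof (rule Bochner_Integration.integrable_bound[OF intB])
    show "AE \<xi> in half_line. norm ((cmod (\<Sum>k<n. c k * xmode k \<xi>))\<^sup>2) \<le> norm (?B \<xi>)"
      using bound by (intro AE_I2) (smt (verit) real_norm_def zero_le_power2)
  qed (rule measurable_half_line, use xmode_measurable[measurable] in measurable)
  have "(LINT \<xi>|half_line. (cmod (\<Sum>k<n. c k * xmode k \<xi>))\<^sup>2) \<le> (LINT \<xi>|half_line. ?B \<xi>)"
    by (rule integral_mono[OF int intB bound])
  also have "\<dots> = (\<Sum>k<n. \<Sum>k'<n. 2 * Re (c k * cnj (c k')) * (if int k - int k' = 0 then pi else 0))"
    by (simp only: Bochner_Integration.integral_sum Bochner_Integration.integrable_sum Bochner_Integration.integrable_mult_right F integral_mult_right_zero)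
  also have "\<dots> = (\<Sum>k<n. \<Sum>k'<n. if k' = k then 2 * pi * Re (c k * cnj (c k)) else 0)"
    by (intro sum.cong refl) auto
  also have "\<dots> = 2 * pi * (\<Sum>k<n. (cmod (c k))\<^sup>2)"
    unfolding complex_norm_square[symmetric] Re_complex_of_real by (simp add: sum_distrib_left)
  finally show "(LINT \<xi>|half_line. (cmod (\<Sum>k<n. c k * xmode k \<xi>))\<^sup>2) \<le> 2 * pi * (\<Sum>k<n. (cmod (c k))\<^sup>2)" .
qed

lemma sum_cells: "(\<Sum>i<n * r. f i) = (\<Sum>l<r. \<Sum>k<n. f (k * r + l))" for f :: "nat \<Rightarrow> 'b::comm_monoid_add"
proof -
  have "(\<Sum>i<n * r. f i) = (\<Sum>k<n. sum f {k * r..<k * r + r})" by (rule sum.nat_group[symmetric])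
  also have "\<dots> = (\<Sum>k<n. \<Sum>l<r. f (k * r + l))"
  proof (rule sum.cong[OF refl])
    fix k
    show "sum f {k * r..<k * r + r} = (\<Sum>l<r. f (k * r + l))"
      using sum.shift_bounds_nat_ivl[of f 0 "k * r" r] by (simp add: atLeast0LessThan add.commute)
  qed
  also have "\<dots> = (\<Sum>l<r. \<Sum>k<n. f (k * r + l))" by (rule sum.swap)
  finally show ?thesis .
qed

text \<open>The sum of the squared moduli of the first \<open>n * r\<close> modes, divided by the
  symbol. It is the total of the eigenvector densities and tends to \<open>L / (2 * pi)\<close> when
  the mesh shrinks with \<open>n * h = L\<close>.\<close>

definition mode_density :: "nat \<Rightarrow> real \<Rightarrow> real" where
  "mode_density n \<xi> = real n * (\<xi> / pi) * fejer \<xi> * ((1 - exp (- \<xi> * w)) / (w * \<xi>\<^sup>2 * (1 + exp (- \<xi> * w))))"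

lemma mode_density_bounds:
  assumes "\<xi> > 0"
  shows "0 \<le> mode_density n \<xi>" "mode_density n \<xi> \<le> real n * h / (2 * pi)"
proof -
  show "0 \<le> mode_density n \<xi>"
    unfolding mode_density_def using assms w fejer_nonneg
    by (intro mult_nonneg_nonneg divide_nonneg_nonneg) (auto simp: add_nonneg_nonneg)
  have "mode_density n \<xi> \<le> real n * (\<xi> / pi) * h * (1 / (2 * \<xi>))"
    unfolding mode_density_def using assms w fejer_nonneg fejer_le ydens_le[OF assms] h
    by (intro mult_mono mult_left_mono mult_nonneg_nonneg divide_nonneg_nonneg) (auto simp: add_nonneg_nonneg)
  also have "\<dots> = real n * h / (2 * pi)" using assms by simp
  finally show "mode_density n \<xi> \<le> real n * h / (2 * pi)" .
qed

lemma sum_norm_mode_square: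
  assumes "\<xi> > 0"
  shows "(\<Sum>i<n * r. (cmod (mode i \<xi>))\<^sup>2) = strip_symbol a \<xi> * mode_density n \<xi>"
proof -
  have "(\<Sum>i<n * r. (cmod (mode i \<xi>))\<^sup>2) = (\<Sum>l<r. \<Sum>k<n. (\<xi> / pi) * (ymode l \<xi>)\<^sup>2 * fejer \<xi>)"
    unfolding sum_cells
  proof (intro sum.cong refl)
    fix l k assume "l \<in> {..<r}"
    then have "(k * r + l) mod r = l" "(k * r + l) div r = k" by auto
    then show "(cmod (mode (k * r + l) \<xi>))\<^sup>2 = (\<xi> / pi) * (ymode l \<xi>)\<^sup>2 * fejer \<xi>"
      using assms by (simp add: mode_def norm_mult power_mult_distrib norm_xmode_square)
  qed
  also have "\<dots> = real n * (\<xi> / pi) * fejer \<xi> * (\<Sum>l<r. (ymode l \<xi>)\<^sup>2)"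
    by (simp add: sum_distrib_left mult_ac)
  finally show ?thesis unfolding sum_ymode_square[OF assms] mode_density_def by (simp only: mult_ac)
qed

text \<open>Cauchy-Schwarz in the vertical direction leaves the Bessel inequality for the functions \<open>xmode k\<close>,
  which are orthogonal on the whole line.\<close>

lemma mode_bessel:
  fixes v :: "nat \<Rightarrow> complex"
  shows "integrable half_line (\<lambda>\<xi>. (cmod (\<Sum>i<n * r. v i * mode i \<xi>))\<^sup>2 / strip_symbol a \<xi>)"
    and "(LINT \<xi>|half_line. (cmod (\<Sum>i<n * r. v i * mode i \<xi>))\<^sup>2 / strip_symbol a \<xi>) \<le> (\<Sum>i<n * r. (cmod (v i))\<^sup>2)"
proof -
  let ?c = "\<lambda>l \<xi>. \<Sum>k<n. v (k * r + l) * xmode k \<xi>"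
  let ?B = "\<lambda>\<xi>. 1 / (2 * pi) * (\<Sum>l<r. (cmod (?c l \<xi>))\<^sup>2)"
  have bound: "(cmod (\<Sum>i<n * r. v i * mode i \<xi>))\<^sup>2 / strip_symbol a \<xi> \<le> ?B \<xi>" if "\<xi> \<in> space half_line" for \<xi>
  proof -
    have xi: "\<xi> > 0" using that by (simp add: space_restrict_space)
    have "(\<Sum>i<n * r. v i * mode i \<xi>) = (\<Sum>l<r. of_real (sqrt (\<xi> / pi) * ymode l \<xi>) * ?c l \<xi>)"
      unfolding sum_cells sum_distrib_left
    proof (intro sum.cong refl)
      fix l k assume "l \<in> {..<r}"
      then have "(k * r + l) mod r = l" "(k * r + l) div r = k" by auto
      then show "v (k * r + l) * mode (k * r + l) \<xi> = of_real (sqrt (\<xi> / pi) * ymode l \<xi>) * (v (k * r + l) * xmode k \<xi>)"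
        by (simp add: mode_def)
    qed
    also have "cmod \<dots> \<le> (\<Sum>l<r. sqrt (\<xi> / pi) * ymode l \<xi> * cmod (?c l \<xi>))"
      by (rule order_trans[OF norm_sum], rule sum_mono)
        (use xi ymode_nonneg[OF xi] in \<open>simp add: norm_mult abs_mult\<close>)
    finally have "(cmod (\<Sum>i<n * r. v i * mode i \<xi>))\<^sup>2 \<le> (\<Sum>l<r. (sqrt (\<xi> / pi) * ymode l \<xi>) * cmod (?c l \<xi>))\<^sup>2"
      by (intro power_mono) auto
    also have "\<dots> \<le> (\<Sum>l<r. (sqrt (\<xi> / pi) * ymode l \<xi>)\<^sup>2) * (\<Sum>l<r. (cmod (?c l \<xi>))\<^sup>2)"
      by (rule Cauchy_Schwarz_ineq_sum)
    also have "(\<Sum>l<r. (sqrt (\<xi> / pi) * ymode l \<xi>)\<^sup>2) = \<xi> / pi * (\<Sum>l<r. (ymode l \<xi>)\<^sup>2)"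
      using xi by (simp add: sum_distrib_left power_mult_distrib)
    \<comment> \<open>The factor \<open>\<xi>\<close> cancels and leaves the symbol over
      \<open>2 * pi\<close>; this constant is compensated by the squared norm \<open>2 * pi\<close>
      of the horizontal modes, so the final Bessel bound has constant 1.\<close>
    also have "\<dots> \<le> \<xi> / pi * (strip_symbol a \<xi> * (1 / (2 * \<xi>)))"
      unfolding sum_ymode_square[OF xi] using xi strip_symbol_pos[OF a xi]
      by (intro mult_left_mono ydens_le) auto
    also have "\<dots> = strip_symbol a \<xi> * (1 / (2 * pi))" using xi by simp
    finally have "(cmod (\<Sum>i<n * r. v i * mode i \<xi>))\<^sup>2 \<le> strip_symbol a \<xi> * (1 / (2 * pi)) * (\<Sum>l<r. (cmod (?c l \<xi>))\<^sup>2)"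
      by (simp add: mult_right_mono sum_nonneg)
    then show ?thesis using strip_symbol_pos[OF a xi] by (simp add: divide_le_eq mult_ac)
  qed
  have intB: "integrable half_line ?B"
    by (intro Bochner_Integration.integrable_mult_right Bochner_Integration.integrable_sum xmode_bessel)
  show int: "integrable half_line (\<lambda>\<xi>. (cmod (\<Sum>i<n * r. v i * mode i \<xi>))\<^sup>2 / strip_symbol a \<xi>)"
  proof (rule Bochner_Integration.integrable_bound[OF intB])
    show "AE \<xi> in half_line. norm ((cmod (\<Sum>i<n * r. v i * mode i \<xi>))\<^sup>2 / strip_symbol a \<xi>) \<le> norm (?B \<xi>)"
    proof (intro AE_I2)
      fix \<xi> assume x: "\<xi> \<in> space half_line"
      then have "strip_symbol a \<xi> > 0" using strip_symbol_pos[OF a] by (simp add: space_restrict_space)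
      then show "norm ((cmod (\<Sum>i<n * r. v i * mode i \<xi>))\<^sup>2 / strip_symbol a \<xi>) \<le> norm (?B \<xi>)"
        using bound[OF x] by (simp add: sum_nonneg)
    qed
  qed (unfold strip_symbol_def, rule measurable_half_line, use mode_measurable[measurable] in measurable)
  have "(LINT \<xi>|half_line. (cmod (\<Sum>i<n * r. v i * mode i \<xi>))\<^sup>2 / strip_symbol a \<xi>) \<le> (LINT \<xi>|half_line. ?B \<xi>)"
    by (rule integral_mono[OF int intB bound])
  also have "\<dots> = 1 / (2 * pi) * (\<Sum>l<r. LINT \<xi>|half_line. (cmod (?c l \<xi>))\<^sup>2)"
    by (simp only: Bochner_Integration.integral_sum xmode_bessel integral_mult_right_zero)
  also have "\<dots> \<le> 1 / (2 * pi) * (\<Sum>l<r. 2 * pi * (\<Sum>k<n. (cmod (v (k * r + l)))\<^sup>2))"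
    by (intro mult_left_mono sum_mono xmode_bessel) auto
  also have "\<dots> = (\<Sum>i<n * r. (cmod (v i))\<^sup>2)"
    unfolding sum_cells by (simp add: sum_distrib_left[symmetric])
  finally show "(LINT \<xi>|half_line. (cmod (\<Sum>i<n * r. v i * mode i \<xi>))\<^sup>2 / strip_symbol a \<xi>) \<le> (\<Sum>i<n * r. (cmod (v i))\<^sup>2)" .
qed

end

subsection \<open>Lower bounds for double sums\<close>

text \<open>On each interval the mean value theorem yields a value of \<open>g\<close> that the left
  endpoint dominates. Phrased with a primitive, the comparison of a Riemann sum with its integral
  involves no integration theory.\<close>

lemma antimono_left_sum_ge:
  fixes g G :: "real \<Rightarrow> real"
  assumes d: "\<And>x. x \<ge> c \<Longrightarrow> (G has_real_derivative g x) (at x)"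
    and anti: "\<And>x y. c \<le> x \<Longrightarrow> x \<le> y \<Longrightarrow> g y \<le> g x" and h: "h \<ge> 0"
  shows "G (c + real n * h) - G c \<le> (\<Sum>k<n. h * g (c + real k * h))"
proof (induction n)
  case (Suc n)
  have "G (c + real (Suc n) * h) - G (c + real n * h) \<le> h * g (c + real n * h)"
  proof (cases "h = 0")
    case False
    then have lt: "c + real n * h < c + real (Suc n) * h" using h by simp
    have ge: "c \<le> c + real n * h" using h by simp
    obtain z where z: "c + real n * h < z" "G (c + real (Suc n) * h) - G (c + real n * h) = (c + real (Suc n) * h - (c + real n * h)) * g z"
      using MVT2[OF lt, of G g] d ge by fastforce
    have "(c + real (Suc n) * h - (c + real n * h)) = h" by (simp add: algebra_simps)
    then show ?thesis using z anti[OF ge, of z] h by (simp add: mult_left_mono)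
  qed simp
  then show ?case using Suc by simp
qed simp


text \<open>Comparison with the telescoping differences \<open>1 / p - 1 / (p + h)\<close>. The
  terms are the tails lost near the ends of an interval, so a bound free of \<open>n\<close> is
  essential.\<close>

lemma sum_inverse_square_le:
  fixes h :: real
  assumes h: "h > 0"
  shows "(\<Sum>k<n. h / (1 + real k * h)\<^sup>2) \<le> h + 1"
proof -
  have "(\<Sum>k<Suc n. h / (1 + real k * h)\<^sup>2) \<le> h + 1 - 1 / (1 + real n * h)" for n
  proof (induction n)
    case (Suc n)
    define p where "p = 1 + real n * h"
    have p: "p > 0" "1 + real (Suc n) * h = p + h" using h by (auto simp: p_def algebra_simps add_pos_nonneg)
    have "h / (p + h)\<^sup>2 \<le> h / (p * (p + h))"
      using p h by (intro divide_left_mono) (auto simp: power2_eq_square)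
    also have "\<dots> = 1 / p - 1 / (p + h)" using p h by (simp add: field_simps)
    finally have "h / (p + h)\<^sup>2 \<le> 1 / p - 1 / (p + h)" .
    moreover have "(\<Sum>k<Suc n. h / (1 + real k * h)\<^sup>2) \<le> h + 1 - 1 / p" using Suc by (simp add: p_def)
    ultimately show ?case unfolding sum.lessThan_Suc[of _ "Suc n"] p(2) by linarith
  qed simp
  from this[of n] have "(\<Sum>k<Suc n. h / (1 + real k * h)\<^sup>2) \<le> h + 1"
    using h by (smt (verit) divide_nonneg_nonneg mult_nonneg_nonneg of_nat_0_le_iff)
  moreover have "(\<Sum>k<n. h / (1 + real k * h)\<^sup>2) \<le> (\<Sum>k<Suc n. h / (1 + real k * h)\<^sup>2)"
    using h by simp
  ultimately show ?thesis by linarith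
qed

section \<open>Riemann sums of the squared kernel\<close>

definition quartic_kernel :: "real \<Rightarrow> real \<Rightarrow> real" where
  "quartic_kernel s x = 1 / (x\<^sup>2 + s\<^sup>2)\<^sup>2"

text \<open>The primitive of \<open>quartic_kernel s\<close> that vanishes at 0; its limit at
  infinity is \<open>pi / (4 * s ^ 3)\<close>. By \<open>norm_K_H_square\<close> the function
  \<open>quartic_kernel s\<close> is \<open>pi\<^sup>2\<close> times the squared modulus of
  \<open>K_H\<close> at two heights with sum \<open>s\<close>.\<close>

definition quartic_primitive :: "real \<Rightarrow> real \<Rightarrow> real" where
  "quartic_primitive s x = x / (2 * s\<^sup>2 * (x\<^sup>2 + s\<^sup>2)) + arctan (x / s) / (2 * s ^ 3)"

lemma DERIV_inverse_power:
  fixes x c :: real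
  assumes "x + c \<noteq> 0"
  shows "((\<lambda>x. 1 / (x + c) ^ Suc n) has_real_derivative - real (Suc n) / (x + c) ^ Suc (Suc n)) (at x)"
proof -
  have "((\<lambda>x. (x + c) ^ Suc n) has_real_derivative real (Suc n) * (x + c) ^ n) (at x)"
    using DERIV_power[OF DERIV_add[OF DERIV_ident DERIV_const[of c]], of "Suc n" x] by simp
  from DERIV_divide[OF DERIV_const[of 1] this] assms
  have "((\<lambda>x. 1 / (x + c) ^ Suc n) has_real_derivative - (real (Suc n) * (x + c) ^ n) / ((x + c) ^ Suc n * (x + c) ^ Suc n)) (at x)"
    by simp
  also have "- (real (Suc n) * (x + c) ^ n) / ((x + c) ^ Suc n * (x + c) ^ Suc n) = - real (Suc n) / (x + c) ^ Suc (Suc n)"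
  proof -
    have "(x + c) ^ Suc n * (x + c) ^ Suc n = (x + c) ^ n * (x + c) ^ Suc (Suc n)" by simp
    moreover have "- (k * p) / (p * q) = - k / q" if "p \<noteq> 0" for k p q :: real using that by simp
    ultimately show ?thesis using assms by (simp only: power_not_zero not_False_eq_True)
  qed
  finally show ?thesis .
qed

lemma quartic_primitive_deriv:
  assumes s: "s > 0"
  shows "(quartic_primitive s has_real_derivative quartic_kernel s x) (at x)"
proof -
  have c: "x\<^sup>2 + s\<^sup>2 > 0" using s by (simp add: add_nonneg_pos)
  have "((\<lambda>x. 2 * s\<^sup>2 * (x\<^sup>2 + s\<^sup>2)) has_real_derivative 2 * s\<^sup>2 * (2 * x)) (at x)"
    by (auto intro!: derivative_eq_intros)
  moreover have "2 * s\<^sup>2 * (x\<^sup>2 + s\<^sup>2) \<noteq> 0" using s c by simp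
  ultimately have 1: "((\<lambda>x. x / (2 * s\<^sup>2 * (x\<^sup>2 + s\<^sup>2))) has_real_derivative
    (2 * s\<^sup>2 * (x\<^sup>2 + s\<^sup>2) - x * (2 * s\<^sup>2 * (2 * x))) / (2 * s\<^sup>2 * (x\<^sup>2 + s\<^sup>2))\<^sup>2) (at x)"
    using DERIV_divide[OF DERIV_ident, where s = UNIV and x = x]
    by (simp only: mult_1 power2_eq_square[of "2 * s\<^sup>2 * (x\<^sup>2 + s\<^sup>2)"])
  have "((\<lambda>x. arctan (x * (1 / s)) * (1 / (2 * s ^ 3))) has_real_derivative inverse (1 + (x * (1 / s))\<^sup>2) * (1 * (1 / s)) * (1 / (2 * s ^ 3))) (at x)"
    by (rule derivative_eq_intros refl)+ simp
  then have 2: "((\<lambda>x. arctan (x / s) / (2 * s ^ 3)) has_real_derivative (1 / s) / (1 + (x / s)\<^sup>2) / (2 * s ^ 3)) (at x)"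
    by (simp add: inverse_eq_divide mult_ac)
  have "((\<lambda>x. x / (2 * s\<^sup>2 * (x\<^sup>2 + s\<^sup>2)) + arctan (x / s) / (2 * s ^ 3)) has_real_derivative
    ((2 * s\<^sup>2 * (x\<^sup>2 + s\<^sup>2) - x * (2 * s\<^sup>2 * (2 * x))) / (2 * s\<^sup>2 * (x\<^sup>2 + s\<^sup>2))\<^sup>2 + (1 / s) / (1 + (x / s)\<^sup>2) / (2 * s ^ 3))) (at x)"
    by (rule DERIV_add[OF 1 2])
  also have "(1 / s) / (1 + (x / s)\<^sup>2) / (2 * s ^ 3) = 1 / (2 * s\<^sup>2 * (x\<^sup>2 + s\<^sup>2))"
    using s c by (simp add: divide_simps) (simp add: eval_nat_numeral algebra_simps)
  also have "(2 * s\<^sup>2 * (x\<^sup>2 + s\<^sup>2) - x * (2 * s\<^sup>2 * (2 * x))) / (2 * s\<^sup>2 * (x\<^sup>2 + s\<^sup>2))\<^sup>2 = (s\<^sup>2 - x\<^sup>2) / (2 * s\<^sup>2 * (x\<^sup>2 + s\<^sup>2)\<^sup>2)"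
  proof -
    have e1: "2 * s\<^sup>2 * (x\<^sup>2 + s\<^sup>2) - x * (2 * s\<^sup>2 * (2 * x)) = (2 * s\<^sup>2) * (s\<^sup>2 - x\<^sup>2)"
      by (simp add: algebra_simps power2_eq_square)
    have e2: "(2 * s\<^sup>2 * (x\<^sup>2 + s\<^sup>2))\<^sup>2 = (2 * s\<^sup>2) * (2 * s\<^sup>2 * (x\<^sup>2 + s\<^sup>2)\<^sup>2)"
      by (simp add: power2_eq_square)
    show ?thesis unfolding e1 e2 by (rule mult_divide_mult_cancel_left) (use s in simp)
  qed
  also have "(s\<^sup>2 - x\<^sup>2) / (2 * s\<^sup>2 * (x\<^sup>2 + s\<^sup>2)\<^sup>2) + 1 / (2 * s\<^sup>2 * (x\<^sup>2 + s\<^sup>2)) = quartic_kernel s x"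
  proof -
    have "1 / (2 * s\<^sup>2 * (x\<^sup>2 + s\<^sup>2)) = (x\<^sup>2 + s\<^sup>2) / (2 * s\<^sup>2 * (x\<^sup>2 + s\<^sup>2)\<^sup>2)"
      using c by (simp add: power2_eq_square[of "x\<^sup>2 + s\<^sup>2"])
    then have "(s\<^sup>2 - x\<^sup>2) / (2 * s\<^sup>2 * (x\<^sup>2 + s\<^sup>2)\<^sup>2) + 1 / (2 * s\<^sup>2 * (x\<^sup>2 + s\<^sup>2)) = (2 * s\<^sup>2) / (2 * s\<^sup>2 * (x\<^sup>2 + s\<^sup>2)\<^sup>2)"
      by (simp add: add_divide_distrib[symmetric])
    then show ?thesis using s unfolding quartic_kernel_def by simp
  qed
  finally show ?thesis unfolding quartic_primitive_def[abs_def] .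
qed

lemma quartic_kernel_antimono:
  assumes "s > 0" "0 \<le> x" "x \<le> y"
  shows "quartic_kernel s y \<le> quartic_kernel s x"
  unfolding quartic_kernel_def using assms
  by (intro divide_left_mono power_mono add_mono mult_pos_pos zero_less_power) (auto simp: add_nonneg_pos)

text \<open>The error \<open>1 / (1 + x)\<^sup>2\<close> is summable along a grid and does not
  involve \<open>s\<close>: a quantitative form of the convergence of the first moment of the
  squared kernel. For \<open>x \<le> 1\<close> the left side is not positive because
  \<open>s \<ge> 2\<close>; beyond that, \<open>arctan (x / s) = pi / 2 - arctan (s / x)\<close>
  gives the decay.\<close>

lemma quartic_primitive_tail:
  assumes s: "s \<ge> 2" and x: "x \<ge> 0"
  shows "pi / (4 * s ^ 3) - 1 / (1 + x)\<^sup>2 \<le> quartic_primitive s x"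
proof (cases "x \<le> 1")
  case True
  have "pi / (4 * s ^ 3) \<le> pi / (4 * 2 ^ 3)"
    using s by (intro divide_left_mono mult_left_mono power_mono) auto
  also have "\<dots> \<le> 1 / 4" using pi_less_4 by simp
  also have "1 / 4 \<le> 1 / (1 + x)\<^sup>2"
  proof -
    have "(1 + x)\<^sup>2 \<le> (1 + 1)\<^sup>2" using True x by (intro power_mono) auto
    then show ?thesis using x by (simp add: divide_simps add_pos_nonneg)
  qed
  finally have "pi / (4 * s ^ 3) - 1 / (1 + x)\<^sup>2 \<le> 0" by simp
  moreover have "0 \<le> quartic_primitive s x"
    unfolding quartic_primitive_def using s x by (intro add_nonneg_nonneg divide_nonneg_nonneg) auto
  ultimately show ?thesis by linarith
next
  case False
  then have x1: "x > 1" by simp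
  have s0: "s > 0" using s by simp
  have at: "arctan (x / s) \<ge> pi / 2 - s / x"
  proof -
    have "arctan (s / x) \<le> s / x" using s x1 by (intro arctan_le_self) auto
    moreover have "arctan (1 / (x / s)) = sgn (x / s) * pi / 2 - arctan (x / s)"
      using arctan_inverse[of "x / s"] x1 s by simp
    ultimately show ?thesis using x1 s by (simp add: sgn_if)
  qed
  have "pi / (4 * s ^ 3) - 1 / (2 * s\<^sup>2 * x) = (pi / 2 - s / x) / (2 * s ^ 3)"
    using s0 x1 by (simp add: field_simps power2_eq_square power3_eq_cube)
  also have "\<dots> \<le> arctan (x / s) / (2 * s ^ 3)"
    using at s0 by (intro divide_right_mono) auto
  finally have 1: "pi / (4 * s ^ 3) - 1 / (2 * s\<^sup>2 * x) \<le> arctan (x / s) / (2 * s ^ 3)" .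
  have c: "x\<^sup>2 + s\<^sup>2 > 0" using s0 by (simp add: add_nonneg_pos)
  have "1 / (2 * s\<^sup>2 * x) - x / (2 * s\<^sup>2 * (x\<^sup>2 + s\<^sup>2)) = ((x\<^sup>2 + s\<^sup>2) - x * x) / (2 * s\<^sup>2 * x * (x\<^sup>2 + s\<^sup>2))"
    using s0 x1 c by (simp add: divide_simps)
  also have "\<dots> = 1 / (2 * x * (x\<^sup>2 + s\<^sup>2))"
    using s0 x1 c by (simp add: power2_eq_square)
  also have "\<dots> \<le> 1 / (1 + x)\<^sup>2"
  proof (rule divide_left_mono)
    have "2\<^sup>2 \<le> s\<^sup>2" using s by (intro power_mono) auto
    then have "x\<^sup>2 + s\<^sup>2 \<ge> x\<^sup>2 + 4" by simp
    then have "2 * x * (x\<^sup>2 + s\<^sup>2) \<ge> 2 * x * (x\<^sup>2 + 4)" using x1 by (intro mult_left_mono) auto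
    moreover have "2 * x * (x\<^sup>2 + 4) \<ge> 2 * (x\<^sup>2 + 4)" using x1 mult_right_mono[of 1 x "2 * (x\<^sup>2 + 4)"] by (simp only: mult_1 mult.assoc mult.left_commute) simp
    moreover have "2 * (x\<^sup>2 + 4) \<ge> (1 + x)\<^sup>2"
      using zero_le_power2[of "x - 1"] by (simp add: power2_eq_square algebra_simps)
    ultimately show "(1 + x)\<^sup>2 \<le> 2 * x * (x\<^sup>2 + s\<^sup>2)" by (meson order_trans)
  qed (use x1 c in auto)
  finally show ?thesis using 1 unfolding quartic_primitive_def by linarith
qed

text \<open>In row \<open>k\<close> the distances to the left run below \<open>k + 1\<close> and
  those to the right below \<open>n - k\<close>, with the diagonal counted twice. Each half falls
  short of \<open>pi / (4 * s ^ 3)\<close> by at most a tail at the distance to an end. Over all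
  rows the tails cost at most \<open>2 * (h + 1)\<close>, and the double diagonal costs
  \<open>n * h * h / 16\<close> because \<open>s ^ 4 \<ge> 16\<close>.\<close>

lemma quartic_double_sum_ge:
  fixes h s :: real
  assumes h: "h > 0" and s: "s \<ge> 2"
  shows "real n * h * pi / (2 * s ^ 3) - 2 * (h + 1) - real n * h * h / 16
    \<le> (\<Sum>k<n. \<Sum>k'<n. h\<^sup>2 * quartic_kernel s ((real k - real k') * h))"
proof -
  have s0: "s > 0" using s by simp
  let ?q = "\<lambda>d. h * quartic_kernel s (real d * h)"
  have P: "pi / (4 * s ^ 3) - 1 / (1 + real k * h)\<^sup>2 \<le> (\<Sum>d<k. ?q d)" for k
  proof -
    have "pi / (4 * s ^ 3) - 1 / (1 + real k * h)\<^sup>2 \<le> quartic_primitive s (0 + real k * h) - quartic_primitive s 0"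
      using quartic_primitive_tail[OF s, of "real k * h"] h by (simp add: quartic_primitive_def)
    also have "\<dots> \<le> (\<Sum>d<k. h * quartic_kernel s (0 + real d * h))"
      by (rule antimono_left_sum_ge) (use s0 h in \<open>auto intro: quartic_primitive_deriv quartic_kernel_antimono\<close>)
    finally show ?thesis by simp
  qed
  have q0: "?q 0 \<le> h / 16"
  proof -
    have "2 ^ 4 \<le> s ^ 4" using s by (intro power_mono) auto
    then have "quartic_kernel s 0 \<le> 1 / 16"
      using s0 by (simp add: quartic_kernel_def divide_simps)
    then show ?thesis using h mult_left_mono[of "quartic_kernel s 0" "1/16" h] by simp
  qed
  have row: "pi / (2 * s ^ 3) - 1 / (1 + real k * h)\<^sup>2 - 1 / (1 + real (n - Suc k) * h)\<^sup>2 - h / 16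
      \<le> (\<Sum>k'<n. h * quartic_kernel s ((real k - real k') * h))" if k: "k < n" for k
  proof -
    have "{..<n} = {..k} \<union> {k<..<n}" using k by auto
    then have "(\<Sum>k'<n. h * quartic_kernel s ((real k - real k') * h))
      = (\<Sum>k'\<le>k. h * quartic_kernel s ((real k - real k') * h)) + (\<Sum>k'\<in>{k<..<n}. h * quartic_kernel s ((real k - real k') * h))"
      by (simp add: sum.union_disjoint ivl_disj_int)
    also have "(\<Sum>k'\<le>k. h * quartic_kernel s ((real k - real k') * h)) = (\<Sum>d<Suc k. ?q d)"
      by (rule sum.reindex_bij_witness[where i = "\<lambda>d. k - d" and j = "\<lambda>d. k - d"]) (auto simp: of_nat_diff)
    also have "(\<Sum>k'\<in>{k<..<n}. h * quartic_kernel s ((real k - real k') * h)) = (\<Sum>d\<in>{1..<n - k}. ?q d)"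
      by (rule sum.reindex_bij_witness[where i = "\<lambda>d. d + k" and j = "\<lambda>d. d - k"])
        (auto simp: of_nat_diff quartic_kernel_def power2_eq_square algebra_simps)
    also have "(\<Sum>d\<in>{1..<n - k}. ?q d) = (\<Sum>d<n - k. ?q d) - ?q 0"
    proof -
      have "{..<n - k} = insert 0 {1..<n - k}" using k by auto
      then show ?thesis by simp
    qed
    finally have e: "(\<Sum>k'<n. h * quartic_kernel s ((real k - real k') * h)) = (\<Sum>d<Suc k. ?q d) + (\<Sum>d<n - k. ?q d) - ?q 0"
      by simp
    \<comment> \<open>Both tails are moved one step towards the end of the interval, so that each
      family becomes the sum over \<open>k < n\<close> starting at distance 0.\<close>
    have mono: "1 / (1 + real (Suc m) * h)\<^sup>2 \<le> 1 / (1 + real m * h)\<^sup>2" for m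
      using h by (intro divide_left_mono power_mono mult_pos_pos zero_less_power) (auto simp: add_pos_nonneg)
    have nk: "n - k = Suc (n - Suc k)" using k by simp
    have half: "pi / (2 * s ^ 3) = pi / (4 * s ^ 3) + pi / (4 * s ^ 3)" by simp
    show ?thesis
      unfolding e half using P[of "Suc k"] P[of "n - k"] mono[of k] mono[of "n - Suc k"] q0 unfolding nk by linarith
  qed
  have "real n * h * pi / (2 * s ^ 3) - 2 * (h + 1) - real n * h * h / 16
    \<le> real n * h * pi / (2 * s ^ 3) - (\<Sum>k<n. h / (1 + real k * h)\<^sup>2) - (\<Sum>k<n. h / (1 + real (n - Suc k) * h)\<^sup>2) - real n * h * h / 16"
  proof -
    have "(\<Sum>k<n. h / (1 + real (n - Suc k) * h)\<^sup>2) = (\<Sum>k<n. h / (1 + real k * h)\<^sup>2)"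
      by (rule sum.nat_diff_reindex)
    moreover have "(A :: real) - 2 * (h + 1) - C \<le> A - B - B' - C" if "B' = B" "B \<le> h + 1" for A B B' C
    proof -
      have "B + B' \<le> (h + 1) + (h + 1)" using that by (intro add_mono) simp_all
      then show ?thesis by (simp add: algebra_simps)
    qed
    ultimately show ?thesis using sum_inverse_square_le[OF h, of n] by blast
  qed
  also have "\<dots> = (\<Sum>k<n. h * (pi / (2 * s ^ 3) - 1 / (1 + real k * h)\<^sup>2 - 1 / (1 + real (n - Suc k) * h)\<^sup>2 - h / 16))"
    by (simp add: sum_subtractf right_diff_distrib)
  also have "\<dots> \<le> (\<Sum>k<n. h * (\<Sum>k'<n. h * quartic_kernel s ((real k - real k') * h)))"
    using row h by (intro sum_mono mult_left_mono) auto
  also have "\<dots> = (\<Sum>k<n. \<Sum>k'<n. h\<^sup>2 * quartic_kernel s ((real k - real k') * h))"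
    by (simp add: sum_distrib_left power2_eq_square mult.assoc)
  finally show ?thesis .
qed

text \<open>Left Riemann sums of decreasing functions, one variable at a time. The bound is the
  integral of the inverse cube of \<open>y + y'\<close> over \<open>y\<close> and \<open>y'\<close>
  from 1 to \<open>a\<close>, and it equals the integral of the squared symbol; this agreement makes
  the terms linear in the length cancel later.\<close>

lemma cubic_double_sum_ge:
  fixes a w :: real
  assumes a: "a > 1" and r: "r > 0" and w: "w = (a - 1) / real r"
  shows "1 / 4 - 1 / (1 + a) + 1 / (4 * a)
    \<le> (\<Sum>l<r. \<Sum>l'<r. w\<^sup>2 * (1 / ((1 + real l * w) + (1 + real l' * w)) ^ 3))"
proof -
  have rw: "real r * w = a - 1" and w0: "w > 0" using w r a by auto
  define g where "g = (\<lambda>c. ((1 / (1 + c)\<^sup>2 - 1 / (a + c)\<^sup>2) / 2 :: real))"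
  have inner: "g c \<le> (\<Sum>l<r. w * (1 / ((1 + real l * w) + c) ^ 3))" if c: "c \<ge> 0" for c
  proof -
    have "(- 1 / (2 * (1 + real r * w + c)\<^sup>2)) - (- 1 / (2 * (1 + c)\<^sup>2)) \<le> (\<Sum>l<r. w * (1 / ((1 + real l * w) + c) ^ 3))"
    proof (rule antimono_left_sum_ge[where G = "\<lambda>y. - 1 / (2 * (y + c)\<^sup>2)" and g = "\<lambda>y. 1 / (y + c) ^ 3"])
      show "((\<lambda>y. - 1 / (2 * (y + c)\<^sup>2)) has_real_derivative 1 / (y + c) ^ 3) (at y)" if "1 \<le> y" for y
      proof -
        have "y + c \<noteq> 0" using that c by simp
        from DERIV_cmult[OF DERIV_inverse_power[OF this, of 1], of "- 1 / 2"] show ?thesis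
          by (simp add: eval_nat_numeral)
      qed
      show "1 / (y + c) ^ 3 \<le> 1 / (x + c) ^ 3" if "1 \<le> x" "x \<le> y" for x y
        using that c by (intro divide_left_mono power_mono mult_pos_pos zero_less_power) auto
    qed (use w0 in auto)
    moreover have "1 + real r * w + c = a + c" using rw by simp
    ultimately show ?thesis unfolding g_def by (simp add: diff_divide_distrib)
  qed
  have outer: "1 / 4 - 1 / (1 + a) + 1 / (4 * a) \<le> (\<Sum>l'<r. w * g (1 + real l' * w))"
  proof -
    have "(- 1 / (1 + (1 + real r * w)) + 1 / (a + (1 + real r * w))) / 2 - (- 1 / (1 + 1) + 1 / (a + 1)) / 2
      \<le> (\<Sum>l'<r. w * g (1 + real l' * w))"
    proof (rule antimono_left_sum_ge[where G = "\<lambda>y. (- 1 / (1 + y) + 1 / (a + y)) / 2"])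
      show "((\<lambda>y. (- 1 / (1 + y) + 1 / (a + y)) / 2) has_real_derivative g y) (at y)" if "1 \<le> y" for y
      proof -
        have "1 + y \<noteq> 0" "a + y \<noteq> 0" using that a by auto
        then show ?thesis unfolding g_def
          using DERIV_cmult[OF DERIV_add[OF DERIV_minus[OF DERIV_inverse_power[of y 1 0]] DERIV_inverse_power[of y a 0]], of "1 / 2"]
          by (simp add: eval_nat_numeral add_ac)
      qed
      show "g y \<le> g x" if xy: "1 \<le> x" "x \<le> y" for x y
      proof -
        have "(g has_real_derivative (- 1 / (1 + u) ^ 3 + 1 / (a + u) ^ 3)) (at u)" if "u \<ge> 1" for u
        proof -
          have "1 + u \<noteq> 0" "a + u \<noteq> 0" using that a by auto
          then show ?thesis unfolding g_def
            using DERIV_cmult[OF DERIV_diff[OF DERIV_inverse_power[of u 1 1] DERIV_inverse_power[of u a 1]], of "1 / 2"]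
            by (simp add: eval_nat_numeral add_ac diff_divide_distrib)
        qed
        moreover have "- 1 / (1 + u) ^ 3 + 1 / (a + u) ^ 3 \<le> 0" if "u \<ge> 1" for u
        proof -
          have "1 / (a + u) ^ 3 \<le> 1 / (1 + u) ^ 3"
            using that a by (intro divide_left_mono power_mono mult_pos_pos zero_less_power) auto
          then show ?thesis by simp
        qed
        ultimately show ?thesis
          using xy DERIV_nonpos_imp_nonincreasing[of x y g] by (meson order_trans)
      qed
    qed (use w0 in auto)
    also have "(- 1 / (1 + (1 + real r * w)) + 1 / (a + (1 + real r * w))) / 2 - (- 1 / (1 + 1) + 1 / (a + 1)) / 2
      = 1 / 4 - 1 / (1 + a) + 1 / (4 * a)"
    proof -
      have e: "1 + (1 + real r * w) = 1 + a" "a + (1 + real r * w) = 2 * a" using rw by auto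
      have q: "1 / (2 * a) = (1 / a) / 2" "1 / (4 * a) = (1 / a) / 4" "- 1 / (1 + a) = - (1 / (1 + a))" "a + 1 = 1 + a"
        by auto
      show ?thesis unfolding e q 
        by (simp add: diff_divide_distrib add_divide_distrib) (use a in \<open>simp add: divide_simps algebra_simps\<close>)
    qed
    finally show ?thesis .
  qed
  also have "\<dots> \<le> (\<Sum>l'<r. w * (\<Sum>l<r. w * (1 / ((1 + real l * w) + (1 + real l' * w)) ^ 3)))"
    by (intro sum_mono mult_left_mono inner) (use w0 in auto)
  also have "\<dots> = (\<Sum>l<r. \<Sum>l'<r. w\<^sup>2 * (1 / ((1 + real l * w) + (1 + real l' * w)) ^ 3))"
    by (subst sum.swap) (simp add: sum_distrib_left power2_eq_square mult.assoc)
  finally show ?thesis .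
qed

subsection \<open>The Gram matrix of a mesh\<close>

lemma nn_integral_half_line_FTC:
  fixes f F :: "real \<Rightarrow> real"
  assumes [measurable]: "f \<in> borel_measurable borel"
    and "\<And>x. 0 \<le> x \<Longrightarrow> (F has_real_derivative f x) (at x)" "\<And>x. 0 \<le> x \<Longrightarrow> 0 \<le> f x"
    and "(F \<longlongrightarrow> T) at_top"
  shows "has_bochner_integral half_line f (T - F 0)"
proof -
  have le: "F 0 \<le> T"
  proof (rule tendsto_lowerbound[OF assms(4)])
    show "\<forall>\<^sub>F x in at_top. F 0 \<le> F x"
      using eventually_ge_at_top[of 0]
    proof eventually_elim
      case (elim x)
      then show ?case using DERIV_nonneg_imp_nondecreasing[of 0 x F] assms(2,3) by blast
    qed
  qed simp
  show ?thesis
  proof (rule has_bochner_integral_nn_integral)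
    show "(\<integral>\<^sup>+ x. ennreal (f x) \<partial>half_line) = ennreal (T - F 0)"
      unfolding nn_integral_half_line by (rule nn_integral_FTC_atLeast) (use assms in auto)
    show "AE x in half_line. 0 \<le> f x"
      using assms(3) by (intro AE_I2) (simp add: space_restrict_space)
  qed (use le in \<open>auto intro: measurable_half_line\<close>)
qed

lemma half_line_closed:
  fixes f :: "real \<Rightarrow> 'b::{banach, second_countable_topology}"
  assumes f [measurable]: "f \<in> borel_measurable borel"
  shows "integrable half_line f \<longleftrightarrow> set_integrable lborel {0..} f"
    and "(LINT x|half_line. f x) = (LBINT x:{0..}. f x)"
proof -
  have ae: "AE x in lborel. indicator {0<..} x *\<^sub>R f x = indicator {0..} x *\<^sub>R f x"
    using AE_lborel_singleton[of "0::real"] by eventually_elim (auto simp: indicator_def)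
  have "integrable lborel (\<lambda>x. indicator {0<..} x *\<^sub>R f x) \<longleftrightarrow> integrable lborel (\<lambda>x. indicator {0..} x *\<^sub>R f x)"
    by (rule integrable_cong_AE[OF _ _ ae]) auto
  then show "integrable half_line f \<longleftrightarrow> set_integrable lborel {0..} f"
    by (simp add: set_integrable_def integrable_restrict_space)
  have "(LINT x|lborel. indicator {0<..} x *\<^sub>R f x) = (LINT x|lborel. indicator {0..} x *\<^sub>R f x)"
    by (rule integral_cong_AE[OF _ _ ae]) auto
  then show "(LINT x|half_line. f x) = (LBINT x:{0..}. f x)"
    by (simp add: set_lebesgue_integral_def integral_restrict_space)
qed

lemma integral_power_exp:
  fixes c :: real
  assumes c: "c > 0"
  shows "integrable half_line (\<lambda>x. exp (- c * x))" "(LINT x|half_line. exp (- c * x)) = 1 / c"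
    and "integrable half_line (\<lambda>x. x * exp (- c * x))" "(LINT x|half_line. x * exp (- c * x)) = 1 / c\<^sup>2"
    and "integrable half_line (\<lambda>x. x\<^sup>2 * exp (- c * x))" "(LINT x|half_line. x\<^sup>2 * exp (- c * x)) = 2 / c ^ 3"
proof -
  have "has_bochner_integral half_line (\<lambda>x. exp (- c * x)) (0 - (- (1 / c) * exp (- c * 0)))"
  proof (rule nn_integral_half_line_FTC[where F = "\<lambda>x. - (1 / c) * exp (- c * x)"])
    show "((\<lambda>x. - (1 / c) * exp (- c * x)) has_real_derivative exp (- c * x)) (at x)" for x
      using c by (auto intro!: derivative_eq_intros)
    show "((\<lambda>x. - (1 / c) * exp (- c * x)) \<longlongrightarrow> 0) at_top" using c by real_asymp
  qed auto
  then show "integrable half_line (\<lambda>x. exp (- c * x))" "(LINT x|half_line. exp (- c * x)) = 1 / c"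
    by (simp_all add: has_bochner_integral_iff)
  let ?F1 = "\<lambda>x. - (x / c + 1 / c\<^sup>2) * exp (- c * x)"
  have "has_bochner_integral half_line (\<lambda>x. x * exp (- c * x)) (0 - ?F1 0)"
  proof (rule nn_integral_half_line_FTC[where F = ?F1])
    show "(?F1 has_real_derivative x * exp (- c * x)) (at x)" for x
      using c by (auto intro!: derivative_eq_intros simp: field_simps power2_eq_square)
    show "(?F1 \<longlongrightarrow> 0) at_top" using c by real_asymp
  qed auto
  then show "integrable half_line (\<lambda>x. x * exp (- c * x))" "(LINT x|half_line. x * exp (- c * x)) = 1 / c\<^sup>2"
    by (simp_all add: has_bochner_integral_iff)
  let ?F2 = "\<lambda>x. - (x\<^sup>2 / c + 2 * x / c\<^sup>2 + 2 / c ^ 3) * exp (- c * x)"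
  have "has_bochner_integral half_line (\<lambda>x. x\<^sup>2 * exp (- c * x)) (0 - ?F2 0)"
  proof (rule nn_integral_half_line_FTC[where F = ?F2])
    show "(?F2 has_real_derivative x\<^sup>2 * exp (- c * x)) (at x)" for x
      using c by (auto intro!: derivative_eq_intros simp: field_simps power2_eq_square power3_eq_cube)
    show "(?F2 \<longlongrightarrow> 0) at_top" using c by real_asymp
  qed auto
  then show "integrable half_line (\<lambda>x. x\<^sup>2 * exp (- c * x))" "(LINT x|half_line. x\<^sup>2 * exp (- c * x)) = 2 / c ^ 3"
    by (simp_all add: has_bochner_integral_iff)
qed

text \<open>The half line is exhausted by the intervals \<open>{0..y}\<close>, on which the
  primitive \<open>?F\<close> evaluates the integral; it decays at infinity because
  \<open>Re z > 0\<close>.\<close>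

lemma integral_complex_exp_moment:
  fixes z :: complex
  assumes z: "Re z > 0"
  shows "integrable half_line (\<lambda>x. of_real x * exp (- of_real x * z))"
    and "(LINT x|half_line. of_real x * exp (- of_real x * z)) = 1 / z\<^sup>2"
proof -
  have z0: "z \<noteq> 0" using z by auto
  let ?f = "\<lambda>x::real. of_real x * exp (- of_real x * z)"
  let ?F = "\<lambda>x::real. - (of_real x / z + 1 / z\<^sup>2) * exp (- of_real x * z)"
  have nf: "cmod (?f x) = x * exp (- Re z * x)" if "x \<ge> 0" for x
    using that by (simp add: norm_mult mult.commute)
  have cont: "continuous_on UNIV ?f" by (intro continuous_intros)
  have meas: "?f \<in> borel_measurable half_line"
    by (rule measurable_half_line) (use cont in \<open>simp add: borel_measurable_continuous_onI\<close>)
  show int: "integrable half_line ?f"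
  proof (rule Bochner_Integration.integrable_bound[OF integral_power_exp(3)[OF z] meas])
    show "AE x in half_line. cmod (?f x) \<le> norm (x * exp (- Re z * x))"
      using nf by (intro AE_I2) (simp add: space_restrict_space)
  qed
  have D: "(?F has_vector_derivative ?f x) (at x within S)" for x S
  proof -
    have "((\<lambda>w. - (w / z + 1 / z\<^sup>2) * exp (- w * z)) has_field_derivative of_real x * exp (- of_real x * z)) (at (of_real x))"
      using z0 by (auto intro!: derivative_eq_intros simp: field_simps power2_eq_square)
    from has_vector_derivative_real_field[OF this] show ?thesis .
  qed
  have "((\<lambda>y. LBINT x:{0..y}. ?f x) \<longlongrightarrow> (LINT x|half_line. ?f x)) at_top"
  proof -
    have "?f \<in> borel_measurable borel" using cont by (rule borel_measurable_continuous_onI)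
    note half_line_closed[OF this]
    then have eq: "(LINT x|half_line. ?f x) = (LBINT x:{0..}. ?f x)" and si: "set_integrable lborel {0..} ?f"
      using int by auto
    show ?thesis unfolding eq by (rule tendsto_set_lebesgue_integral_at_top) (use si in auto)
  qed
  moreover have "((\<lambda>y. LBINT x:{0..y}. ?f x) \<longlongrightarrow> 0 - ?F 0) at_top"
  proof -
    have "\<forall>\<^sub>F y in at_top. ?F y - ?F 0 = (LBINT x:{0..y}. ?f x)"
      using eventually_ge_at_top[of 0]
    proof eventually_elim
      case (elim y)
      have "(\<integral>x. indicator {0..y} x *\<^sub>R ?f x \<partial>lborel) = ?F y - ?F 0"
        by (rule integral_FTC_Icc[OF elim]) (use D cont in \<open>auto intro: continuous_on_subset\<close>)
      then show ?case by (simp add: set_lebesgue_integral_def)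
    qed
    moreover have "((\<lambda>y. ?F y - ?F 0) \<longlongrightarrow> 0 - ?F 0) at_top"
    proof (intro tendsto_diff tendsto_const)
      show "(?F \<longlongrightarrow> 0) at_top"
      proof (rule Lim_null_comparison[where g = "\<lambda>x. (x / cmod z + 1 / (cmod z)\<^sup>2) * exp (- x * Re z)"])
        show "\<forall>\<^sub>F x in at_top. cmod (?F x) \<le> (x / cmod z + 1 / (cmod z)\<^sup>2) * exp (- x * Re z)"
          using eventually_ge_at_top[of 0]
        proof eventually_elim
          case (elim x)
          have "cmod (of_real x / z + 1 / z\<^sup>2) \<le> x / cmod z + 1 / (cmod z)\<^sup>2"
            by (rule order_trans[OF norm_triangle_ineq]) (use elim in \<open>simp add: norm_divide norm_power\<close>)
          then have "cmod (of_real x / z + 1 / z\<^sup>2) * exp (- x * Re z) \<le> (x / cmod z + 1 / (cmod z)\<^sup>2) * exp (- x * Re z)"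
            by (intro mult_right_mono) auto
          moreover have "cmod (?F x) = cmod (of_real x / z + 1 / z\<^sup>2) * exp (- x * Re z)"
            by (simp only: norm_mult norm_minus_cancel norm_exp_eq_Re) simp
          ultimately show ?case by simp
        qed
        show "((\<lambda>x. (x / cmod z + 1 / (cmod z)\<^sup>2) * exp (- x * Re z)) \<longlongrightarrow> 0) at_top"
        proof -
          obtain q p where "q = cmod z" "p = Re z" "q > 0" "p > 0" using z z0 by auto
          then show ?thesis by (simp only:) real_asymp
        qed
      qed
    qed
    ultimately show ?thesis by (rule Lim_transform_eventually[rotated])
  qed
  ultimately have "(LINT x|half_line. ?f x) = 0 - ?F 0"
    by (rule tendsto_unique[rotated]) simp
  then show "(LINT x|half_line. ?f x) = 1 / z\<^sup>2" by simp
qed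

text \<open>The function \<open>exp (\<i> * \<xi> * z)\<close>, with the real and the imaginary part
  of \<open>z\<close> separated to suit the product structure of the cells.\<close>

definition wave :: "complex \<Rightarrow> real \<Rightarrow> complex" where
  "wave z \<xi> = cis (\<xi> * Re z) * of_real (exp (- \<xi> * Im z))"

lemma K_H_eq_integral:
  assumes "Im z > 0" "Im z' > 0"
  shows "integrable half_line (\<lambda>\<xi>. of_real (\<xi> / pi) * (wave z \<xi> * cnj (wave z' \<xi>)))"
    and "K_H z z' = (LINT \<xi>|half_line. of_real (\<xi> / pi) * (wave z \<xi> * cnj (wave z' \<xi>)))"
proof -
  \<comment> \<open>The rotation turns positivity of the imaginary parts into
    \<open>Re u > 0\<close>, and the sign of \<open>u\<^sup>2\<close> accounts for the minus sign in
    \<open>K_H\<close>.\<close>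
  define u where "u = - \<i> * (z - cnj z')"
  have u: "Re u > 0" using assms by (simp add: u_def)
  have w: "of_real (\<xi> / pi) * (wave z \<xi> * cnj (wave z' \<xi>)) = 1 / of_real pi * (of_real \<xi> * exp (- of_real \<xi> * u))" for \<xi>
  proof -
    have "wave z \<xi> * cnj (wave z' \<xi>) = cis (\<xi> * (Re z - Re z')) * of_real (exp (- \<xi> * (Im z + Im z')))"
    proof -
      have "wave z \<xi> * cnj (wave z' \<xi>) = (cis (\<xi> * Re z) * cis (- (\<xi> * Re z'))) * of_real (exp (- \<xi> * Im z) * exp (- \<xi> * Im z'))"
        by (simp add: wave_def cis_cnj)
      then show ?thesis unfolding cis_mult exp_add[symmetric] by (simp add: algebra_simps)
    qed
    also have "\<dots> = exp (- of_real \<xi> * u)"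
      by (simp add: cis_conv_exp exp_of_real[symmetric] exp_add[symmetric] del: exp_of_real, rule arg_cong[where f = exp])
        (simp add: u_def complex_eq_iff algebra_simps)
    finally show ?thesis by simp
  qed
  note I = integral_complex_exp_moment[OF u]
  show "integrable half_line (\<lambda>\<xi>. of_real (\<xi> / pi) * (wave z \<xi> * cnj (wave z' \<xi>)))"
    unfolding w by (rule integrable_mult_right[OF I(1)])
  have "u\<^sup>2 = - (z - cnj z')\<^sup>2" by (simp add: u_def power_mult_distrib)
  then have "K_H z z' = 1 / of_real pi * (1 / u\<^sup>2)" by (simp add: K_H_def)
  then show "K_H z z' = (LINT \<xi>|half_line. of_real (\<xi> / pi) * (wave z \<xi> * cnj (wave z' \<xi>)))"
    unfolding w by (simp add: I(2)[symmetric] del: I(2))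
qed

lemma norm_cis_minus_1_le: "cmod (cis u - 1) \<le> \<bar>u\<bar>"
  using iexp_approx1[of u 0] by (simp add: cis_conv_exp)

text \<open>The quotient is the mean of \<open>cis\<close> over the interval from 0 to
  \<open>u\<close>. It differs from 1 by at most \<open>u / 2\<close>, and \<open>cis s\<close>
  differs from 1 by at most \<open>u\<close>.\<close>

lemma norm_cis_average:
  assumes "u > 0" "0 \<le> s" "s \<le> u"
  shows "cmod ((cis u - 1) / (\<i> * of_real u) - cis s) \<le> 3 / 2 * u"
proof -
  have "cmod (cis u - (1 + \<i> * of_real u)) \<le> u\<^sup>2 / 2"
    using iexp_approx1[of u 1] by (simp add: cis_conv_exp eval_nat_numeral)
  then have "cmod (cis u - (1 + \<i> * of_real u)) / u \<le> u\<^sup>2 / 2 / u"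
    using assms(1) by (intro divide_right_mono) auto
  moreover have "(cis u - 1) / (\<i> * of_real u) - 1 = (cis u - (1 + \<i> * of_real u)) / (\<i> * of_real u)"
    using assms(1) by (simp add: field_simps)
  ultimately have "cmod ((cis u - 1) / (\<i> * of_real u) - 1) \<le> u / 2"
    using assms(1) by (simp add: norm_divide norm_mult power2_eq_square)
  moreover have "cmod (1 - cis s) \<le> u"
    using norm_cis_minus_1_le[of s] assms by (simp add: norm_minus_commute)
  moreover have "(cis u - 1) / (\<i> * of_real u) - cis s = ((cis u - 1) / (\<i> * of_real u) - 1) + (1 - cis s)" by simp
  ultimately show ?thesis using norm_triangle_ineq[of "(cis u - 1) / (\<i> * of_real u) - 1" "1 - cis s"] by simp
qed

text \<open>The quotient is the mean of \<open>exp (- t)\<close> for \<open>t\<close> from 0 to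
  \<open>v\<close>; both this mean and \<open>exp (- s)\<close> lie between \<open>1 - v\<close> and
  1.\<close>

lemma exp_average:
  fixes v :: real
  assumes v: "v > 0" and s: "0 \<le> s" "s \<le> v"
  shows "0 \<le> (1 - exp (- v)) / v" "(1 - exp (- v)) / v \<le> 1" "\<bar>(1 - exp (- v)) / v - exp (- s)\<bar> \<le> v"
proof -
  have e1: "1 - v \<le> exp (- v)" using exp_ge_add_one_self[of "- v"] by simp
  have e2: "exp (- v) \<le> 1 - v + v\<^sup>2"
  proof -
    have "(1 + v) * exp (- v) \<le> exp v * exp (- v)" by (intro mult_right_mono exp_ge_add_one_self) auto
    then have "(1 + v) * exp (- v) \<le> 1" by (simp add: exp_add[symmetric])
    also have "1 \<le> (1 + v) * (1 - v + v\<^sup>2)" using v by (simp add: algebra_simps power2_eq_square)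
    finally show ?thesis using v by simp
  qed
  show "0 \<le> (1 - exp (- v)) / v" "(1 - exp (- v)) / v \<le> 1" using v e1 by (auto simp: divide_le_eq)
  moreover have "1 - v \<le> (1 - exp (- v)) / v" using v e2 by (simp add: le_divide_eq algebra_simps power2_eq_square)
  moreover have "1 - v \<le> exp (- s)" "exp (- s) \<le> 1" using exp_ge_add_one_self[of "- s"] s by auto
  ultimately show "\<bar>(1 - exp (- v)) / v - exp (- s)\<bar> \<le> v" by linarith
qed

section \<open>Cell averages of the kernel\<close>

context mesh
begin

text \<open>The mean of \<open>wave z \<xi>\<close> over the points \<open>z\<close> of cell
  \<open>i\<close>. Unlike \<open>mode\<close> it is not normalised in \<open>L\<^sup>2\<close>, so
  it can be compared with point values.\<close>

definition avg :: "nat \<Rightarrow> real \<Rightarrow> complex" where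
  "avg i \<xi> = of_real (exp (- \<xi> * (1 + real (i mod r) * w)) * ((1 - exp (- \<xi> * w)) / (\<xi> * w)))
    * (cis (\<xi> * real (i div r) * h) * ((cis (\<xi> * h) - 1) / (\<i> * of_real (\<xi> * h))))"

definition in_cell :: "nat \<Rightarrow> complex \<Rightarrow> bool" where
  "in_cell i z \<longleftrightarrow> real (i div r) * h \<le> Re z \<and> Re z \<le> real (Suc (i div r)) * h
    \<and> 1 + real (i mod r) * w \<le> Im z \<and> Im z \<le> 1 + real (Suc (i mod r)) * w"

lemma mode_eq_avg: "mode i \<xi> = of_real (sqrt (\<xi> / pi) * sqrt (h * w)) * avg i \<xi>"
proof -
  have *: "complex_of_real w = of_real (sqrt w) * of_real (sqrt w)" "complex_of_real h = of_real (sqrt h) * of_real (sqrt h)"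
    using w h by (simp_all flip: of_real_mult)
  show ?thesis
    unfolding mode_def avg_def ymode_def xmode_def using w h
    by (simp add: real_sqrt_mult * mult_ac)
qed

lemma norm_avg_le: "\<xi> > 0 \<Longrightarrow> cmod (avg i \<xi>) \<le> exp (- \<xi>)"
proof -
  assume xi: "\<xi> > 0"
  have v: "\<xi> * w > 0" "\<xi> * h > 0" using xi w h by auto
  have "cmod ((cis (\<xi> * h) - 1) / (\<i> * of_real (\<xi> * h))) \<le> 1"
    using norm_cis_minus_1_le[of "\<xi> * h"] xi h by (simp add: norm_divide norm_mult divide_le_eq)
  moreover have "exp (- \<xi> * (1 + real (i mod r) * w)) \<le> exp (- \<xi>)" using xi w by simp
  moreover have "0 \<le> (1 - exp (- \<xi> * w)) / (\<xi> * w)" "(1 - exp (- \<xi> * w)) / (\<xi> * w) \<le> 1"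
    using exp_average(1,2)[OF v(1), of 0] v by auto
  ultimately have "exp (- \<xi> * (1 + real (i mod r) * w)) * ((1 - exp (- \<xi> * w)) / (\<xi> * w)) * (1 * cmod ((cis (\<xi> * h) - 1) / (\<i> * of_real (\<xi> * h)))) \<le> (exp (- \<xi>) * 1) * (1 * 1)"
    by (intro mult_mono mult_nonneg_nonneg) auto
  moreover have "cmod (avg i \<xi>) = exp (- \<xi> * (1 + real (i mod r) * w)) * ((1 - exp (- \<xi> * w)) / (\<xi> * w)) * (1 * cmod ((cis (\<xi> * h) - 1) / (\<i> * of_real (\<xi> * h))))"
    unfolding avg_def norm_mult norm_cis norm_of_real abs_mult
    using \<open>0 \<le> (1 - exp (- \<xi> * w)) / (\<xi> * w)\<close> by (simp only: abs_of_nonneg abs_exp_cancel)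
  ultimately show ?thesis by simp
qed

lemma norm_wave_le: "\<xi> > 0 \<Longrightarrow> 1 \<le> Im z \<Longrightarrow> cmod (wave z \<xi>) \<le> exp (- \<xi>)"
  by (simp add: wave_def norm_mult)

text \<open>The value at the lower left corner is a common factor of modulus at most
  \<open>exp (- \<xi>)\<close>. What remains compares a mean with a point value, separately in the
  two directions.\<close>

lemma avg_close_wave:
  assumes xi: "\<xi> > 0" and z: "in_cell i z"
  shows "cmod (avg i \<xi> - wave z \<xi>) \<le> exp (- \<xi>) * (3 / 2 * \<xi> * (h + w))"
proof -
  have v: "\<xi> * w > 0" "\<xi> * h > 0" using xi w h by auto
  define k where "k = i div r" define l where "l = i mod r"
  define s where "s = \<xi> * (Re z - real k * h)"
  define s' where "s' = \<xi> * (Im z - (1 + real l * w))"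
  have s: "0 \<le> s" "s \<le> \<xi> * h" and s': "0 \<le> s'" "s' \<le> \<xi> * w"
  proof -
    have "0 \<le> Re z - real k * h" "Re z - real k * h \<le> h" "0 \<le> Im z - (1 + real l * w)" "Im z - (1 + real l * w) \<le> w"
      using z unfolding k_def l_def in_cell_def by (auto simp: algebra_simps)
    then show "0 \<le> s" "s \<le> \<xi> * h" "0 \<le> s'" "s' \<le> \<xi> * w"
      unfolding s_def s'_def using xi by (auto intro!: mult_nonneg_nonneg mult_left_mono)
  qed
  define X where "X = (cis (\<xi> * h) - 1) / (\<i> * of_real (\<xi> * h))"
  define Y where "Y = (1 - exp (- (\<xi> * w))) / (\<xi> * w)"
  define P where "P = exp (- \<xi> * (1 + real l * w))"
  define C where "C = cis (\<xi> * real k * h)"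
  have A: "avg i \<xi> = of_real P * C * (of_real Y * X)"
    by (simp add: avg_def P_def C_def Y_def X_def k_def l_def)
  have W: "wave z \<xi> = of_real P * C * (of_real (exp (- s')) * cis s)"
  proof -
    have "cis (\<xi> * Re z) = C * cis s" by (simp add: C_def s_def cis_mult algebra_simps)
    moreover have "exp (- \<xi> * Im z) = P * exp (- s')" by (simp add: P_def s'_def exp_add[symmetric] algebra_simps)
    ultimately show ?thesis by (simp add: wave_def)
  qed
  have X1: "cmod (X - cis s) \<le> 3 / 2 * (\<xi> * h)" unfolding X_def by (rule norm_cis_average[OF v(2) s])
  have Y1: "\<bar>Y - exp (- s')\<bar> \<le> \<xi> * w" "0 \<le> Y" "Y \<le> 1" unfolding Y_def using exp_average[OF v(1) s'] by auto
  have "of_real Y * X - of_real (exp (- s')) * cis s = of_real Y * (X - cis s) + of_real (Y - exp (- s')) * cis s"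
    by (simp add: algebra_simps)
  also have "cmod \<dots> \<le> Y * cmod (X - cis s) + \<bar>Y - exp (- s')\<bar>"
    by (rule order_trans[OF norm_triangle_ineq]) (use Y1 in \<open>simp add: norm_mult del: of_real_diff\<close>)
  also have "\<dots> \<le> 1 * (3 / 2 * (\<xi> * h)) + \<xi> * w" using X1 Y1 by (intro add_mono mult_mono) auto
  also have "\<dots> \<le> 3 / 2 * \<xi> * (h + w)" using v by (simp add: algebra_simps)
  finally have d: "cmod (of_real Y * X - of_real (exp (- s')) * cis s) \<le> 3 / 2 * \<xi> * (h + w)" .
  have P: "0 \<le> P" "P \<le> exp (- \<xi>)" using xi w by (auto simp: P_def)
  have "avg i \<xi> - wave z \<xi> = of_real P * C * (of_real Y * X - of_real (exp (- s')) * cis s)"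
    unfolding A W by (simp add: algebra_simps)
  then have "cmod (avg i \<xi> - wave z \<xi>) = P * cmod (of_real Y * X - of_real (exp (- s')) * cis s)"
    using P by (simp add: norm_mult C_def)
  also have "\<dots> \<le> exp (- \<xi>) * (3 / 2 * \<xi> * (h + w))" using d P by (intro mult_mono) auto
  finally show ?thesis .
qed

lemma avg_measurable: "avg i \<in> borel_measurable borel"
  unfolding avg_def[abs_def]
proof (rule borel_measurable_times)
  show "(\<lambda>\<xi>. complex_of_real (exp (- \<xi> * (1 + real (i mod r) * w)) * ((1 - exp (- \<xi> * w)) / (\<xi> * w)))) \<in> borel_measurable borel"
    by measurable
  show "(\<lambda>\<xi>. cis (\<xi> * real (i div r) * h) * ((cis (\<xi> * h) - 1) / (\<i> * of_real (\<xi> * h)))) \<in> borel_measurable borel"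
    by (rule borel_measurable_times[OF _ borel_measurable_divide];
        rule borel_measurable_continuous_onI; intro continuous_intros)
qed

lemma integrable_avg_product:
  shows "integrable half_line (\<lambda>\<xi>. of_real (\<xi> / pi) * (avg i \<xi> * cnj (avg j \<xi>)))"
    and "cmod (LINT \<xi>|half_line. of_real (\<xi> / pi) * (avg i \<xi> * cnj (avg j \<xi>))) \<le> 1"
proof -
  have b: "integrable half_line (\<lambda>\<xi>. 1 / pi * (\<xi> * exp (- 2 * \<xi>)))"
    by (rule integrable_mult_right) (rule integral_power_exp, simp)
  have le: "cmod (of_real (\<xi> / pi) * (avg i \<xi> * cnj (avg j \<xi>))) \<le> 1 / pi * (\<xi> * exp (- 2 * \<xi>))" if "\<xi> \<in> space half_line" for \<xi>
  proof -
    have xi: "\<xi> > 0" using that by (simp add: space_restrict_space)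
    have "cmod (of_real (\<xi> / pi) * (avg i \<xi> * cnj (avg j \<xi>))) = \<xi> / pi * (cmod (avg i \<xi>) * cmod (avg j \<xi>))"
      using xi by (simp add: norm_mult norm_divide)
    also have "\<dots> \<le> \<xi> / pi * (exp (- \<xi>) * exp (- \<xi>))"
      using xi norm_avg_le[OF xi] by (intro mult_left_mono mult_mono) auto
    also have "\<dots> = 1 / pi * (\<xi> * exp (- 2 * \<xi>))" by (simp add: exp_add[symmetric])
    finally show ?thesis .
  qed
  show int: "integrable half_line (\<lambda>\<xi>. of_real (\<xi> / pi) * (avg i \<xi> * cnj (avg j \<xi>)))"
  proof (rule Bochner_Integration.integrable_bound[OF b])
    show "AE \<xi> in half_line. norm (complex_of_real (\<xi> / pi) * (avg i \<xi> * cnj (avg j \<xi>))) \<le> norm (1 / pi * (\<xi> * exp (- 2 * \<xi>)))"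
      using le by (intro AE_I2) (smt (verit) real_norm_def)
    show "(\<lambda>\<xi>. complex_of_real (\<xi> / pi) * (avg i \<xi> * cnj (avg j \<xi>))) \<in> borel_measurable half_line"
    proof (rule measurable_half_line)
      have [measurable]: "avg i \<in> borel_measurable borel" by (rule avg_measurable)
      have "cnj \<in> borel_measurable borel" by (intro borel_measurable_continuous_onI continuous_intros)
      then have [measurable]: "(\<lambda>\<xi>. cnj (avg j \<xi>)) \<in> borel_measurable borel"
        using measurable_compose[OF avg_measurable] by blast
      show "(\<lambda>\<xi>. complex_of_real (\<xi> / pi) * (avg i \<xi> * cnj (avg j \<xi>))) \<in> borel_measurable lborel" by measurable
    qed
  qed
  have "cmod (LINT \<xi>|half_line. of_real (\<xi> / pi) * (avg i \<xi> * cnj (avg j \<xi>))) \<le> (LINT \<xi>|half_line. 1 / pi * (\<xi> * exp (- 2 * \<xi>)))"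
    by (rule order_trans[OF integral_norm_bound integral_mono]) (use int b le in auto)
  also have "\<dots> = 1 / pi * (1 / 2\<^sup>2)" using integral_power_exp(4)[of 2] by (simp add: field_simps)
  also have "\<dots> \<le> 1" using pi_gt3 by simp
  finally show "cmod (LINT \<xi>|half_line. of_real (\<xi> / pi) * (avg i \<xi> * cnj (avg j \<xi>))) \<le> 1" .
qed

lemma mode_product:
  "\<xi> > 0 \<Longrightarrow> mode i \<xi> * cnj (mode j \<xi>) = of_real (h * w) * (of_real (\<xi> / pi) * (avg i \<xi> * cnj (avg j \<xi>)))"
proof -
  assume "\<xi> > 0"
  then have "(sqrt (\<xi> / pi) * sqrt (h * w)) * (sqrt (\<xi> / pi) * sqrt (h * w)) = h * w * (\<xi> / pi)"
    using h w by (simp add: mult_ac)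
  then have "complex_of_real (sqrt (\<xi> / pi) * sqrt (h * w)) * of_real (sqrt (\<xi> / pi) * sqrt (h * w)) = of_real (h * w * (\<xi> / pi))"
    by (simp only: of_real_mult[symmetric])
  moreover have "mode i \<xi> * cnj (mode j \<xi>) = (complex_of_real (sqrt (\<xi> / pi) * sqrt (h * w)) * of_real (sqrt (\<xi> / pi) * sqrt (h * w))) * (avg i \<xi> * cnj (avg j \<xi>))"
    unfolding mode_eq_avg by (simp only: complex_cnj_mult complex_cnj_complex_of_real mult_ac)
  ultimately show ?thesis by (simp only: of_real_mult mult.assoc)
qed

lemma integrable_mode_product: "integrable half_line (\<lambda>\<xi>. mode i \<xi> * cnj (mode j \<xi>))"
  by (rule Bochner_Integration.integrable_cong[THEN iffD2, OF refl _ integrable_mult_right[OF integrable_avg_product(1)[of i j], of "of_real (h * w)"]])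
    (simp add: space_restrict_space mode_product)

text \<open>The mean of \<open>K_H\<close> over the product of cells \<open>i\<close> and
  \<open>j\<close>: an entry of the Gram matrix freed from the area factor
  \<open>h * w\<close>.\<close>

definition cell_kernel :: "nat \<Rightarrow> nat \<Rightarrow> complex" where
  "cell_kernel i j = (LINT \<xi>|half_line. of_real (\<xi> / pi) * (avg i \<xi> * cnj (avg j \<xi>)))"

lemma gram_eq_cell_kernel: "gram i j = of_real (h * w) * cell_kernel i j"
proof -
  have "gram i j = (LINT \<xi>|half_line. of_real (h * w) * (of_real (\<xi> / pi) * (avg i \<xi> * cnj (avg j \<xi>))))"
    unfolding gram_def by (rule Bochner_Integration.integral_cong) (auto simp: space_restrict_space mode_product)
  then show ?thesis unfolding cell_kernel_def by (simp only: integral_mult_right_zero)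
qed

lemma norm_cell_kernel_le: "cmod (cell_kernel i j) \<le> 1"
  unfolding cell_kernel_def by (rule integrable_avg_product)

lemma cell_kernel_close:
  assumes z: "in_cell i z" "in_cell j z'"
  shows "cmod (K_H z z' - cell_kernel i j) \<le> h + w"
proof -
  have Im: "1 \<le> Im z" "1 \<le> Im z'" using z w unfolding in_cell_def by (smt (verit) mult_nonneg_nonneg of_nat_0_le_iff)+
  then have Im0: "0 < Im z" "0 < Im z'" by auto
  note K = K_H_eq_integral[OF Im0]
  note A = integrable_avg_product(1)[of i j]
  \<comment> \<open>Exchanging one wave at a time contributes \<open>3 / 2\<close> twice; the
    exponential comes from the fact that all heights are at least 1.\<close>
  let ?B = "\<lambda>\<xi>. 3 * (h + w) / pi * (\<xi>\<^sup>2 * exp (- 2 * \<xi>))"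
  have b: "integrable half_line ?B"
    by (rule integrable_mult_right) (rule integral_power_exp, simp)
  have le: "cmod (of_real (\<xi> / pi) * (wave z \<xi> * cnj (wave z' \<xi>)) - of_real (\<xi> / pi) * (avg i \<xi> * cnj (avg j \<xi>))) \<le> ?B \<xi>"
    if "\<xi> \<in> space half_line" for \<xi>
  proof -
    have xi: "\<xi> > 0" using that by (simp add: space_restrict_space)
    have "wave z \<xi> * cnj (wave z' \<xi>) - avg i \<xi> * cnj (avg j \<xi>) = (wave z \<xi> - avg i \<xi>) * cnj (wave z' \<xi>) + avg i \<xi> * cnj (wave z' \<xi> - avg j \<xi>)"
      by (simp add: algebra_simps)
    also have "cmod \<dots> \<le> cmod (avg i \<xi> - wave z \<xi>) * cmod (wave z' \<xi>) + cmod (avg i \<xi>) * cmod (avg j \<xi> - wave z' \<xi>)"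
      by (rule order_trans[OF norm_triangle_ineq]) (simp only: norm_mult complex_mod_cnj norm_minus_commute order_refl)
    also have "\<dots> \<le> (exp (- \<xi>) * (3 / 2 * \<xi> * (h + w))) * exp (- \<xi>) + exp (- \<xi>) * (exp (- \<xi>) * (3 / 2 * \<xi> * (h + w)))"
      using avg_close_wave[OF xi z(1)] avg_close_wave[OF xi z(2)] norm_wave_le[OF xi Im(2)] norm_avg_le[OF xi, of i] xi h w
      by (intro add_mono mult_mono) auto
    also have "\<dots> = 3 * \<xi> * (h + w) * (exp (- \<xi>) * exp (- \<xi>))" by (simp add: algebra_simps)
    also have "exp (- \<xi>) * exp (- \<xi>) = exp (- 2 * \<xi>)" by (simp add: exp_add[symmetric])
    finally have "\<xi> / pi * cmod (wave z \<xi> * cnj (wave z' \<xi>) - avg i \<xi> * cnj (avg j \<xi>)) \<le> \<xi> / pi * (3 * \<xi> * (h + w) * exp (- 2 * \<xi>))"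
      using xi by (intro mult_left_mono) auto
    also have "\<dots> = ?B \<xi>" by (simp add: power2_eq_square)
    finally show ?thesis using xi by (simp add: right_diff_distrib[symmetric] norm_mult del: of_real_divide)
  qed
  let ?D = "\<lambda>\<xi>. of_real (\<xi> / pi) * (wave z \<xi> * cnj (wave z' \<xi>)) - of_real (\<xi> / pi) * (avg i \<xi> * cnj (avg j \<xi>))"
  have D: "K_H z z' - cell_kernel i j = (LINT \<xi>|half_line. of_real (\<xi> / pi) * (wave z \<xi> * cnj (wave z' \<xi>)) - of_real (\<xi> / pi) * (avg i \<xi> * cnj (avg j \<xi>)))"
    unfolding K(2) cell_kernel_def by (rule Bochner_Integration.integral_diff[symmetric, OF K(1) A])
  have "cmod (LINT \<xi>|half_line. ?D \<xi>) \<le> (LINT \<xi>|half_line. cmod (?D \<xi>))" by (rule integral_norm_bound)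
  also have "\<dots> \<le> (LINT \<xi>|half_line. ?B \<xi>)"
    by (rule integral_mono[OF integrable_norm[OF Bochner_Integration.integrable_diff[OF K(1) A]] b le])
  also have "\<dots> = 3 * (h + w) / pi * (2 / 2 ^ 3)" by (subst integral_mult_right_zero) (subst integral_power_exp(6), simp_all)
  also have "\<dots> \<le> h + w"
  proof -
    have "(h + w) * (3 / (4 * pi)) \<le> (h + w) * 1" using pi_gt3 h w by (intro mult_left_mono) auto
    then show ?thesis by (simp add: mult_ac)
  qed
  finally show ?thesis unfolding D .
qed

lemma gram_herm: "gram j i = cnj (gram i j)"
proof -
  have "gram j i = (LINT \<xi>|half_line. cnj (mode i \<xi> * cnj (mode j \<xi>)))"
    unfolding gram_def by (simp add: mult.commute)
  then show ?thesis unfolding gram_def by (simp only: Bochner_Integration.integral_cnj)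
qed

text \<open>Moving both cells by one column multiplies the two modes by the same unimodular factor
  \<open>cis (\<xi> * h)\<close>, which cancels against its conjugate.\<close>

lemma gram_toeplitz: "gram (i + r) (j + r) = gram i j"
proof -
  have m: "mode (i + r) \<xi> = cis (\<xi> * h) * mode i \<xi>" for i \<xi>
  proof -
    have "(i + r) div r = Suc (i div r)" "(i + r) mod r = i mod r" using r by auto
    moreover have "cis (\<xi> * real (Suc (i div r)) * h) = cis (\<xi> * h) * cis (\<xi> * real (i div r) * h)"
      by (simp add: cis_mult algebra_simps)
    ultimately show ?thesis by (simp add: mode_def xmode_def)
  qed
  have "cis t * x * cnj (cis t * y) = x * cnj y" for t x y
  proof -
    have "cis t * cis (- t) = 1" by (simp add: cis_mult)
    then have "x * cnj y * (cis t * cis (- t)) = x * cnj y" by simp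
    then show ?thesis by (simp add: cis_cnj mult_ac)
  qed
  then have "(\<lambda>\<xi>. cis (\<xi> * h) * mode i \<xi> * cnj (cis (\<xi> * h) * mode j \<xi>)) = (\<lambda>\<xi>. mode i \<xi> * cnj (mode j \<xi>))"
    by (intro ext)
  then show ?thesis unfolding gram_def m by (rule arg_cong)
qed

lemma gram_form:
  "integrable half_line (\<lambda>\<xi>. (cmod (\<Sum>i<n. cnj (v i) * mode i \<xi>))\<^sup>2)"
  "(\<Sum>i<n. cnj (v i) * (\<Sum>j<n. gram i j * v j)) = of_real (LINT \<xi>|half_line. (cmod (\<Sum>i<n. cnj (v i) * mode i \<xi>))\<^sup>2)"
proof -
  have e: "complex_of_real ((cmod (\<Sum>i<n. cnj (v i) * mode i \<xi>))\<^sup>2) = (\<Sum>i<n. \<Sum>j<n. (cnj (v i) * v j) * (mode i \<xi> * cnj (mode j \<xi>)))" for \<xi>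
    unfolding complex_norm_square cnj_sum sum_product by (simp only: complex_cnj_mult complex_cnj_cnj mult_ac)
  have int: "integrable half_line (\<lambda>\<xi>. \<Sum>i<n. \<Sum>j<n. (cnj (v i) * v j) * (mode i \<xi> * cnj (mode j \<xi>)))"
    by (intro Bochner_Integration.integrable_sum integrable_mult_right integrable_mode_product)
  then have "integrable half_line (\<lambda>\<xi>. complex_of_real ((cmod (\<Sum>i<n. cnj (v i) * mode i \<xi>))\<^sup>2))"
    by (simp only: e)
  then show *: "integrable half_line (\<lambda>\<xi>. (cmod (\<Sum>i<n. cnj (v i) * mode i \<xi>))\<^sup>2)"
    by (rule complex_of_real_integrable_eq[THEN iffD1])
  have "complex_of_real (LINT \<xi>|half_line. (cmod (\<Sum>i<n. cnj (v i) * mode i \<xi>))\<^sup>2)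
    = (LINT \<xi>|half_line. complex_of_real ((cmod (\<Sum>i<n. cnj (v i) * mode i \<xi>))\<^sup>2))"
    by (rule integral_of_real[OF *, symmetric])
  also have "\<dots> = (\<Sum>i<n. \<Sum>j<n. (cnj (v i) * v j) * gram i j)"
    unfolding e gram_def
    by (simp only: Bochner_Integration.integral_sum Bochner_Integration.integrable_sum integrable_mult_right integrable_mode_product integral_mult_right_zero)
  also have "\<dots> = (\<Sum>i<n. cnj (v i) * (\<Sum>j<n. gram i j * v j))"
    unfolding sum_distrib_left by (simp only: mult_ac)
  finally show "(\<Sum>i<n. cnj (v i) * (\<Sum>j<n. gram i j * v j)) = of_real (LINT \<xi>|half_line. (cmod (\<Sum>i<n. cnj (v i) * mode i \<xi>))\<^sup>2)" ..
qed

end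

subsection \<open>Eigenvalues of the Gram matrix\<close>

text \<open>Both identities follow from the expansion of \<open>H\<close> into rank-one projections
  onto the \<open>u p\<close> with weights \<open>l p\<close>.\<close>

lemma spectral_trace_and_frobenius:
  fixes H :: "nat \<Rightarrow> nat \<Rightarrow> complex" and l :: "nat \<Rightarrow> real"
  assumes herm: "\<And>i j. i < n \<Longrightarrow> j < n \<Longrightarrow> H j i = cnj (H i j)"
    and c: "\<And>i j. i < n \<Longrightarrow> j < n \<Longrightarrow> (\<Sum>p<n. u p i * cnj (u p j)) = (if i = j then 1 else 0)"
    and o: "\<And>p. p < n \<Longrightarrow> (\<Sum>i<n. u p i * cnj (u p i)) = 1"
    and e: "\<And>p i. p < n \<Longrightarrow> i < n \<Longrightarrow> (\<Sum>j<n. H i j * u p j) = of_real (l p) * u p i"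
  shows "(\<Sum>i<n. H i i) = of_real (\<Sum>p<n. l p)"
    and "(\<Sum>i<n. \<Sum>j<n. (cmod (H i j))\<^sup>2) = (\<Sum>p<n. (l p)\<^sup>2)"
proof -
  have H: "H i j = (\<Sum>p<n. of_real (l p) * u p i * cnj (u p j))" if i: "i < n" and j: "j < n" for i j
  proof -
    have "(\<Sum>p<n. of_real (l p) * u p i * cnj (u p j)) = (\<Sum>p<n. (\<Sum>k<n. H i k * u p k) * cnj (u p j))"
      by (intro sum.cong refl) (use i e in simp)
    also have "\<dots> = (\<Sum>k<n. \<Sum>p<n. H i k * (u p k * cnj (u p j)))"
      unfolding sum_distrib_right by (subst sum.swap) (simp only: mult.assoc)
    also have "\<dots> = (\<Sum>k<n. if k = j then H i k else 0)"
      unfolding sum_distrib_left[symmetric] by (intro sum.cong refl) (use c j in simp)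
    finally show ?thesis using j by simp
  qed
  have "(\<Sum>i<n. H i i) = (\<Sum>i<n. \<Sum>p<n. of_real (l p) * (u p i * cnj (u p i)))"
    by (intro sum.cong refl) (simp add: H mult.assoc)
  also have "\<dots> = (\<Sum>p<n. of_real (l p) * (\<Sum>i<n. u p i * cnj (u p i)))"
    by (subst sum.swap) (simp only: sum_distrib_left)
  also have "\<dots> = (\<Sum>p<n. of_real (l p))" by (intro sum.cong refl) (simp add: o)
  finally show "(\<Sum>i<n. H i i) = of_real (\<Sum>p<n. l p)" by simp
  have "complex_of_real (\<Sum>i<n. \<Sum>j<n. (cmod (H i j))\<^sup>2) = (\<Sum>i<n. \<Sum>j<n. H i j * cnj (H i j))"
    by (simp only: of_real_sum complex_norm_square)
  also have "\<dots> = (\<Sum>i<n. \<Sum>j<n. H i j * (\<Sum>p<n. of_real (l p) * u p j * cnj (u p i)))"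
  proof (rule sum.cong[OF refl], rule sum.cong[OF refl])
    fix i j assume "i \<in> {..<n}" "j \<in> {..<n}"
    then have "cnj (H i j) = (\<Sum>p<n. of_real (l p) * u p j * cnj (u p i))" using herm[of i j] H[of j i] by simp
    then show "H i j * cnj (H i j) = H i j * (\<Sum>p<n. of_real (l p) * u p j * cnj (u p i))" by (rule arg_cong)
  qed
  also have "\<dots> = (\<Sum>i<n. \<Sum>p<n. \<Sum>j<n. of_real (l p) * cnj (u p i) * (H i j * u p j))"
    unfolding sum_distrib_left by (rule sum.cong[OF refl], subst sum.swap) (simp only: mult_ac)
  also have "\<dots> = (\<Sum>i<n. \<Sum>p<n. of_real ((l p)\<^sup>2) * (u p i * cnj (u p i)))"
    unfolding sum_distrib_left[symmetric]
    by (rule sum.cong[OF refl], rule sum.cong[OF refl]) (simp add: e power2_eq_square)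
  also have "\<dots> = (\<Sum>p<n. of_real ((l p)\<^sup>2) * (\<Sum>i<n. u p i * cnj (u p i)))"
    by (subst sum.swap) (simp only: sum_distrib_left)
  also have "\<dots> = (\<Sum>p<n. of_real ((l p)\<^sup>2))" by (intro sum.cong refl) (simp add: o)
  also have "\<dots> = complex_of_real (\<Sum>p<n. (l p)\<^sup>2)" by simp
  finally show "(\<Sum>i<n. \<Sum>j<n. (cmod (H i j))\<^sup>2) = (\<Sum>p<n. (l p)\<^sup>2)" by (simp only: of_real_eq_iff)
qed

lemma parseval_orthonormal:
  fixes u :: "nat \<Rightarrow> nat \<Rightarrow> complex"
  assumes c: "\<And>i j. i < n \<Longrightarrow> j < n \<Longrightarrow> (\<Sum>p<n. u p i * cnj (u p j)) = (if i = j then 1 else 0)"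
  shows "(\<Sum>p<n. (cmod (\<Sum>i<n. cnj (u p i) * x i))\<^sup>2) = (\<Sum>i<n. (cmod (x i))\<^sup>2)"
proof -
  have "complex_of_real (\<Sum>p<n. (cmod (\<Sum>i<n. cnj (u p i) * x i))\<^sup>2)
    = (\<Sum>p<n. \<Sum>i<n. \<Sum>j<n. x i * cnj (x j) * (u p j * cnj (u p i)))"
    unfolding of_real_sum complex_norm_square cnj_sum sum_product
    by (simp only: complex_cnj_mult complex_cnj_cnj mult_ac)
  also have "\<dots> = (\<Sum>i<n. \<Sum>j<n. x i * cnj (x j) * (\<Sum>p<n. u p j * cnj (u p i)))"
    unfolding sum_distrib_left by (subst sum.swap, rule sum.cong[OF refl], subst sum.swap) (rule refl)
  also have "\<dots> = (\<Sum>i<n. \<Sum>j<n. if j = i then x i * cnj (x j) else 0)"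
    by (rule sum.cong[OF refl], rule sum.cong[OF refl]) (simp add: c)
  also have "\<dots> = complex_of_real (\<Sum>i<n. (cmod (x i))\<^sup>2)"
    by (simp only: of_real_sum complex_norm_square) simp
  finally show ?thesis by (simp only: of_real_eq_iff)
qed

text \<open>Averaging the second order Taylor expansion of \<open>f\<close> around the mean of a subprobability
  density, the missing mass sitting at \<open>0\<close>.\<close>

lemma taylor_mean_bound:
  fixes f f1 :: "real \<Rightarrow> complex" and lam q :: "real \<Rightarrow> real"
  assumes f: "f 0 = 0" "f \<in> borel_measurable borel"
    and taylor: "\<And>x y. 0 \<le> x \<Longrightarrow> x \<le> 1 \<Longrightarrow> 0 \<le> y \<Longrightarrow> y \<le> 1 \<Longrightarrow> cmod (f x - f y - f1 y * of_real (x - y)) \<le> B * (x - y)\<^sup>2"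
    and lam [measurable]: "lam \<in> borel_measurable M" "\<And>t. t \<in> space M \<Longrightarrow> 0 \<le> lam t \<and> lam t \<le> 1"
    and q: "integrable M q" "\<And>t. t \<in> space M \<Longrightarrow> 0 \<le> q t"
    and mass: "(LINT t|M. q t) \<le> 1" and mean: "(LINT t|M. lam t * q t) = l"
  shows "integrable M (\<lambda>t. f (lam t) * of_real (q t))"
    and "cmod (f l - (LINT t|M. f (lam t) * of_real (q t))) \<le> B * ((LINT t|M. (lam t)\<^sup>2 * q t) - l\<^sup>2)"
    and "0 \<le> l" "l \<le> 1"
proof -
  have [measurable]: "q \<in> borel_measurable M" using q(1) by (rule borel_measurable_integrable)
  have [measurable]: "(\<lambda>t. f (lam t)) \<in> borel_measurable M" using lam(1) f(2) by (rule measurable_compose)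
  have B0: "0 \<le> B" using order_trans[OF norm_ge_zero taylor[of 1 0]] by simp
  have i1: "integrable M (\<lambda>t. lam t * q t)"
    by (rule Bochner_Integration.integrable_bound[OF q(1)])
      (use lam q in \<open>auto intro!: AE_I2 simp: abs_mult mult_left_le_one_le\<close>)
  have i2: "integrable M (\<lambda>t. (lam t)\<^sup>2 * q t)"
    by (rule Bochner_Integration.integrable_bound[OF q(1)])
      (use lam q in \<open>auto intro!: AE_I2 simp: abs_mult mult_left_le_one_le power_le_one\<close>)
  show l0: "0 \<le> l" unfolding mean[symmetric] using lam q by (intro Bochner_Integration.integral_nonneg) auto
  have "l \<le> (LINT t|M. q t)" unfolding mean[symmetric]
    using lam q by (intro integral_mono i1 q) (auto simp: mult_left_le_one_le)
  then show l1: "l \<le> 1" using mass by simp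
  have fb: "cmod (f x) \<le> cmod (f1 0) + B" if "0 \<le> x" "x \<le> 1" for x
  proof -
    have "cmod (f x) \<le> cmod (f x - f 0 - f1 0 * of_real (x - 0)) + cmod (f1 0 * of_real x)"
      using norm_triangle_ineq[of "f x - f 0 - f1 0 * of_real (x - 0)" "f1 0 * of_real x"] f(1) by simp
    also have "\<dots> \<le> B * 1 + cmod (f1 0) * 1"
      using taylor[of x 0] that B0 by (intro add_mono) (auto simp: norm_mult power_le_one intro: order_trans[OF _ mult_left_le] mult_left_le)
    finally show ?thesis by simp
  qed
  show i3: "integrable M (\<lambda>t. f (lam t) * of_real (q t))"
  proof (rule Bochner_Integration.integrable_bound[OF integrable_mult_right[OF q(1), of "cmod (f1 0) + B"]])
    show "AE t in M. cmod (f (lam t) * of_real (q t)) \<le> norm ((cmod (f1 0) + B) * q t)"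
      using fb lam q B0 by (intro AE_I2) (auto simp: norm_mult abs_mult intro!: mult_right_mono)
  qed measurable
  \<comment> \<open>The missing mass, placed at the point 0, where \<open>f\<close>
    vanishes.\<close>
  define \<beta> where "\<beta> = 1 - (LINT t|M. q t)"
  have \<beta>: "0 \<le> \<beta>" using mass by (simp add: \<beta>_def)
  define D where "D = (\<lambda>x. f x - f l - f1 l * of_real (x - l))"
  have Db: "cmod (D x) \<le> B * (x - l)\<^sup>2" if "0 \<le> x" "x \<le> 1" for x
    unfolding D_def using taylor[of x l] that l0 l1 by simp
  have De: "D (lam t) * of_real (q t) = f (lam t) * of_real (q t) - (f l - f1 l * of_real l) * of_real (q t) - f1 l * of_real (lam t * q t)" for t
    by (simp add: D_def algebra_simps)
  have ir: "integrable M (\<lambda>t. complex_of_real (q t))" "integrable M (\<lambda>t. complex_of_real (lam t * q t))"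
    using q(1) i1 by (simp_all only: complex_of_real_integrable_eq)
  have iD: "integrable M (\<lambda>t. D (lam t) * of_real (q t))"
    unfolding De by (intro Bochner_Integration.integrable_diff i3 integrable_mult_right ir)
  have "(LINT t|M. D (lam t) * of_real (q t)) = (LINT t|M. f (lam t) * of_real (q t)) - (f l - f1 l * of_real l) * of_real (1 - \<beta>) - f1 l * of_real l"
    unfolding De using mean
    by (simp add: Bochner_Integration.integral_diff i3 integrable_mult_right ir \<beta>_def del: of_real_mult of_real_diff)
  \<comment> \<open>Once the missing mass is included, the total mass is 1 and the mean is
    \<open>l\<close>, so the linear term of the Taylor expansion integrates to 0.\<close>
  then have id: "f l - (LINT t|M. f (lam t) * of_real (q t)) = - (LINT t|M. D (lam t) * of_real (q t)) - of_real \<beta> * D 0"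
    using f(1) by (simp add: D_def algebra_simps)
  have sq: "(lam t - l)\<^sup>2 * q t = (lam t)\<^sup>2 * q t - 2 * l * (lam t * q t) + l\<^sup>2 * q t" for t
    by (simp add: power2_eq_square algebra_simps)
  have b2: "integrable M (\<lambda>t. B * ((lam t - l)\<^sup>2 * q t))"
    unfolding sq by (intro integrable_mult_right Bochner_Integration.integrable_add Bochner_Integration.integrable_diff i1 i2 q(1))
  have "cmod (LINT t|M. D (lam t) * of_real (q t)) \<le> (LINT t|M. cmod (D (lam t) * of_real (q t)))" by (rule integral_norm_bound)
  also have "\<dots> \<le> (LINT t|M. B * ((lam t - l)\<^sup>2 * q t))"
  proof (rule integral_mono[OF integrable_norm[OF iD] b2])
    fix t assume t: "t \<in> space M"
    then have "cmod (D (lam t)) * q t \<le> B * (lam t - l)\<^sup>2 * q t"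
      using lam(2)[OF t] q(2)[OF t] by (intro mult_right_mono Db) auto
    then show "cmod (D (lam t) * of_real (q t)) \<le> B * ((lam t - l)\<^sup>2 * q t)"
      using q(2)[OF t] by (simp add: norm_mult mult.assoc)
  qed
  also have "\<dots> = B * ((LINT t|M. (lam t)\<^sup>2 * q t) - 2 * l * l + l\<^sup>2 * (1 - \<beta>))"
    unfolding sq using mean i1 i2 q(1) by (simp add: \<beta>_def)
  finally have 1: "cmod (LINT t|M. D (lam t) * of_real (q t)) \<le> B * ((LINT t|M. (lam t)\<^sup>2 * q t) - 2 * l * l + l\<^sup>2 * (1 - \<beta>))" .
  have 2: "cmod (of_real \<beta> * D 0) \<le> \<beta> * (B * l\<^sup>2)"
    using mult_left_mono[OF Db[of 0] \<beta>] \<beta> by (simp add: norm_mult)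
  have "cmod (f l - (LINT t|M. f (lam t) * of_real (q t))) \<le> cmod (LINT t|M. D (lam t) * of_real (q t)) + cmod (of_real \<beta> * D 0)"
    unfolding id by (rule order_trans[OF norm_triangle_ineq4]) simp
  also have "\<dots> \<le> B * ((LINT t|M. (lam t)\<^sup>2 * q t) - 2 * l * l + l\<^sup>2 * (1 - \<beta>)) + \<beta> * (B * l\<^sup>2)"
    using 1 2 by (rule add_mono)
  \<comment> \<open>The parts with weights \<open>1 - \<beta>\<close> and \<open>\<beta>\<close>
    recombine, and the factor of \<open>B\<close> becomes the variance of the completed
    distribution.\<close>
  also have "\<dots> = B * ((LINT t|M. (lam t)\<^sup>2 * q t) - l\<^sup>2)" by (simp add: power2_eq_square algebra_simps)
  finally show "cmod (f l - (LINT t|M. f (lam t) * of_real (q t))) \<le> B * ((LINT t|M. (lam t)\<^sup>2 * q t) - l\<^sup>2)" .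
qed

text \<open>\<open>f1\<close> stands for the derivative, but it enters only through the remainder
  estimate. The condition \<open>f 0 = 0\<close> is what allows missing mass to sit at 0.\<close>

definition quadratic_taylor :: "real \<Rightarrow> (real \<Rightarrow> complex) \<Rightarrow> (real \<Rightarrow> complex) \<Rightarrow> bool" where
  "quadratic_taylor B f f1 \<longleftrightarrow> f 0 = 0 \<and> f \<in> borel_measurable borel \<and>
    (\<forall>x\<in>{0..1}. \<forall>y\<in>{0..1}. cmod (f x - f y - f1 y * of_real (x - y)) \<le> B * (x - y)\<^sup>2)"

context mesh
begin

text \<open>Here the densities \<open>q p\<close> are built. Their mass is at most 1 by
  \<open>mode_bessel\<close>, the mean of the symbol is the eigenvalue by \<open>gram_form\<close>,
  and Parseval's identity adds them up to \<open>mode_density n\<close>. One list of eigenvalues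
  serves all \<open>f\<close>, since later \<open>f\<close> varies with
  \<open>\<theta>\<close>.\<close>

lemma gram_spectrum:
  obtains l :: "nat \<Rightarrow> real" where
    "\<And>p. p < n * r \<Longrightarrow> 0 \<le> l p \<and> l p \<le> 1"
    "\<And>z. Determinant.det (Matrix.mat (n * r) (n * r) (\<lambda>(i, j). (if i = j then 1 else 0) + z * gram i j))
       = (\<Prod>p<n * r. 1 + z * of_real (l p))"
    "(\<Sum>p<n * r. l p) = (LINT \<xi>|half_line. strip_symbol a \<xi> * mode_density n \<xi>)"
    "\<And>f f1 B. quadratic_taylor B f f1 \<Longrightarrow>
      cmod ((\<Sum>p<n * r. f (l p)) - (LINT \<xi>|half_line. f (strip_symbol a \<xi>) * of_real (mode_density n \<xi>)))
      \<le> B * ((LINT \<xi>|half_line. (strip_symbol a \<xi>)\<^sup>2 * mode_density n \<xi>) - (\<Sum>i<n * r. \<Sum>j<n * r. (cmod (gram i j))\<^sup>2))"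
proof -
  define m where "m = n * r"
  obtain u l where
    o: "\<And>p q. p < m \<Longrightarrow> q < m \<Longrightarrow> (\<Sum>i<m. u p i * cnj (u q i)) = (if p = q then 1 else 0)" and
    c: "\<And>i j. i < m \<Longrightarrow> j < m \<Longrightarrow> (\<Sum>p<m. u p i * cnj (u p j)) = (if i = j then 1 else 0)" and
    e: "\<And>p i. p < m \<Longrightarrow> i < m \<Longrightarrow> (\<Sum>j<m. gram i j * u p j) = of_real (l p :: real) * u p i" and
    d: "\<And>z. Determinant.det (Matrix.mat m m (\<lambda>(i, j). (if i = j then 1 else 0) + z * gram i j))
       = (\<Prod>p<m. 1 + z * of_real (l p))"
    using hermitian_spectral[of m gram, OF gram_herm] by blast
  let ?s = "strip_symbol a"
  define q where "q = (\<lambda>p \<xi>. (cmod (\<Sum>i<m. cnj (u p i) * mode i \<xi>))\<^sup>2 / ?s \<xi>)"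
  have s01: "0 \<le> ?s t \<and> ?s t \<le> 1" "?s t > 0" if "t \<in> space half_line" for t
    using that strip_symbol_pos[OF a, of t] strip_symbol_less_1[of t a] by (auto simp: space_restrict_space)
  have ms: "?s \<in> borel_measurable half_line"
    unfolding strip_symbol_def[abs_def] by (rule measurable_half_line) measurable
  have qi: "integrable half_line (q p)" for p
    unfolding q_def m_def by (rule mode_bessel)
  have q0: "0 \<le> q p t" if "t \<in> space half_line" for p t
    using s01(2)[OF that] by (simp add: q_def)
  have mass: "(LINT t|half_line. q p t) \<le> 1" if p: "p < m" for p
  proof -
    have "(LINT t|half_line. q p t) \<le> (\<Sum>i<m. (cmod (cnj (u p i)))\<^sup>2)"
      unfolding q_def m_def by (rule mode_bessel)
    also have "\<dots> = 1"
    proof -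
      have "complex_of_real (\<Sum>i<m. (cmod (cnj (u p i)))\<^sup>2) = (\<Sum>i<m. u p i * cnj (u p i))"
        by (simp only: of_real_sum complex_mod_cnj complex_norm_square)
      then have "complex_of_real (\<Sum>i<m. (cmod (cnj (u p i)))\<^sup>2) = 1" using o[OF p p] by simp
      then show ?thesis by (simp only: of_real_eq_1_iff)
    qed
    finally show ?thesis .
  qed
  have mean: "(LINT t|half_line. ?s t * q p t) = l p" if p: "p < m" for p
  proof -
    have "complex_of_real (LINT t|half_line. (cmod (\<Sum>i<m. cnj (u p i) * mode i t))\<^sup>2) = (\<Sum>i<m. cnj (u p i) * (\<Sum>j<m. gram i j * u p j))"
      by (rule gram_form(2)[symmetric])
    also have "\<dots> = of_real (l p) * (\<Sum>i<m. u p i * cnj (u p i))"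
      unfolding sum_distrib_left[of _ "\<lambda>i. u p i * cnj (u p i)"] by (intro sum.cong refl) (use p in \<open>simp add: e\<close>)
    also have "\<dots> = of_real (l p)" using o[OF p p] by simp
    finally have "(LINT t|half_line. (cmod (\<Sum>i<m. cnj (u p i) * mode i t))\<^sup>2) = l p" by (simp only: of_real_eq_iff)
    moreover have "(LINT t|half_line. ?s t * q p t) = (LINT t|half_line. (cmod (\<Sum>i<m. cnj (u p i) * mode i t))\<^sup>2)"
      by (rule Bochner_Integration.integral_cong[OF refl]) (use s01(2) in \<open>force simp: q_def\<close>)
    ultimately show ?thesis by simp
  qed
  have qsum: "(\<Sum>p<m. q p t) = mode_density n t" if t: "t \<in> space half_line" for t
  proof -
    have "(\<Sum>p<m. q p t) = (\<Sum>i<m. (cmod (mode i t))\<^sup>2) / ?s t"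
      unfolding q_def sum_divide_distrib[symmetric] by (subst parseval_orthonormal[OF c]) auto
    also have "\<dots> = mode_density n t"
      unfolding m_def using t s01(2)[OF t] by (subst sum_norm_mode_square) (auto simp: space_restrict_space)
    finally show ?thesis .
  qed
  have norms: "(\<Sum>i<m. \<Sum>j<m. (cmod (gram i j))\<^sup>2) = (\<Sum>p<m. (l p)\<^sup>2)"
    by (rule spectral_trace_and_frobenius[OF gram_herm c _ e]) (use o in auto)
  \<comment> \<open>The identity function has remainder 0 and serves to read off
    \<open>0 \<le> l p\<close> and \<open>l p \<le> 1\<close> from the same lemma.\<close>
  have trivial: "quadratic_taylor 0 (\<lambda>x. of_real x) (\<lambda>_. 1)" by (simp add: quadratic_taylor_def)
  have tm: "integrable half_line (\<lambda>t. f (?s t) * of_real (q p t))"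
     "cmod (f (l p) - (LINT t|half_line. f (?s t) * of_real (q p t))) \<le> B * ((LINT t|half_line. (?s t)\<^sup>2 * q p t) - (l p)\<^sup>2)"
     "0 \<le> l p" "l p \<le> 1"
    if f: "quadratic_taylor B f f1" and p: "p < m" for f f1 B p
  proof -
    have f': "f 0 = 0" "f \<in> borel_measurable borel"
      "\<And>x y. 0 \<le> x \<Longrightarrow> x \<le> 1 \<Longrightarrow> 0 \<le> y \<Longrightarrow> y \<le> 1 \<Longrightarrow> cmod (f x - f y - f1 y * of_real (x - y)) \<le> B * (x - y)\<^sup>2"
      using f by (auto simp: quadratic_taylor_def)
    note T = taylor_mean_bound[OF f' ms s01(1) qi q0 mass[OF p] mean[OF p]]
    show "integrable half_line (\<lambda>t. f (?s t) * of_real (q p t))" by (rule T)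
    show "cmod (f (l p) - (LINT t|half_line. f (?s t) * of_real (q p t))) \<le> B * ((LINT t|half_line. (?s t)\<^sup>2 * q p t) - (l p)\<^sup>2)" by (rule T)
    show "0 \<le> l p" and "l p \<le> 1" using T(3,4) by auto
  qed
  have is2: "integrable half_line (\<lambda>t. (?s t)\<^sup>2 * q p t)" for p
    by (rule Bochner_Integration.integrable_bound[OF qi[of p]])
      (use ms s01 q0 borel_measurable_integrable[OF qi[of p]] in \<open>auto intro!: AE_I2 simp: abs_mult mult_left_le_one_le power_le_one\<close>)
  have s2: "(\<Sum>p<m. LINT t|half_line. (?s t)\<^sup>2 * q p t) = (LINT t|half_line. (?s t)\<^sup>2 * mode_density n t)"
  proof -
    have "(\<Sum>p<m. LINT t|half_line. (?s t)\<^sup>2 * q p t) = (LINT t|half_line. (\<Sum>p<m. (?s t)\<^sup>2 * q p t))"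
      by (rule Bochner_Integration.integral_sum[symmetric]) (rule is2)
    also have "\<dots> = (LINT t|half_line. (?s t)\<^sup>2 * mode_density n t)"
      by (rule Bochner_Integration.integral_cong[OF refl]) (simp add: sum_distrib_left[symmetric] qsum)
    finally show ?thesis .
  qed
  show ?thesis
  proof (rule that[of l, folded m_def])
    show "0 \<le> l p \<and> l p \<le> 1" if "p < m" for p using tm(3,4)[OF trivial that] by simp
    show "Determinant.det (Matrix.mat m m (\<lambda>(i, j). (if i = j then 1 else 0) + z * gram i j))
       = (\<Prod>p<m. 1 + z * of_real (l p))" for z by (rule d)
    show "(\<Sum>p<m. l p) = (LINT \<xi>|half_line. ?s \<xi> * mode_density n \<xi>)"
    proof -
      have "(\<Sum>p<m. l p) = (\<Sum>p<m. LINT t|half_line. ?s t * q p t)" by (intro sum.cong refl) (simp add: mean)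
      also have "\<dots> = (LINT t|half_line. (\<Sum>p<m. ?s t * q p t))"
      proof (rule Bochner_Integration.integral_sum[symmetric])
        fix p
        show "integrable half_line (\<lambda>t. ?s t * q p t)"
          by (rule Bochner_Integration.integrable_bound[OF qi[of p]])
            (use ms s01 q0 borel_measurable_integrable[OF qi[of p]] in \<open>auto intro!: AE_I2 simp: abs_mult mult_left_le_one_le\<close>)
      qed
      also have "\<dots> = (LINT \<xi>|half_line. ?s \<xi> * mode_density n \<xi>)"
        by (rule Bochner_Integration.integral_cong[OF refl]) (simp add: sum_distrib_left[symmetric] qsum)
      finally show ?thesis .
    qed
    show "cmod ((\<Sum>p<m. f (l p)) - (LINT \<xi>|half_line. f (?s \<xi>) * of_real (mode_density n \<xi>)))
      \<le> B * ((LINT \<xi>|half_line. (?s \<xi>)\<^sup>2 * mode_density n \<xi>) - (\<Sum>i<m. \<Sum>j<m. (cmod (gram i j))\<^sup>2))"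
      if f: "quadratic_taylor B f f1" for f f1 B
    proof -
      have "(LINT \<xi>|half_line. f (?s \<xi>) * of_real (mode_density n \<xi>)) = (LINT \<xi>|half_line. (\<Sum>p<m. f (?s \<xi>) * of_real (q p \<xi>)))"
        by (rule Bochner_Integration.integral_cong[OF refl]) (simp add: sum_distrib_left[symmetric] qsum[symmetric])
      also have "\<dots> = (\<Sum>p<m. LINT \<xi>|half_line. f (?s \<xi>) * of_real (q p \<xi>))"
        by (rule Bochner_Integration.integral_sum) (use tm(1)[OF f] in auto)
      finally have "(\<Sum>p<m. f (l p)) - (LINT \<xi>|half_line. f (?s \<xi>) * of_real (mode_density n \<xi>))
        = (\<Sum>p<m. f (l p) - (LINT \<xi>|half_line. f (?s \<xi>) * of_real (q p \<xi>)))"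
        by (simp only: sum_subtractf)
      also have "cmod \<dots> \<le> (\<Sum>p<m. B * ((LINT t|half_line. (?s t)\<^sup>2 * q p t) - (l p)\<^sup>2))"
        by (rule order_trans[OF norm_sum sum_mono]) (use tm(2)[OF f] in auto)
      also have "\<dots> = B * ((LINT \<xi>|half_line. (?s \<xi>)\<^sup>2 * mode_density n \<xi>) - (\<Sum>i<m. \<Sum>j<m. (cmod (gram i j))\<^sup>2))"
        unfolding norms s2[symmetric] by (simp only: sum_distrib_left[symmetric] sum_subtractf)
      finally show ?thesis .
    qed
  qed
qed

end

section \<open>The Frobenius norm against the integral of the squared symbol\<close>

lemma strip_symbol_moments:
  assumes a: "a > 1"
  shows "integrable half_line (strip_symbol a)" "(LINT \<xi>|half_line. strip_symbol a \<xi>) \<le> 1"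
    and "integrable half_line (\<lambda>\<xi>. (strip_symbol a \<xi>)\<^sup>2)"
    and "(LINT \<xi>|half_line. (strip_symbol a \<xi>)\<^sup>2) = 1 / 4 - 1 / (1 + a) + 1 / (4 * a)"
proof -
  have E: "has_bochner_integral half_line (\<lambda>x. exp (- c * x)) (1 / c)" if "c > 0" for c
    using integral_power_exp(1,2)[OF that] by (simp add: has_bochner_integral_iff)
  have "has_bochner_integral half_line (\<lambda>\<xi>. exp (- 2 * \<xi>) - exp (- (2 * a) * \<xi>)) (1 / 2 - 1 / (2 * a))"
    by (intro has_bochner_integral_diff E) (use a in auto)
  then have 1: "has_bochner_integral half_line (strip_symbol a) (1 / 2 - 1 / (2 * a))"
    by (simp add: strip_symbol_def[abs_def])
  then show "integrable half_line (strip_symbol a)" by (simp add: has_bochner_integral_iff)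
  have "(LINT \<xi>|half_line. strip_symbol a \<xi>) = 1 / 2 - 1 / (2 * a)" using 1 by (simp add: has_bochner_integral_iff)
  moreover have "0 \<le> 1 / (2 * a)" using a by simp
  ultimately show "(LINT \<xi>|half_line. strip_symbol a \<xi>) \<le> 1" by linarith
  have "has_bochner_integral half_line (\<lambda>\<xi>. exp (- 4 * \<xi>) - 2 * exp (- (2 + 2 * a) * \<xi>) + exp (- (4 * a) * \<xi>))
    (1 / 4 - 2 * (1 / (2 + 2 * a)) + 1 / (4 * a))"
    by (intro has_bochner_integral_diff has_bochner_integral_add has_bochner_integral_mult_right E) (use a in auto)
  moreover have "exp (- 4 * \<xi>) - 2 * exp (- (2 + 2 * a) * \<xi>) + exp (- (4 * a) * \<xi>) = (strip_symbol a \<xi>)\<^sup>2" for \<xi>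
    by (simp add: strip_symbol_def power2_eq_square algebra_simps exp_add[symmetric])
  moreover have "2 * (1 / (2 + 2 * a)) = 1 / (1 + a)" using a by (simp add: field_simps)
  ultimately have 2: "has_bochner_integral half_line (\<lambda>\<xi>. (strip_symbol a \<xi>)\<^sup>2) (1 / 4 - 1 / (1 + a) + 1 / (4 * a))"
    by simp
  then show "integrable half_line (\<lambda>\<xi>. (strip_symbol a \<xi>)\<^sup>2)"
    "(LINT \<xi>|half_line. (strip_symbol a \<xi>)\<^sup>2) = 1 / 4 - 1 / (1 + a) + 1 / (4 * a)"
    by (simp_all only: has_bochner_integral_iff)
qed

lemma norm_K_H_square:
  "(cmod (K_H z z'))\<^sup>2 = 1 / pi\<^sup>2 * quartic_kernel (Im z + Im z') (Re z - Re z')"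
proof -
  have "(cmod (z - cnj z'))\<^sup>2 = (Re z - Re z')\<^sup>2 + (Im z + Im z')\<^sup>2" by (simp add: cmod_power2)
  moreover have "cmod (K_H z z') = 1 / (pi * (cmod (z - cnj z'))\<^sup>2)"
    by (simp add: K_H_def norm_divide norm_mult norm_power)
  ultimately show ?thesis by (simp add: quartic_kernel_def power_divide power_mult_distrib)
qed

lemma norm_K_H_le_1:
  assumes "Im z \<ge> 1" "Im z' \<ge> 1"
  shows "cmod (K_H z z') \<le> 1"
proof -
  have "2 \<le> Im (z - cnj z')" using assms by simp
  then have "2 \<le> cmod (z - cnj z')" using abs_Im_le_cmod[of "z - cnj z'"] by linarith
  then have "2\<^sup>2 \<le> (cmod (z - cnj z'))\<^sup>2" by (intro power_mono) auto
  then have "1 * 1 \<le> pi * (cmod (z - cnj z'))\<^sup>2" using pi_gt3 by (intro mult_mono) auto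
  then show ?thesis by (simp add: K_H_def norm_divide norm_mult norm_power divide_le_eq)
qed

text \<open>Squaring preserves the inequality only where \<open>x - e\<close> is nonnegative; in the
  other case \<open>x\<^sup>2 - 2 * e\<close> is already at most 0.\<close>

lemma square_approx_ge:
  fixes x y e :: real
  assumes "0 \<le> x" "x \<le> 1" "x - e \<le> y" "0 \<le> y" "0 \<le> e"
  shows "x\<^sup>2 - 2 * e \<le> y\<^sup>2"
proof (cases "e \<le> x")
  case True
  have "x\<^sup>2 - 2 * e \<le> x\<^sup>2 - 2 * e * x" using assms by (simp add: mult_left_le)
  also have "\<dots> \<le> (x - e)\<^sup>2" by (simp add: power2_eq_square algebra_simps)
  also have "\<dots> \<le> y\<^sup>2" using True assms by (intro power_mono) auto
  finally show ?thesis .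
next
  case False
  have "x\<^sup>2 \<le> x * 1" unfolding power2_eq_square using assms by (intro mult_left_mono) auto
  then have "x\<^sup>2 - 2 * e \<le> 0" using False assms by simp
  then show ?thesis by (meson order_trans zero_le_power2)
qed

context mesh
begin

text \<open>The lower left vertex: sampling there turns sums over cells into left Riemann sums,
  which bound the integrals of decreasing functions from above.\<close>

definition corner :: "nat \<Rightarrow> complex" where
  "corner i = Complex (real (i div r) * h) (1 + real (i mod r) * w)"

lemma in_cell_corner: "in_cell i (corner i)"
  using h w by (simp add: in_cell_def corner_def algebra_simps)

lemma Im_corner: "1 \<le> Im (corner i)"
  using w by (simp add: corner_def)

text \<open>Cell means are replaced by corner values, at the cost of \<open>2 * (h + w)\<close>
  times the squared cell area for each pair; the horizontal and the vertical sums then have lower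
  bounds of their own. The leading coefficient is \<open>pi / 2\<close> divided by
  \<open>pi\<^sup>2\<close>, that is \<open>1 / (2 * pi)\<close> per unit length. In the boundary
  term the factor \<open>1 / pi\<^sup>2\<close> is bounded by 1.\<close>

lemma gram_frobenius_ge:
  "real n * h / (2 * pi) * (1 / 4 - 1 / (1 + a) + 1 / (4 * a))
    - (a - 1)\<^sup>2 * (2 * (h + 1) + real n * h * h / 16) - 2 * (h + w) * (real n * h * (a - 1))\<^sup>2
    \<le> (\<Sum>i<n * r. \<Sum>j<n * r. (cmod (gram i j))\<^sup>2)"
proof -
  have term_ge: "(h * w)\<^sup>2 * (cmod (K_H (corner i) (corner j)))\<^sup>2 - 2 * (h + w) * (h * w)\<^sup>2 \<le> (cmod (gram i j))\<^sup>2" for i j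
  proof -
    have "cmod (K_H (corner i) (corner j)) - (h + w) \<le> cmod (cell_kernel i j)"
      using cell_kernel_close[OF in_cell_corner in_cell_corner, of i j] norm_triangle_ineq2[of "K_H (corner i) (corner j)" "cell_kernel i j"]
      by linarith
    then have "(cmod (K_H (corner i) (corner j)))\<^sup>2 - 2 * (h + w) \<le> (cmod (cell_kernel i j))\<^sup>2"
      using norm_K_H_le_1[OF Im_corner Im_corner] h w by (intro square_approx_ge) auto
    then have "(h * w)\<^sup>2 * ((cmod (K_H (corner i) (corner j)))\<^sup>2 - 2 * (h + w)) \<le> (h * w)\<^sup>2 * (cmod (cell_kernel i j))\<^sup>2"
      by (intro mult_left_mono) auto
    moreover have "(cmod (gram i j))\<^sup>2 = (h * w)\<^sup>2 * (cmod (cell_kernel i j))\<^sup>2"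
      unfolding gram_eq_cell_kernel norm_mult norm_of_real by (simp add: power_mult_distrib)
    ultimately show ?thesis by (simp add: algebra_simps)
  qed
  let ?s = "\<lambda>l l'. (1 + real l * w) + (1 + real l' * w)"
  have "real n * h / (2 * pi) * (1 / 4 - 1 / (1 + a) + 1 / (4 * a)) - (a - 1)\<^sup>2 * (2 * (h + 1) + real n * h * h / 16)
    \<le> 1 / pi\<^sup>2 * (real n * h * pi / 2 * (1 / 4 - 1 / (1 + a) + 1 / (4 * a)) - (a - 1)\<^sup>2 * (2 * (h + 1) + real n * h * h / 16))"
  proof -
    have pi2: "1 / pi\<^sup>2 \<le> 1" using pi_gt3 one_le_power[of pi 2] by (simp add: divide_le_eq)
    have E: "0 \<le> (a - 1)\<^sup>2 * (2 * (h + 1) + real n * h * h / 16)" using h by auto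
    have "1 / pi\<^sup>2 * (real n * h * pi / 2 * c - X) = real n * h / (2 * pi) * c - 1 / pi\<^sup>2 * X" for c X
      by (simp add: power2_eq_square algebra_simps)
    then show ?thesis using mult_right_mono[OF pi2 E] by simp
  qed
  also have "\<dots> \<le> 1 / pi\<^sup>2 * (real n * h * pi / 2 * (\<Sum>l<r. \<Sum>l'<r. w\<^sup>2 * (1 / ?s l l' ^ 3))
      - (a - 1)\<^sup>2 * (2 * (h + 1) + real n * h * h / 16))"
    using cubic_double_sum_ge[OF a r w_def] h
    by (intro mult_left_mono diff_right_mono) auto
  also have "\<dots> = 1 / pi\<^sup>2 * (\<Sum>l<r. \<Sum>l'<r. w\<^sup>2 * (real n * h * pi / (2 * ?s l l' ^ 3) - 2 * (h + 1) - real n * h * h / 16))"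
  proof -
    have aw: "(a - 1)\<^sup>2 = (\<Sum>l<r. \<Sum>l'<r. w\<^sup>2)" by (simp add: rw[symmetric] power2_eq_square mult_ac)
    have "real n * h * pi / 2 * (\<Sum>l<r. \<Sum>l'<r. w\<^sup>2 * (1 / ?s l l' ^ 3)) - (a - 1)\<^sup>2 * (2 * (h + 1) + real n * h * h / 16)
      = (\<Sum>l<r. \<Sum>l'<r. real n * h * pi / 2 * (w\<^sup>2 * (1 / ?s l l' ^ 3)) - w\<^sup>2 * (2 * (h + 1) + real n * h * h / 16))"
      unfolding aw sum_distrib_left sum_distrib_right sum_subtractf ..
    also have "\<dots> = (\<Sum>l<r. \<Sum>l'<r. w\<^sup>2 * (real n * h * pi / (2 * ?s l l' ^ 3) - 2 * (h + 1) - real n * h * h / 16))"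
      by (rule sum.cong[OF refl], rule sum.cong[OF refl]) (simp add: algebra_simps)
    finally show ?thesis by (rule arg_cong)
  qed
  also have "\<dots> \<le> 1 / pi\<^sup>2 * (\<Sum>l<r. \<Sum>l'<r. w\<^sup>2 * (\<Sum>k<n. \<Sum>k'<n. h\<^sup>2 * quartic_kernel (?s l l') ((real k - real k') * h)))"
    using w by (intro mult_left_mono sum_mono quartic_double_sum_ge h) auto
  also have "\<dots> = (\<Sum>i<n * r. \<Sum>j<n * r. (h * w)\<^sup>2 * (cmod (K_H (corner i) (corner j)))\<^sup>2)"
  proof -
    have "(\<Sum>i<n * r. \<Sum>j<n * r. (h * w)\<^sup>2 * (cmod (K_H (corner i) (corner j)))\<^sup>2)
      = (\<Sum>l<r. \<Sum>k<n. \<Sum>l'<r. \<Sum>k'<n. (h * w)\<^sup>2 * (1 / pi\<^sup>2 * quartic_kernel (?s l l') ((real k - real k') * h)))"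
      unfolding sum_cells
    proof (rule sum.cong[OF refl], rule sum.cong[OF refl], rule sum.cong[OF refl], rule sum.cong[OF refl])
      fix l k l' k' assume "l \<in> {..<r}" "l' \<in> {..<r}"
      then have "(k * r + l) mod r = l" "(k * r + l) div r = k" "(k' * r + l') mod r = l'" "(k' * r + l') div r = k'" by auto
      then show "(h * w)\<^sup>2 * (cmod (K_H (corner (k * r + l)) (corner (k' * r + l'))))\<^sup>2
        = (h * w)\<^sup>2 * (1 / pi\<^sup>2 * quartic_kernel (?s l l') ((real k - real k') * h))"
        by (simp add: norm_K_H_square corner_def left_diff_distrib)
    qed
    also have "\<dots> = (\<Sum>l<r. \<Sum>l'<r. \<Sum>k<n. \<Sum>k'<n. (h * w)\<^sup>2 * (1 / pi\<^sup>2 * quartic_kernel (?s l l') ((real k - real k') * h)))"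
      by (rule sum.cong[OF refl], rule sum.swap)
    finally show ?thesis
      by (simp only: sum_distrib_left power_mult_distrib mult_ac)
  qed
  finally have *: "real n * h / (2 * pi) * (1 / 4 - 1 / (1 + a) + 1 / (4 * a)) - (a - 1)\<^sup>2 * (2 * (h + 1) + real n * h * h / 16)
    \<le> (\<Sum>i<n * r. \<Sum>j<n * r. (h * w)\<^sup>2 * (cmod (K_H (corner i) (corner j)))\<^sup>2)" .
  have "(\<Sum>i<n * r. \<Sum>j<n * r. 2 * (h + w) * (h * w)\<^sup>2) = 2 * (h + w) * (real n * h * (real r * w))\<^sup>2"
    by (simp add: power2_eq_square algebra_simps)
  then have "real n * h / (2 * pi) * (1 / 4 - 1 / (1 + a) + 1 / (4 * a))
    - (a - 1)\<^sup>2 * (2 * (h + 1) + real n * h * h / 16) - 2 * (h + w) * (real n * h * (a - 1))\<^sup>2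
    \<le> (\<Sum>i<n * r. \<Sum>j<n * r. (h * w)\<^sup>2 * (cmod (K_H (corner i) (corner j)))\<^sup>2) - (\<Sum>i<n * r. \<Sum>j<n * r. 2 * (h + w) * (h * w)\<^sup>2)"
    using * by (simp only: rw)
  also have "\<dots> = (\<Sum>i<n * r. \<Sum>j<n * r. (h * w)\<^sup>2 * (cmod (K_H (corner i) (corner j)))\<^sup>2 - 2 * (h + w) * (h * w)\<^sup>2)"
    by (simp only: sum_subtractf)
  also have "\<dots> \<le> (\<Sum>i<n * r. \<Sum>j<n * r. (cmod (gram i j))\<^sup>2)"
    by (intro sum_mono term_ge)
  finally show ?thesis .
qed

lemma mode_density_measurable: "mode_density n \<in> borel_measurable half_line"
  unfolding mode_density_def[abs_def] fejer_def by (rule measurable_half_line) measurable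

lemma integral_mode_density_le:
  assumes f: "integrable half_line f" "\<And>\<xi>. \<xi> > 0 \<Longrightarrow> 0 \<le> f \<xi>"
  shows "(LINT \<xi>|half_line. f \<xi> * mode_density n \<xi>) \<le> real n * h / (2 * pi) * (LINT \<xi>|half_line. f \<xi>)"
    and "integrable half_line (\<lambda>\<xi>. f \<xi> * mode_density n \<xi>)"
proof -
  have i: "integrable half_line (\<lambda>\<xi>. real n * h / (2 * pi) * f \<xi>)" by (intro integrable_mult_right f)
  have le: "f \<xi> * mode_density n \<xi> \<le> real n * h / (2 * pi) * f \<xi>" "0 \<le> f \<xi> * mode_density n \<xi>" if "\<xi> \<in> space half_line" for \<xi>
    using that f(2)[of \<xi>] mode_density_bounds[of \<xi> n] mult_left_mono[of "mode_density n \<xi>" "real n * h / (2 * pi)" "f \<xi>"]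
    by (auto simp: space_restrict_space mult.commute)
  show i': "integrable half_line (\<lambda>\<xi>. f \<xi> * mode_density n \<xi>)"
  proof (rule Bochner_Integration.integrable_bound[OF i])
    show "AE \<xi> in half_line. norm (f \<xi> * mode_density n \<xi>) \<le> norm (real n * h / (2 * pi) * f \<xi>)"
    proof (intro AE_I2)
      fix \<xi> assume "\<xi> \<in> space half_line"
      from le[OF this] show "norm (f \<xi> * mode_density n \<xi>) \<le> norm (real n * h / (2 * pi) * f \<xi>)"
        unfolding real_norm_def by (metis abs_ge_self abs_of_nonneg order_trans)
    qed
  qed (use f(1) mode_density_measurable in measurable)
  have "(LINT \<xi>|half_line. f \<xi> * mode_density n \<xi>) \<le> (LINT \<xi>|half_line. real n * h / (2 * pi) * f \<xi>)"
    by (rule integral_mono[OF i' i le(1)])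
  then show "(LINT \<xi>|half_line. f \<xi> * mode_density n \<xi>) \<le> real n * h / (2 * pi) * (LINT \<xi>|half_line. f \<xi>)"
    by (simp only: integral_mult_right_zero)
qed

text \<open>Both main terms are \<open>n * h / (2 * pi)\<close> times the integral of the squared
  symbol and cancel. For fixed \<open>n * h\<close> the bound tends to
  \<open>2 * (a - 1)\<^sup>2\<close> as the mesh shrinks, with no growth in the length.\<close>

lemma variance_defect_le:
  "(LINT \<xi>|half_line. (strip_symbol a \<xi>)\<^sup>2 * mode_density n \<xi>) - (\<Sum>i<n * r. \<Sum>j<n * r. (cmod (gram i j))\<^sup>2)
    \<le> (a - 1)\<^sup>2 * (2 * (h + 1) + real n * h * h / 16) + 2 * (h + w) * (real n * h * (a - 1))\<^sup>2"
  using integral_mode_density_le(1)[OF strip_symbol_moments(3)[OF a], of n] gram_frobenius_ge[of n]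
  unfolding strip_symbol_moments(4)[OF a] by simp

text \<open>A crude bound, uniform in the mesh: it dominates the moment series and the sums of
  logarithms while the mesh shrinks.\<close>

lemma trace_le: "(LINT \<xi>|half_line. strip_symbol a \<xi> * mode_density n \<xi>) \<le> real n * h"
proof -
  have "(LINT \<xi>|half_line. strip_symbol a \<xi> * mode_density n \<xi>) \<le> real n * h / (2 * pi) * (LINT \<xi>|half_line. strip_symbol a \<xi>)"
    by (rule integral_mode_density_le(1)[OF strip_symbol_moments(1)[OF a]]) (use strip_symbol_pos[OF a] in \<open>auto intro: less_imp_le\<close>)
  also have "\<dots> \<le> real n * h / (2 * pi) * 1"
    using h strip_symbol_moments(2)[OF a] by (intro mult_left_mono) auto
  also have "\<dots> \<le> real n * h / 1 * 1"
    using h pi_gt3 by (intro mult_right_mono divide_left_mono) auto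
  finally show ?thesis by simp
qed

end

subsection \<open>Factorial moments of the counting variable\<close>

lemma emeasure_complex_rectangle:
  assumes ab: "x0 \<le> x1" "y0 \<le> y1" and A: "A \<in> sets borel"
    and sub: "box (Complex x0 y0) (Complex x1 y1) \<subseteq> A" "A \<subseteq> cbox (Complex x0 y0) (Complex x1 y1)"
  shows "emeasure lborel A = ennreal ((x1 - x0) * (y1 - y0))"
proof (rule antisym)
  have le: "\<And>b. b \<in> Basis \<Longrightarrow> Complex x0 y0 \<bullet> b \<le> Complex x1 y1 \<bullet> b"
    using ab by (auto simp: Basis_complex_def)
  have v: "(\<Prod>b\<in>Basis. (Complex x1 y1 - Complex x0 y0) \<bullet> b) = (x1 - x0) * (y1 - y0)"
    by (simp add: Basis_complex_def)
  have "emeasure lborel A \<le> emeasure lborel (cbox (Complex x0 y0) (Complex x1 y1))"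
    by (rule emeasure_mono[OF sub(2)]) simp
  then show "emeasure lborel A \<le> ennreal ((x1 - x0) * (y1 - y0))"
    using le v by (simp add: emeasure_lborel_cbox_eq)
  have "emeasure lborel (box (Complex x0 y0) (Complex x1 y1)) \<le> emeasure lborel A"
    by (rule emeasure_mono[OF sub(1)]) (use A in simp)
  then show "ennreal ((x1 - x0) * (y1 - y0)) \<le> emeasure lborel A"
    using le v by simp
qed

text \<open>Leibniz's formula has \<open>fact n\<close> terms, and a product of factors of modulus
  at most 1 changes by at most the sum of the changes of its factors.\<close>

lemma det_diff_bound:
  fixes A B :: "nat \<Rightarrow> nat \<Rightarrow> complex"
  assumes A: "\<And>i j. i < n \<Longrightarrow> j < n \<Longrightarrow> cmod (A i j) \<le> 1" and B: "\<And>i j. i < n \<Longrightarrow> j < n \<Longrightarrow> cmod (B i j) \<le> 1"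
    and d: "\<And>i j. i < n \<Longrightarrow> j < n \<Longrightarrow> cmod (A i j - B i j) \<le> e"
  shows "cmod (Determinant.det (Matrix.mat n n (\<lambda>(i, j). A i j)) - Determinant.det (Matrix.mat n n (\<lambda>(i, j). B i j))) \<le> fact n * (real n * e)"
    and "cmod (Determinant.det (Matrix.mat n n (\<lambda>(i, j). A i j))) \<le> fact n"
proof -
  have D: "Determinant.det (Matrix.mat n n (\<lambda>(i, j). C i j)) = (\<Sum>p | p permutes {0..<n}. of_int (sign p) * (\<Prod>i<n. C i (p i)))" for C :: "nat \<Rightarrow> nat \<Rightarrow> complex"
    by (subst det_def') (auto simp: atLeast0LessThan permutes_in_image intro!: sum.cong prod.cong)
  have sg: "\<bar>real_of_int (sign p)\<bar> = 1" for p :: "nat \<Rightarrow> nat" by (simp add: sign_def)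
  have lt: "p i < n" if "p permutes {0..<n}" "i < n" for p i
    using permutes_in_image[OF that(1), of i] that(2) by simp
  have "cmod (Determinant.det (Matrix.mat n n (\<lambda>(i, j). A i j)) - Determinant.det (Matrix.mat n n (\<lambda>(i, j). B i j)))
    = cmod (\<Sum>p | p permutes {0..<n}. of_int (sign p) * ((\<Prod>i<n. A i (p i)) - (\<Prod>i<n. B i (p i))))"
    unfolding D by (simp add: sum_subtractf right_diff_distrib)
  also have "\<dots> \<le> (\<Sum>p | p permutes {0..<n}. real n * e)"
  proof (rule order_trans[OF norm_sum sum_mono])
    fix p assume "p \<in> {p. p permutes {0..<n}}"
    then have p: "p permutes {0..<n}" by simp
    have "cmod ((\<Prod>i<n. A i (p i)) - (\<Prod>i<n. B i (p i))) \<le> (\<Sum>i<n. cmod (A i (p i) - B i (p i)))"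
      by (rule norm_prod_diff) (use A B lt[OF p] in auto)
    also have "\<dots> \<le> (\<Sum>i<n. e)" by (intro sum_mono d) (use lt[OF p] in auto)
    finally show "cmod (of_int (sign p) * ((\<Prod>i<n. A i (p i)) - (\<Prod>i<n. B i (p i)))) \<le> real n * e"
      by (simp add: norm_mult sg)
  qed
  also have "\<dots> = fact n * (real n * e)" by (simp add: card_permutations)
  finally show "cmod (Determinant.det (Matrix.mat n n (\<lambda>(i, j). A i j)) - Determinant.det (Matrix.mat n n (\<lambda>(i, j). B i j))) \<le> fact n * (real n * e)" .
  have "cmod (Determinant.det (Matrix.mat n n (\<lambda>(i, j). A i j))) \<le> (\<Sum>p | p permutes {0..<n}. (1::real))"
    unfolding D
  proof (rule order_trans[OF norm_sum sum_mono])
    fix p assume "p \<in> {p. p permutes {0..<n}}"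
    then have p: "p permutes {0..<n}" by simp
    have "(\<Prod>i<n. cmod (A i (p i))) \<le> 1" by (rule prod_le_1) (use A lt[OF p] in auto)
    then show "cmod (of_int (sign p) * (\<Prod>i<n. A i (p i))) \<le> 1" by (simp add: norm_mult sg prod_norm)
  qed
  then show "cmod (Determinant.det (Matrix.mat n n (\<lambda>(i, j). A i j))) \<le> fact n" by (simp add: card_permutations)
qed

lemma det_scale:
  fixes A :: "nat \<Rightarrow> nat \<Rightarrow> complex"
  shows "Determinant.det (Matrix.mat n n (\<lambda>(i, j). c * A i j)) = c ^ n * Determinant.det (Matrix.mat n n (\<lambda>(i, j). A i j))"
proof -
  have "Matrix.mat n n (\<lambda>(i, j). c * A i j) = c \<cdot>\<^sub>m Matrix.mat n n (\<lambda>(i, j). A i j)"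
    by (rule eq_matI) auto
  then show ?thesis by (simp add: det_smult)
qed

section \<open>Integration over products of cells\<close>

abbreviation plane_power :: "nat \<Rightarrow> (nat \<Rightarrow> complex) measure" where
  "plane_power n \<equiv> PiM {..<n} (\<lambda>_. restrict_space lborel upper_half_plane)"

definition rectangle :: "real \<Rightarrow> real \<Rightarrow> complex set" where
  "rectangle a L = {z. 0 \<le> Re z \<and> Re z \<le> L \<and> 1 \<le> Im z \<and> Im z \<le> a}"

lemma rectangle_eq_cbox: "rectangle a L = cbox (Complex 0 1) (Complex L a)"
  by (auto simp: rectangle_def in_cbox_complex_iff)

lemma upper_half_plane_borel [measurable]: "upper_half_plane \<in> sets borel"
  unfolding upper_half_plane_def by (intro borel_open open_Collect_less continuous_intros)

lemma rectangle_subset: "rectangle a L \<subseteq> upper_half_plane"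
  by (auto simp: rectangle_def upper_half_plane_def)

lemma sets_half_plane:
  "A \<in> sets (restrict_space lborel upper_half_plane) \<longleftrightarrow> A \<subseteq> upper_half_plane \<and> A \<in> sets borel"
  by (subst sets_restrict_space_iff) auto

lemma emeasure_half_plane:
  "A \<subseteq> upper_half_plane \<Longrightarrow> emeasure (restrict_space lborel upper_half_plane) A = emeasure lborel A"
  by (rule emeasure_restrict_space) auto

lemma emeasure_plane_power:
  assumes "\<And>i. i < n \<Longrightarrow> A i \<in> sets borel" "\<And>i. i < n \<Longrightarrow> A i \<subseteq> upper_half_plane"
  shows "emeasure (plane_power n) (Pi\<^sub>E {..<n} A) = (\<Prod>i<n. emeasure lborel (A i))"
proof -
  interpret product_sigma_finite "\<lambda>_::nat. restrict_space lborel upper_half_plane"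
    by (rule product_sigma_finite.intro, rule sigma_finite_measure_restrict_space)
      (auto simp: sigma_finite_lborel)
  have "emeasure (plane_power n) (Pi\<^sub>E {..<n} A) = (\<Prod>i<n. emeasure (restrict_space lborel upper_half_plane) (A i))"
    by (rule emeasure_PiM) (use assms in \<open>auto simp: sets_half_plane\<close>)
  then show ?thesis using assms by (simp add: emeasure_half_plane)
qed

lemma sets_plane_power:
  assumes "\<And>i. i < n \<Longrightarrow> A i \<in> sets borel" "\<And>i. i < n \<Longrightarrow> A i \<subseteq> upper_half_plane"
  shows "Pi\<^sub>E {..<n} A \<in> sets (plane_power n)"
  by (rule sets_PiM_I_finite) (use assms in \<open>auto simp: sets_half_plane\<close>)

context mesh
begin

text \<open>Half-open, so that distinct cells are disjoint; the cells with indices below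
  \<open>m * r\<close> miss only a null set of the closed rectangle.\<close>

definition cell :: "nat \<Rightarrow> complex set" where
  "cell i = {z. real (i div r) * h \<le> Re z \<and> Re z < real (Suc (i div r)) * h
    \<and> 1 + real (i mod r) * w \<le> Im z \<and> Im z < 1 + real (Suc (i mod r)) * w}"

lemma cell_in_cell: "z \<in> cell i \<Longrightarrow> in_cell i z"
  by (simp add: cell_def in_cell_def)

lemma cell_Im: "z \<in> cell i \<Longrightarrow> 1 \<le> Im z"
  unfolding cell_def using w by (smt (verit) mem_Collect_eq mult_nonneg_nonneg of_nat_0_le_iff)

lemma cell_subset: "cell i \<subseteq> upper_half_plane"
  using cell_Im unfolding upper_half_plane_def by force

lemma cell_borel: "cell i \<in> sets borel"
proof -
  have "cell i = {z. real (i div r) * h \<le> Re z} \<inter> {z. Re z < real (Suc (i div r)) * h}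
    \<inter> {z. 1 + real (i mod r) * w \<le> Im z} \<inter> {z. Im z < 1 + real (Suc (i mod r)) * w}"
    by (auto simp: cell_def)
  also have "\<dots> \<in> sets borel"
    by (intro sets.Int borel_open borel_closed open_Collect_less closed_Collect_le continuous_intros)
  finally show ?thesis .
qed

lemma emeasure_cell: "emeasure lborel (cell i) = ennreal (h * w)"
proof -
  have "emeasure lborel (cell i) = ennreal ((real (Suc (i div r)) * h - real (i div r) * h) * ((1 + real (Suc (i mod r)) * w) - (1 + real (i mod r) * w)))"
    by (rule emeasure_complex_rectangle[OF _ _ cell_borel])
      (use h w in \<open>auto simp: cell_def in_box_complex_iff in_cbox_complex_iff algebra_simps\<close>)
  then show ?thesis by (simp add: algebra_simps)
qed

lemma cell_unique:
  assumes "z \<in> cell i" "z \<in> cell j"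
  shows "i = j"
proof -
  have lin: "k = k'" if "real k * c \<le> x" "x < real (Suc k) * c" "real k' * c \<le> x" "x < real (Suc k') * c" "c > 0" for k k' :: nat and c x :: real
  proof -
    have "real k * c < real (Suc k') * c" "real k' * c < real (Suc k) * c" using that by linarith+
    then have "real k < real (Suc k')" "real k' < real (Suc k)" using that(5) by simp_all
    then show ?thesis by linarith
  qed
  have "i div r = j div r" using assms h unfolding cell_def by (intro lin[of _ h "Re z"]) auto
  moreover have "i mod r = j mod r" using assms w unfolding cell_def by (intro lin[of _ w "Im z - 1"]) (auto simp: algebra_simps)
  ultimately show ?thesis by (metis div_mult_mod_eq)
qed

lemma cell_subset_rectangle:
  assumes "i < m * r"
  shows "cell i \<subseteq> rectangle a (real m * h)"
proof
  fix z assume z: "z \<in> cell i"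
  have "i div r < m" using assms by (simp add: less_mult_imp_div_less)
  then have "real (Suc (i div r)) \<le> real m" by simp
  then have "real (Suc (i div r)) * h \<le> real m * h" using h by (intro mult_right_mono) auto
  moreover have "real (Suc (i mod r)) \<le> real r" using mod_less_divisor[OF r, of i] by (simp only: of_nat_le_iff Suc_le_eq)
  then have "real (Suc (i mod r)) * w \<le> real r * w" using w by (intro mult_right_mono) auto
  moreover have "0 \<le> real (i div r) * h" using h by simp
  ultimately show "z \<in> rectangle a (real m * h)"
    using z cell_Im[OF z] rw unfolding cell_def rectangle_def by auto
qed

text \<open>On a product of cells the correlation function differs by at most
  \<open>\<epsilon>\<close> from the determinant \<open>d y\<close> of cell means, and
  \<open>d y\<close> times the volume of the product is the determinant of Gram entries. Summation
  over all products multiplies the error by the total volume.\<close>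

lemma correlation_integral_approx:
  assumes rho: "\<rho> \<in> borel_measurable (plane_power n)"
    and det: "\<And>x. x \<in> {..<n} \<rightarrow>\<^sub>E upper_half_plane \<Longrightarrow>
      complex_of_real (\<rho> x) = Determinant.det (Matrix.mat n n (\<lambda>(i, j). K_H (x i) (x j)))"
    and m: "m > 0"
  shows "integrable (plane_power n) (\<lambda>x. indicator (Pi\<^sub>E {..<n} (\<lambda>_. rectangle a (real m * h))) x * \<rho> x)"
    and "cmod (of_real (LINT x|plane_power n. indicator (Pi\<^sub>E {..<n} (\<lambda>_. rectangle a (real m * h))) x * \<rho> x)
      - (\<Sum>y\<in>{..<n} \<rightarrow>\<^sub>E {..<m * r}. Determinant.det (Matrix.mat n n (\<lambda>(i, j). gram (y i) (y j)))))
      \<le> fact n * (real n * (h + w)) * (real m * h * (a - 1)) ^ n"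
proof -
  let ?P = "plane_power n"
  define B where "B = Pi\<^sub>E {..<n} (\<lambda>_. rectangle a (real m * h))"
  define Y where "Y = {..<n} \<rightarrow>\<^sub>E {..<m * r}"
  define Q where "Q = (\<lambda>y. Pi\<^sub>E {..<n} (\<lambda>i. cell (y i)))"
  define d where "d = (\<lambda>y. Determinant.det (Matrix.mat n n (\<lambda>(i, j). cell_kernel (y i) (y j))))"
  define \<epsilon> where "\<epsilon> = fact n * (real n * (h + w))"
  have finY: "finite Y" unfolding Y_def by (intro finite_PiE) auto
  have cardY: "real (card Y) * (h * w) ^ n = (real m * h * (a - 1)) ^ n"
    unfolding Y_def by (simp add: card_funcsetE rw[symmetric] power_mult_distrib mult_ac)
  have mh: "0 \<le> real m * h" using h by simp
  have rect_borel: "rectangle a (real m * h) \<in> sets borel" unfolding rectangle_eq_cbox by simp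
  have rect_meas: "emeasure lborel (rectangle a (real m * h)) = ennreal (real m * h * (a - 1))"
    using emeasure_complex_rectangle[of 0 "real m * h" 1 a "rectangle a (real m * h)"] mh a rect_borel
    unfolding rectangle_eq_cbox by (simp add: box_subset_cbox)
  have B: "B \<in> sets ?P" unfolding B_def by (rule sets_plane_power) (use rect_borel rectangle_subset in auto)
  have eB: "emeasure ?P B = ennreal ((real m * h * (a - 1)) ^ n)"
    unfolding B_def using rect_borel rectangle_subset mh a
    by (subst emeasure_plane_power) (auto simp: rect_meas ennreal_power)
  have Q: "Q y \<in> sets ?P" for y unfolding Q_def by (rule sets_plane_power) (use cell_borel cell_subset in auto)
  have eQ: "emeasure ?P (Q y) = ennreal ((h * w) ^ n)" for y
    unfolding Q_def using cell_borel cell_subset h w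
    by (subst emeasure_plane_power) (auto simp: emeasure_cell ennreal_power)
  have mQ: "measure ?P (Q y) = (h * w) ^ n" for y
    using eQ[of y] h w by (simp add: measure_def)
  have QB: "Q y \<subseteq> B" if "y \<in> Y" for y
    unfolding Q_def B_def by (rule PiE_mono) (use that cell_subset_rectangle in \<open>auto simp: Y_def PiE_iff\<close>)
  have disj: "y = y'" if "x \<in> Q y" "x \<in> Q y'" "y \<in> Y" "y' \<in> Y" for x y y'
  proof (rule PiE_ext[of _ "{..<n}" "\<lambda>_. {..<m * r}"])
    show "y \<in> {..<n} \<rightarrow>\<^sub>E {..<m * r}" "y' \<in> {..<n} \<rightarrow>\<^sub>E {..<m * r}" using that by (auto simp: Y_def)
    fix i assume "i \<in> {..<n}"
    then show "y i = y' i" using that(1,2) cell_unique[of "x i" "y i" "y' i"] unfolding Q_def by (auto simp: PiE_iff)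
  qed
  have dUN: "disjoint_family_on Q Y"
    using disj by (auto simp: disjoint_family_on_def)
  define U where "U = (\<Union>y\<in>Y. Q y)"
  have U: "U \<in> sets ?P" unfolding U_def using finY Q by (intro sets.finite_UN) auto
  \<comment> \<open>The uncovered part need not be described: the disjoint products of cells have
    the same finite total measure as \<open>B\<close>.\<close>
  have eU: "emeasure ?P U = emeasure ?P B"
  proof -
    have "emeasure ?P U = (\<Sum>y\<in>Y. emeasure ?P (Q y))"
      unfolding U_def by (rule sum_emeasure[symmetric]) (use Q dUN finY in auto)
    also have "\<dots> = ennreal (real (card Y) * (h * w) ^ n)"
      using h w by (simp add: eQ ennreal_mult ennreal_of_nat_eq_real_of_nat)
    finally show ?thesis unfolding eB cardY .
  qed
  have UB: "U \<subseteq> B" unfolding U_def using QB by blast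
  have null: "B - U \<in> null_sets ?P"
  proof (rule null_setsI)
    show "emeasure ?P (B - U) = 0"
      using emeasure_Diff[OF _ B U UB] eU eB by simp
  qed (use B U in auto)
  have Bsp: "B \<subseteq> {..<n} \<rightarrow>\<^sub>E upper_half_plane"
    unfolding B_def by (rule PiE_mono) (use rectangle_subset in auto)
  have rho_bound: "\<bar>\<rho> x\<bar> \<le> fact n" if "x \<in> B" for x
  proof -
    have "cmod (Determinant.det (Matrix.mat n n (\<lambda>(i, j). K_H (x i) (x j)))) \<le> fact n"
      by (rule det_diff_bound(2)[where B = "\<lambda>i j. K_H (x i) (x j)" and e = 0])
        (use that norm_K_H_le_1 in \<open>auto simp: B_def PiE_iff rectangle_def\<close>)
    then show ?thesis using det[of x] Bsp that by (metis norm_of_real subsetD)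
  qed
  have intB: "integrable ?P (\<lambda>x. indicator B x * \<rho> x)"
  proof (rule Bochner_Integration.integrable_bound)
    show "integrable ?P (\<lambda>x. fact n * indicator B x :: real)"
      using B eB by (intro integrable_mult_right) (simp add: integrable_indicator_iff)
    show "AE x in ?P. norm (indicator B x * \<rho> x) \<le> norm (fact n * indicator B x :: real)"
      using rho_bound by (intro AE_I2) (auto simp: indicator_def)
  qed (use B rho in measurable)
  then show "integrable (plane_power n) (\<lambda>x. indicator (Pi\<^sub>E {..<n} (\<lambda>_. rectangle a (real m * h))) x * \<rho> x)"
    unfolding B_def .
  have intQ: "integrable ?P (\<lambda>x. indicator (Q y) x * \<rho> x)" if "y \<in> Y" for y
  proof -
    have "integrable ?P (\<lambda>x. indicator (Q y) x *\<^sub>R (indicator B x * \<rho> x))"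
      by (rule integrable_mult_indicator[OF Q intB])
    moreover have "indicator (Q y) x *\<^sub>R (indicator B x * \<rho> x) = indicator (Q y) x * \<rho> x" for x
      using QB[OF that] by (auto simp: indicator_def)
    ultimately show ?thesis by (simp only:)
  qed
  have split: "(LINT x|?P. indicator B x * \<rho> x) = (\<Sum>y\<in>Y. (LINT x|?P. indicator (Q y) x * \<rho> x))"
  proof -
    have "(LINT x|?P. indicator B x * \<rho> x) = (LINT x|?P. (\<Sum>y\<in>Y. indicator (Q y) x * \<rho> x))"
    proof (rule integral_cong_AE)
      show "AE x in ?P. indicator B x * \<rho> x = (\<Sum>y\<in>Y. indicator (Q y) x * \<rho> x)"
        using AE_not_in[OF null]
      proof eventually_elim
        case (elim x)
        have "(\<Sum>y\<in>Y. indicator (Q y) x * \<rho> x) = indicator U x * \<rho> x"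
          unfolding U_def sum_distrib_right[symmetric]
          by (subst indicator_UN_disjoint[OF finY dUN]) (rule refl)
        moreover have "x \<in> B \<longleftrightarrow> x \<in> U" using elim UB by auto
        ultimately show ?case by (simp add: indicator_def)
      qed
    qed (use intB intQ in \<open>auto intro!: borel_measurable_integrable Bochner_Integration.integrable_sum\<close>)
    also have "\<dots> = (\<Sum>y\<in>Y. (LINT x|?P. indicator (Q y) x * \<rho> x))"
      by (rule Bochner_Integration.integral_sum) (rule intQ)
    finally show ?thesis .
  qed
  have each: "cmod (of_real (LINT x|?P. indicator (Q y) x * \<rho> x) - of_real ((h * w) ^ n) * d y) \<le> \<epsilon> * (h * w) ^ n" if y: "y \<in> Y" for y
  proof -
    have fm: "emeasure ?P (Q y) < \<infinity>" by (simp add: eQ)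
    have ii: "integrable ?P (\<lambda>x. complex_of_real (indicator (Q y) x))"
      using fm Q by (intro integrable_of_real) (simp add: integrable_indicator_iff)
    have iid: "integrable ?P (\<lambda>x. complex_of_real (indicator (Q y) x) * d y)" by (intro integrable_mult_left ii)
    have iir: "integrable ?P (\<lambda>x. complex_of_real (indicator (Q y) x * \<rho> x))" by (rule integrable_of_real[OF intQ[OF y]])
    have "(LINT x|?P. complex_of_real (indicator (Q y) x) * d y) = of_real ((h * w) ^ n) * d y"
      using mQ[of y] Q[of y] fm by (simp add: sets.Int_space_eq2)
    then have "of_real (LINT x|?P. indicator (Q y) x * \<rho> x) - of_real ((h * w) ^ n) * d y
      = (LINT x|?P. complex_of_real (indicator (Q y) x * \<rho> x) - complex_of_real (indicator (Q y) x) * d y)"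
      using Bochner_Integration.integral_diff[OF iir iid] integral_complex_of_real[of ?P "\<lambda>x. indicator (Q y) x * \<rho> x"]
      by (simp only:)
    also have "cmod \<dots> \<le> (LINT x|?P. cmod (complex_of_real (indicator (Q y) x * \<rho> x) - complex_of_real (indicator (Q y) x) * d y))"
      by (rule integral_norm_bound)
    also have "\<dots> \<le> (LINT x|?P. \<epsilon> * indicator (Q y) x)"
    proof (rule integral_mono)
      show "integrable ?P (\<lambda>x. cmod (complex_of_real (indicator (Q y) x * \<rho> x) - complex_of_real (indicator (Q y) x) * d y))"
        by (intro integrable_norm Bochner_Integration.integrable_diff iir iid)
      show "integrable ?P (\<lambda>x. \<epsilon> * indicator (Q y) x)"
        using fm Q by (intro integrable_mult_right) (simp add: integrable_indicator_iff)
      fix x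
      show "cmod (complex_of_real (indicator (Q y) x * \<rho> x) - complex_of_real (indicator (Q y) x) * d y) \<le> \<epsilon> * indicator (Q y) x"
      proof (cases "x \<in> Q y")
        case True
        then have xs: "x \<in> {..<n} \<rightarrow>\<^sub>E upper_half_plane" using QB[OF y] Bsp by auto
        have "cmod (Determinant.det (Matrix.mat n n (\<lambda>(i, j). K_H (x i) (x j))) - d y) \<le> \<epsilon>"
          unfolding d_def \<epsilon>_def
        proof (rule det_diff_bound(1))
          fix i j assume ij: "i < n" "j < n"
          then have c: "x i \<in> cell (y i)" "x j \<in> cell (y j)" using True by (auto simp: Q_def PiE_iff)
          show "cmod (K_H (x i) (x j)) \<le> 1" using c by (intro norm_K_H_le_1 cell_Im)
          show "cmod (cell_kernel (y i) (y j)) \<le> 1" by (rule norm_cell_kernel_le)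
          show "cmod (K_H (x i) (x j) - cell_kernel (y i) (y j)) \<le> h + w"
            using c by (intro cell_kernel_close cell_in_cell)
        qed
        then show ?thesis using True det[OF xs] by simp
      qed simp
    qed
    also have "\<dots> = \<epsilon> * (h * w) ^ n" using mQ[of y] Q[of y] fm by (simp add: sets.Int_space_eq2)
    finally show ?thesis .
  qed
  have g: "Determinant.det (Matrix.mat n n (\<lambda>(i, j). gram (y i) (y j))) = of_real ((h * w) ^ n) * d y" for y
    unfolding d_def gram_eq_cell_kernel det_scale by simp
  have "cmod (of_real (LINT x|?P. indicator B x * \<rho> x) - (\<Sum>y\<in>Y. Determinant.det (Matrix.mat n n (\<lambda>(i, j). gram (y i) (y j)))))
    = cmod (\<Sum>y\<in>Y. of_real (LINT x|?P. indicator (Q y) x * \<rho> x) - of_real ((h * w) ^ n) * d y)"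
    unfolding split g by (simp add: sum_subtractf)
  also have "\<dots> \<le> (\<Sum>y\<in>Y. \<epsilon> * (h * w) ^ n)"
    by (rule order_trans[OF norm_sum sum_mono]) (rule each)
  also have "\<dots> = \<epsilon> * (real m * h * (a - 1)) ^ n" unfolding cardY[symmetric] by simp
  finally show "cmod (of_real (LINT x|plane_power n. indicator (Pi\<^sub>E {..<n} (\<lambda>_. rectangle a (real m * h))) x * \<rho> x)
      - (\<Sum>y\<in>{..<n} \<rightarrow>\<^sub>E {..<m * r}. Determinant.det (Matrix.mat n n (\<lambda>(i, j). gram (y i) (y j)))))
      \<le> fact n * (real n * (h + w)) * (real m * h * (a - 1)) ^ n"
    unfolding B_def Y_def \<epsilon>_def .
qed


text \<open>The expansions of one determinant by tuples and by eigenvalues are polynomials in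
  \<open>z\<close> with equal coefficients. The \<open>e k\<close> are the elementary symmetric
  functions of the eigenvalues; since \<open>e k * s ^ k\<close> is at most the product of the
  factors \<open>1 + s * l p\<close>, it is at most the exponential of \<open>s\<close> times the
  trace, for every mesh and every \<open>s\<close>.\<close>

lemma tuple_sums_eq_elementary_symmetric:
  obtains e :: "nat \<Rightarrow> real" where
    "\<And>k. (\<Sum>y\<in>{..<k} \<rightarrow>\<^sub>E {..<n * r}. Determinant.det (Matrix.mat k k (\<lambda>(i, j). gram (y i) (y j)))) = of_real (fact k * e k)"
    "\<And>k. 0 \<le> e k" "\<And>k s. 0 < s \<Longrightarrow> e k * s ^ k \<le> exp (s * (real n * h))"
    "\<And>k. n * r < k \<Longrightarrow> e k = 0"
proof -
  define m where "m = n * r"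
  obtain l where l: "\<And>p. p < m \<Longrightarrow> 0 \<le> l p \<and> l p \<le> 1"
    and d: "\<And>z. Determinant.det (Matrix.mat m m (\<lambda>(i, j). (if i = j then 1 else 0) + z * gram i j)) = (\<Prod>p<m. 1 + z * of_real (l p))"
    and tr: "(\<Sum>p<m. l p) = (LINT \<xi>|half_line. strip_symbol a \<xi> * mode_density n \<xi>)"
    by (rule gram_spectrum[of n, folded m_def]; rule that)
  define e where "e = (\<lambda>k. \<Sum>S | S \<subseteq> {..<m} \<and> card S = k. \<Prod>p\<in>S. l p)"
  define S where "S = (\<lambda>k. \<Sum>y\<in>{..<k} \<rightarrow>\<^sub>E {..<m}. Determinant.det (Matrix.mat k k (\<lambda>(i, j). gram (y i) (y j))))"
  have fin: "finite {S. S \<subseteq> {..<m} \<and> card S = k}" for k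
    by (rule finite_subset[of _ "Pow {..<m}"]) auto
  have e0: "0 \<le> e k" for k
    unfolding e_def using l by (intro sum_nonneg prod_nonneg) auto
  have expand: "(\<Prod>p<m. 1 + z * of_real (l p)) = (\<Sum>k\<le>m. of_real (e k) * z ^ k)" for z :: complex
  proof -
    have "(\<Prod>p<m. 1 + z * of_real (l p)) = (\<Prod>p<m. z * of_real (l p) + 1)" by (simp only: add.commute)
    also have "\<dots> = (\<Sum>S\<in>Pow {..<m}. (\<Prod>p\<in>S. z * of_real (l p)) * (\<Prod>p\<in>{..<m} - S. 1))"
      by (rule prod_add) simp
    also have "\<dots> = (\<Sum>S\<in>Pow {..<m}. z ^ card S * of_real (\<Prod>p\<in>S. l p))"
      by (simp add: prod.distrib)
    also have "\<dots> = (\<Sum>k\<le>m. \<Sum>S | S \<in> Pow {..<m} \<and> card S = k. z ^ card S * of_real (\<Prod>p\<in>S. l p))"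
    proof (rule sum.group[symmetric])
      show "card ` Pow {..<m} \<subseteq> {..m}"
      proof
        fix k assume "k \<in> card ` Pow {..<m}"
        then obtain S where "S \<subseteq> {..<m}" "k = card S" by auto
        then show "k \<in> {..m}" using card_mono[of "{..<m}" S] by simp
      qed
    qed auto
    also have "\<dots> = (\<Sum>k\<le>m. of_real (e k) * z ^ k)"
    proof (rule sum.cong[OF refl])
      fix k
      have "(\<Sum>S | S \<in> Pow {..<m} \<and> card S = k. z ^ card S * of_real (\<Prod>p\<in>S. l p))
        = (\<Sum>S | S \<subseteq> {..<m} \<and> card S = k. z ^ k * complex_of_real (\<Prod>p\<in>S. l p))"
        by (rule sum.cong) auto
      also have "\<dots> = of_real (e k) * z ^ k"
        unfolding e_def of_real_sum sum_distrib_right by (simp only: mult.commute)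
      finally show "(\<Sum>S | S \<in> Pow {..<m} \<and> card S = k. z ^ card S * of_real (\<Prod>p\<in>S. l p)) = of_real (e k) * z ^ k" .
    qed
    finally show ?thesis .
  qed
  have "\<forall>z. (\<Sum>k\<le>m. (S k / fact k) * z ^ k) = (\<Sum>k\<le>m. of_real (e k) * z ^ k)"
  proof
    fix z
    have "(\<Sum>k\<le>m. (S k / fact k) * z ^ k) = (\<Sum>k\<le>m. z ^ k / fact k * S k)"
      by (rule sum.cong[OF refl]) simp
    also have "\<dots> = (\<Prod>p<m. 1 + z * of_real (l p))"
      unfolding d[symmetric] det_one_plus_eq_sum_tuples S_def ..
    finally show "(\<Sum>k\<le>m. (S k / fact k) * z ^ k) = (\<Sum>k\<le>m. of_real (e k) * z ^ k)"
      unfolding expand .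
  qed
  then have coeff: "S k / fact k = of_real (e k)" if "k \<le> m" for k
    using that unfolding polyfun_eq_coeffs by blast
  have large: "e k = 0" "S k = 0" if "m < k" for k
  proof -
    have "{S. S \<subseteq> {..<m} \<and> card S = k} = {}"
    proof (rule ccontr)
      assume "\<not> ?thesis"
      then obtain S where "S \<subseteq> {..<m}" "card S = k" by blast
      then show False using that card_mono[of "{..<m}" S] by simp
    qed
    then show "e k = 0" unfolding e_def by (simp only: sum.empty)
    show "S k = 0" unfolding S_def by (rule tuple_sum_eq_0_of_gt[OF that])
  qed
  show ?thesis
  proof (rule that[of e, folded m_def])
    show "(\<Sum>y\<in>{..<k} \<rightarrow>\<^sub>E {..<m}. Determinant.det (Matrix.mat k k (\<lambda>(i, j). gram (y i) (y j)))) = of_real (fact k * e k)" for k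
    proof -
      have "S k = of_real (fact k * e k)"
      proof (cases "k \<le> m")
        case True
        then show ?thesis using coeff[OF True] by (simp add: field_simps)
      qed (use large[of k] in simp)
      then show ?thesis unfolding S_def .
    qed
    show "0 \<le> e k" for k by (rule e0)
    show "e k = 0" if "m < k" for k by (rule large[OF that])
    show "e k * s ^ k \<le> exp (s * (real n * h))" if s: "0 < s" for k s
    proof (cases "k \<le> m")
      case True
      have "complex_of_real (\<Sum>k\<le>m. e k * s ^ k) = complex_of_real (\<Prod>p<m. 1 + s * l p)"
        using expand[of "of_real s"] by simp
      then have eq: "(\<Sum>k\<le>m. e k * s ^ k) = (\<Prod>p<m. 1 + s * l p)" by (simp only: of_real_eq_iff)
      have "e k * s ^ k \<le> (\<Sum>k\<le>m. e k * s ^ k)"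
        by (rule member_le_sum) (use True s e0 in auto)
      also have "\<dots> \<le> (\<Prod>p<m. exp (s * l p))"
        unfolding eq using l s by (intro prod_mono) (auto simp: add_nonneg_nonneg)
      also have "\<dots> = exp (s * (\<Sum>p<m. l p))" by (simp add: exp_sum sum_distrib_left)
      also have "\<dots> \<le> exp (s * (real n * h))"
        unfolding tr using trace_le s by (simp add: mult_left_mono)
      finally show ?thesis .
    qed (use large in simp)
  qed
qed

end

section \<open>Binomial moments of the number of points\<close>

lemma prod_diff_eq_fact_binomial: "prod ((-) n) {0..<k} = fact k * (n choose k)" for n k :: nat
proof (induction k)
  case (Suc k)
  have "Suc k * (n choose Suc k) = (n - k) * (n choose k)"
    by (simp only: binomial_absorption binomial_absorb_comp)
  then have "fact (Suc k) * (n choose Suc k) = fact k * (n choose k) * (n - k)"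
    by (simp only: fact_Suc of_nat_id mult.assoc mult.commute mult.left_commute)
  then show ?case using Suc by simp
qed simp

lemma N_eq_card: "N Z a L \<omega> = card (Z \<omega> \<inter> rectangle a L)"
  unfolding N_def rectangle_def by (rule arg_cong[of _ _ card]) auto

context
  fixes M :: "'w measure" and Z :: "'w \<Rightarrow> complex set" and a :: real
  assumes dpp: "determinantal_point_process M upper_half_plane lborel K_H Z" and a: "a > 1"
begin

interpretation simple_point_process M upper_half_plane Z
  using dpp unfolding determinantal_point_process_def by simp

lemma finite_points: "\<omega> \<in> space M \<Longrightarrow> finite (Z \<omega> \<inter> rectangle a L)"
  by (rule locally_finite) (auto simp: rectangle_eq_cbox rectangle_subset[unfolded rectangle_eq_cbox])

text \<open>The process provides counts with extended values. The rectangle is compact, so the count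
  is finite and is recovered as the rounded real value.\<close>

lemma measurable_N: "N Z a L \<in> measurable M (count_space UNIV)"
proof -
  have "(\<lambda>\<omega>. emeasure (count_space UNIV) (Z \<omega> \<inter> rectangle a L)) \<in> borel_measurable M"
    by (rule measurable_count) (auto simp: rectangle_eq_cbox rectangle_subset[unfolded rectangle_eq_cbox])
  then have [measurable]: "(\<lambda>\<omega>. enn2real (emeasure (count_space UNIV) (Z \<omega> \<inter> rectangle a L))) \<in> borel_measurable M"
    by measurable
  have "(\<lambda>\<omega>. nat \<lfloor>enn2real (emeasure (count_space UNIV) (Z \<omega> \<inter> rectangle a L))\<rfloor>) \<in> measurable M (count_space UNIV)"
    by measurable
  moreover have "nat \<lfloor>enn2real (emeasure (count_space UNIV) (Z \<omega> \<inter> rectangle a L))\<rfloor> = N Z a L \<omega>" if "\<omega> \<in> space M" for \<omega>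
    using finite_points[OF that, of L] by (simp add: N_eq_card ennreal_of_nat_eq_real_of_nat)
  ultimately show ?thesis
    using measurable_cong[of M "\<lambda>\<omega>. nat \<lfloor>enn2real (emeasure (count_space UNIV) (Z \<omega> \<inter> rectangle a L))\<rfloor>" "N Z a L" "count_space UNIV"]
    by blast
qed

text \<open>The correlation function, tested on the indicator of the \<open>k\<close>-fold product
  of the rectangle, counts injective \<open>k\<close>-tuples of its points, which is a falling
  factorial of \<open>N\<close>. The second property ties these moments to every mesh of the same
  rectangle.\<close>

lemma factorial_moments:
  assumes L: "L > 0"
  obtains F :: "nat \<Rightarrow> real" where
    "\<And>k. has_bochner_integral M (\<lambda>\<omega>. real (N Z a L \<omega> choose k)) (F k)"
    "\<And>k h w r m. mesh a h w r \<Longrightarrow> m > 0 \<Longrightarrow> real m * h = L \<Longrightarrow>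
      cmod (of_real (fact k * F k) - (\<Sum>y\<in>{..<k} \<rightarrow>\<^sub>E {..<m * r}. Determinant.det (Matrix.mat k k (\<lambda>(i, j). mesh.gram h w r (y i) (y j)))))
        \<le> fact k * (real k * (h + w)) * (L * (a - 1)) ^ k"
proof -
  have "\<forall>k. \<exists>\<rho>. correlation_function M upper_half_plane lborel Z k \<rho> \<and>
      (\<forall>x\<in>{..<k} \<rightarrow>\<^sub>E upper_half_plane. complex_of_real (\<rho> x) = Determinant.det (Matrix.mat k k (\<lambda>(i, j). K_H (x i) (x j))))"
    using dpp unfolding determinantal_point_process_def by simp
  then obtain \<rho> where cf: "\<And>k. correlation_function M upper_half_plane lborel Z k (\<rho> k)"
    and det: "\<And>k x. x \<in> {..<k} \<rightarrow>\<^sub>E upper_half_plane \<Longrightarrow> complex_of_real (\<rho> k x) = Determinant.det (Matrix.mat k k (\<lambda>(i, j). K_H (x i) (x j)))"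
    by metis
  have rho: "\<rho> k \<in> borel_measurable (plane_power k)" and rho0: "\<And>x. x \<in> space (plane_power k) \<Longrightarrow> 0 \<le> \<rho> k x"
    and corr: "\<And>f. f \<in> borel_measurable (plane_power k) \<Longrightarrow>
      (\<integral>\<^sup>+ \<omega>. (\<integral>\<^sup>+ x. f x \<partial>count_space {x \<in> {..<k} \<rightarrow>\<^sub>E Z \<omega>. inj_on x {..<k}}) \<partial>M) = (\<integral>\<^sup>+ x. f x * ennreal (\<rho> k x) \<partial>plane_power k)" for k
    using cf[of k] unfolding correlation_function_def Let_def by auto
  define B where "B = (\<lambda>k::nat. Pi\<^sub>E {..<k} (\<lambda>_. rectangle a L))"
  define G where "G = (\<lambda>k. LINT x|plane_power k. indicator (B k) x * \<rho> k x)"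
  \<comment> \<open>The mesh with a single cell, which is enough for integrability over the
    rectangle.\<close>
  have mesh1: "mesh a L (a - 1) 1" using a L by unfold_locales auto
  have int: "integrable (plane_power k) (\<lambda>x. indicator (B k) x * \<rho> k x)" for k
    using mesh.correlation_integral_approx(1)[OF mesh1 rho[of k] det, where m = 1] by (simp add: B_def)
  have approx: "cmod (of_real (G k) - (\<Sum>y\<in>{..<k} \<rightarrow>\<^sub>E {..<m * r}. Determinant.det (Matrix.mat k k (\<lambda>(i, j). mesh.gram h w r (y i) (y j)))))
        \<le> fact k * (real k * (h + w)) * (L * (a - 1)) ^ k"
    if "mesh a h w r" "m > 0" "real m * h = L" for k h w r m
    using mesh.correlation_integral_approx(2)[OF that(1) rho[of k] det that(2)] unfolding that(3) G_def B_def .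
  have moment: "has_bochner_integral M (\<lambda>\<omega>. real (fact k * (N Z a L \<omega> choose k))) (G k)" for k
  proof (rule has_bochner_integral_nn_integral)
    show "(\<lambda>\<omega>. real (fact k * (N Z a L \<omega> choose k))) \<in> borel_measurable M"
      using measurable_compose[OF measurable_N[of L], of "\<lambda>n. real (fact k * (n choose k))" borel] by simp
    show "0 \<le> G k" unfolding G_def
      using rho0 by (intro Bochner_Integration.integral_nonneg) auto
    have Bs: "B k \<in> sets (plane_power k)"
      unfolding B_def by (rule sets_plane_power) (use rectangle_subset in \<open>auto simp: rectangle_eq_cbox\<close>)
    have inner: "(\<integral>\<^sup>+ x. indicator (B k) x \<partial>count_space {x \<in> {..<k} \<rightarrow>\<^sub>E Z \<omega>. inj_on x {..<k}}) = ennreal (real (fact k * (N Z a L \<omega> choose k)))"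
      if \<omega>: "\<omega> \<in> space M" for \<omega>
    proof -
      let ?C = "{x \<in> {..<k} \<rightarrow>\<^sub>E Z \<omega> \<inter> rectangle a L. inj_on x {..<k}}"
      have eq: "B k \<inter> {x \<in> {..<k} \<rightarrow>\<^sub>E Z \<omega>. inj_on x {..<k}} = ?C"
        unfolding B_def by (rule Set.set_eqI) (simp only: Int_iff mem_Collect_eq PiE_iff, blast)
      then have sub: "?C \<subseteq> {x \<in> {..<k} \<rightarrow>\<^sub>E Z \<omega>. inj_on x {..<k}}" by blast
      have fin: "finite ?C"
        by (rule finite_subset[of _ "{..<k} \<rightarrow>\<^sub>E Z \<omega> \<inter> rectangle a L"]) (use finite_points[OF \<omega>] in \<open>auto intro!: finite_PiE\<close>)
      have "(\<integral>\<^sup>+ x. indicator (B k) x \<partial>count_space {x \<in> {..<k} \<rightarrow>\<^sub>E Z \<omega>. inj_on x {..<k}})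
        = (\<integral>\<^sup>+ x. indicator ?C x \<partial>count_space {x \<in> {..<k} \<rightarrow>\<^sub>E Z \<omega>. inj_on x {..<k}})"
        unfolding eq[symmetric] by (rule nn_integral_cong) (simp add: indicator_def)
      also have "\<dots> = emeasure (count_space {x \<in> {..<k} \<rightarrow>\<^sub>E Z \<omega>. inj_on x {..<k}}) ?C"
        by (rule nn_integral_indicator) (use sub in simp)
      also have "\<dots> = of_nat (card ?C)"
        by (rule emeasure_count_space_finite[OF sub fin])
      also have "card ?C = fact k * (N Z a L \<omega> choose k)"
      proof -
        have "card ?C = prod ((-) (N Z a L \<omega>)) {0..<k}"
          using card_inj_on_subset_funcset[of "{..<k}" "Z \<omega> \<inter> rectangle a L" "{..<k}"] finite_points[OF \<omega>]
          by (simp add: N_eq_card)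
        also have "\<dots> = fact k * (N Z a L \<omega> choose k)"
          by (rule prod_diff_eq_fact_binomial)
        finally show ?thesis .
      qed
      finally show ?thesis by (simp add: ennreal_of_nat_eq_real_of_nat)
    qed
    have "(\<integral>\<^sup>+ \<omega>. ennreal (real (fact k * (N Z a L \<omega> choose k))) \<partial>M)
      = (\<integral>\<^sup>+ \<omega>. (\<integral>\<^sup>+ x. indicator (B k) x \<partial>count_space {x \<in> {..<k} \<rightarrow>\<^sub>E Z \<omega>. inj_on x {..<k}}) \<partial>M)"
      by (rule nn_integral_cong) (simp only: inner)
    also have "\<dots> = (\<integral>\<^sup>+ x. indicator (B k) x * ennreal (\<rho> k x) \<partial>plane_power k)"
      by (rule corr) (use Bs in measurable)
    also have "\<dots> = (\<integral>\<^sup>+ x. ennreal (indicator (B k) x * \<rho> k x) \<partial>plane_power k)"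
      by (rule nn_integral_cong) (auto simp: indicator_def)
    also have "\<dots> = ennreal (G k)"
      unfolding G_def by (rule nn_integral_eq_integral[OF int]) (use rho0 in \<open>auto intro!: AE_I2\<close>)
    finally show "(\<integral>\<^sup>+ \<omega>. ennreal (real (fact k * (N Z a L \<omega> choose k))) \<partial>M) = ennreal (G k)" .
  qed auto
  show ?thesis
  proof (rule that[of "\<lambda>k. G k / fact k"])
    show "has_bochner_integral M (\<lambda>\<omega>. real (N Z a L \<omega> choose k)) (G k / fact k)" for k
      using has_bochner_integral_divide_zero[OF moment[of k], of "fact k"] by simp
    show "cmod (of_real (fact k * (G k / fact k)) - (\<Sum>y\<in>{..<k} \<rightarrow>\<^sub>E {..<m * r}. Determinant.det (Matrix.mat k k (\<lambda>(i, j). mesh.gram h w r (y i) (y j)))))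
        \<le> fact k * (real k * (h + w)) * (L * (a - 1)) ^ k"
      if "mesh a h w r" "m > 0" "real m * h = L" for k h w r m
      using approx[OF that] by simp
  qed
qed

end

subsection \<open>Refining the mesh\<close>

text \<open>A length \<open>\<eta>\<close> is cut into \<open>Suc q\<close> columns of
  \<open>Suc q\<close> cells each. Rectangles of the widths \<open>j * \<eta>\<close> then
  correspond to leading blocks of the same matrix, which is what the concavity argument
  compares.\<close>

definition grid_h :: "real \<Rightarrow> nat \<Rightarrow> real" where "grid_h \<eta> q = \<eta> / real (Suc q)"
definition grid_w :: "real \<Rightarrow> nat \<Rightarrow> real" where "grid_w a q = (a - 1) / real (Suc q)"

definition grid_gram :: "real \<Rightarrow> real \<Rightarrow> nat \<Rightarrow> nat \<Rightarrow> nat \<Rightarrow> complex" where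
  "grid_gram a \<eta> q = mesh.gram (grid_h \<eta> q) (grid_w a q) (Suc q)"

definition grid_det :: "real \<Rightarrow> real \<Rightarrow> nat \<Rightarrow> nat \<Rightarrow> complex \<Rightarrow> complex" where
  "grid_det a \<eta> j q z = Determinant.det (Matrix.mat (j * Suc q * Suc q) (j * Suc q * Suc q)
     (\<lambda>(i, k). (if i = k then 1 else 0) + z * grid_gram a \<eta> q i k))"

lemma mesh_grid: "a > 1 \<Longrightarrow> \<eta> > 0 \<Longrightarrow> mesh a (grid_h \<eta> q) (grid_w a q) (Suc q)"
  by unfold_locales (auto simp: grid_h_def grid_w_def)

lemma grid_length: "real (j * Suc q) * grid_h \<eta> q = real j * \<eta>"
  unfolding grid_h_def of_nat_mult by (simp del: of_nat_Suc)

lemma grid_mesh_tendsto_0: "(\<lambda>q. grid_h \<eta> q) \<longlonglongrightarrow> 0" "(\<lambda>q. grid_w a q) \<longlonglongrightarrow> 0"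
proof -
  have "(\<lambda>q. c / real (Suc q)) \<longlonglongrightarrow> 0" for c :: real
    using LIMSEQ_Suc[OF lim_const_over_n[of c]] by simp
  then show "(\<lambda>q. grid_h \<eta> q) \<longlonglongrightarrow> 0" "(\<lambda>q. grid_w a q) \<longlonglongrightarrow> 0"
    unfolding grid_h_def grid_w_def by auto
qed

text \<open>Each coefficient \<open>e q k\<close> converges to the binomial moment
  \<open>F k\<close>, and the trace bound yields a geometric majorant uniform in \<open>q\<close>,
  so Tannery's theorem applies to the determinants. The same majorant permits summing the binomial
  series of \<open>(1 + z) ^ N\<close> under the expectation.\<close>

lemma grid_det_tendsto:
  fixes M :: "'w measure" and Z :: "'w \<Rightarrow> complex set"
  assumes dpp: "determinantal_point_process M upper_half_plane lborel K_H Z" and a: "a > 1"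
    and \<eta>: "\<eta> > 0" and j: "j > 0"
  shows "integrable M (\<lambda>\<omega>. (1 + z) ^ N Z a (real j * \<eta>) \<omega>)"
    and "(\<lambda>q. grid_det a \<eta> j q z) \<longlonglongrightarrow> (LINT \<omega>|M. (1 + z) ^ N Z a (real j * \<eta>) \<omega>)"
proof -
  define L where "L = real j * \<eta>"
  have L: "L > 0" using \<eta> j by (simp add: L_def)
  obtain F where F: "\<And>k. has_bochner_integral M (\<lambda>\<omega>. real (N Z a L \<omega> choose k)) (F k)"
    and approx: "\<And>k h w r m. mesh a h w r \<Longrightarrow> m > 0 \<Longrightarrow> real m * h = L \<Longrightarrow>
      cmod (of_real (fact k * F k) - (\<Sum>y\<in>{..<k} \<rightarrow>\<^sub>E {..<m * r}. Determinant.det (Matrix.mat k k (\<lambda>(i, j). mesh.gram h w r (y i) (y j)))))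
        \<le> fact k * (real k * (h + w)) * (L * (a - 1)) ^ k"
    by (rule factorial_moments[OF dpp a L]; rule that)
  define P where "P = (\<lambda>q (e :: nat \<Rightarrow> real).
    (\<forall>k. (\<Sum>y\<in>{..<k} \<rightarrow>\<^sub>E {..<j * Suc q * Suc q}. Determinant.det (Matrix.mat k k (\<lambda>(i, j). grid_gram a \<eta> q (y i) (y j)))) = of_real (fact k * e k))
    \<and> (\<forall>k. 0 \<le> e k) \<and> (\<forall>k s. 0 < s \<longrightarrow> e k * s ^ k \<le> exp (s * L)) \<and> (\<forall>k. j * Suc q * Suc q < k \<longrightarrow> e k = 0))"
  have "\<exists>e. P q e" for q
  proof -
    interpret mesh a "grid_h \<eta> q" "grid_w a q" "Suc q" by (rule mesh_grid[OF a \<eta>])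
    show ?thesis unfolding P_def
      by (rule tuple_sums_eq_elementary_symmetric[of "j * Suc q"])
        (unfold grid_length L_def[symmetric] grid_gram_def, blast)
  qed
  then obtain e :: "nat \<Rightarrow> nat \<Rightarrow> real" where
    e: "\<And>q k. (\<Sum>y\<in>{..<k} \<rightarrow>\<^sub>E {..<j * Suc q * Suc q}. Determinant.det (Matrix.mat k k (\<lambda>(i, j). grid_gram a \<eta> q (y i) (y j)))) = of_real (fact k * e q k)"
    and e0: "\<And>q k. 0 \<le> e q k" and eb: "\<And>q k s. 0 < s \<Longrightarrow> e q k * s ^ k \<le> exp (s * L)"
    and ez: "\<And>q k. j * Suc q * Suc q < k \<Longrightarrow> e q k = 0"
  proof -
    from \<open>\<And>q. \<exists>e. P q e\<close> obtain e where "\<And>q. P q (e q)" by metis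
    then show ?thesis using that[of e] unfolding P_def by blast
  qed
  have e_lim: "(\<lambda>q. e q k) \<longlonglongrightarrow> F k" for k
  proof -
    have b: "\<bar>e q k - F k\<bar> \<le> (real k * (grid_h \<eta> q + grid_w a q)) * (L * (a - 1)) ^ k" for q
    proof -
      have "cmod (of_real (fact k * F k) - of_real (fact k * e q k)) \<le> fact k * (real k * (grid_h \<eta> q + grid_w a q)) * (L * (a - 1)) ^ k"
        using approx[OF mesh_grid[OF a \<eta>, of q], of "j * Suc q" k] j
        unfolding grid_length L_def[symmetric] grid_gram_def[symmetric] e by simp
      also have "cmod (of_real (fact k * F k) - of_real (fact k * e q k)) = \<bar>fact k * (F k - e q k)\<bar>"
        by (simp only: of_real_diff[symmetric] norm_of_real right_diff_distrib)
      also have "\<dots> = fact k * \<bar>e q k - F k\<bar>" by (simp add: abs_mult abs_minus_commute)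
      finally show ?thesis by (simp add: mult.assoc)
    qed
    have "(\<lambda>q. (real k * (grid_h \<eta> q + grid_w a q)) * (L * (a - 1)) ^ k) \<longlonglongrightarrow> (real k * (0 + 0)) * (L * (a - 1)) ^ k"
      by (intro tendsto_intros grid_mesh_tendsto_0)
    then have "(\<lambda>q. e q k - F k) \<longlonglongrightarrow> 0"
      by (intro Lim_null_comparison[of "\<lambda>q. e q k - F k"]) (use b in auto)
    then show ?thesis by (simp add: LIM_zero_iff)
  qed
  have F0: "0 \<le> F k" for k by (rule tendsto_lowerbound[OF e_lim]) (use e0 in auto)
  have Fb: "F k * s ^ k \<le> exp (s * L)" if "s > 0" for k s
    by (rule tendsto_upperbound[OF tendsto_mult_right[OF e_lim]]) (use eb[OF that] in auto)
  \<comment> \<open>A positive number larger than \<open>cmod z\<close>, so that the majorant has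
    ratio below 1; the summand 1 covers \<open>z = 0\<close>.\<close>
  define s where "s = 2 * cmod z + 1"
  have s: "s > 0" "cmod z / s < 1" by (auto simp: s_def add_nonneg_pos divide_less_eq)
  define Mb where "Mb = (\<lambda>k. exp (s * L) * (cmod z / s) ^ k)"
  have Mb: "summable Mb" unfolding Mb_def by (intro summable_mult summable_geometric) (use s in simp)
  have Mbound: "cmod (z ^ k * of_real x) \<le> Mb k" if "x * s ^ k \<le> exp (s * L)" "0 \<le> x" for x k
  proof -
    have "x \<le> exp (s * L) / s ^ k" using that s by (simp add: le_divide_eq)
    then have "cmod z ^ k * x \<le> cmod z ^ k * (exp (s * L) / s ^ k)" by (intro mult_left_mono) auto
    then show ?thesis using that by (simp add: Mb_def norm_mult norm_power power_divide mult_ac)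
  qed
  have det: "grid_det a \<eta> j q z = (\<Sum>k. z ^ k * of_real (e q k))" for q
  proof -
    have "grid_det a \<eta> j q z = (\<Sum>k\<le>j * Suc q * Suc q. z ^ k / fact k * of_real (fact k * e q k))"
      unfolding grid_det_def det_one_plus_eq_sum_tuples e ..
    also have "\<dots> = (\<Sum>k\<le>j * Suc q * Suc q. z ^ k * of_real (e q k))"
      by (rule sum.cong[OF refl]) simp
    also have "\<dots> = (\<Sum>k. z ^ k * of_real (e q k))"
      by (rule suminf_finite[symmetric]) (use ez in auto)
    finally show ?thesis .
  qed
  have lim: "(\<lambda>q. grid_det a \<eta> j q z) \<longlonglongrightarrow> (\<Sum>k. z ^ k * of_real (F k))"
  proof -
    have "\<forall>\<^sub>F (k, q) in at_top \<times>\<^sub>F sequentially. norm (z ^ k * of_real (e q k)) \<le> Mb k"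
      using Mbound[OF eb[OF s(1)] e0] by (intro always_eventually) auto
    moreover have "(\<lambda>q. z ^ k * complex_of_real (e q k)) \<longlonglongrightarrow> z ^ k * of_real (F k)" for k
      by (intro tendsto_intros e_lim)
    ultimately show ?thesis
      unfolding det using tannerys_theorem[of "\<lambda>k q. z ^ k * complex_of_real (e q k)" "\<lambda>k. z ^ k * of_real (F k)" sequentially Mb] Mb
      by simp
  qed
  define f where "f = (\<lambda>k \<omega>. z ^ k * complex_of_real (real (N Z a L \<omega> choose k)))"
  have f: "has_bochner_integral M (f k) (z ^ k * of_real (F k))" for k
    unfolding f_def by (intro has_bochner_integral_mult_right has_bochner_integral_of_real F)
  have fsum: "(\<lambda>k. f k \<omega>) sums (1 + z) ^ N Z a L \<omega>" for \<omega>
  proof -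
    have "(\<Sum>k. f k \<omega>) = (\<Sum>k\<le>N Z a L \<omega>. f k \<omega>)" "summable (\<lambda>k. f k \<omega>)"
      by (rule suminf_finite, auto simp: f_def intro!: summable_finite[of "{..N Z a L \<omega>}"])
    moreover have "(\<Sum>k\<le>N Z a L \<omega>. f k \<omega>) = (1 + z) ^ N Z a L \<omega>"
      unfolding f_def binomial_ring[of z 1, unfolded add.commute[of z]] by (simp add: mult.commute)
    ultimately show ?thesis by (metis summable_sums)
  qed
  have fn: "(\<lambda>k. norm (f k \<omega>)) = (\<lambda>k. cmod z ^ k * real (N Z a L \<omega> choose k))" for \<omega>
    by (simp add: f_def norm_mult norm_power)
  have fnint: "(LINT \<omega>|M. norm (f k \<omega>)) = cmod z ^ k * F k" for k
    using has_bochner_integral_mult_right[OF F[of k], of "cmod z ^ k"]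
    by (simp add: f_def norm_mult norm_power has_bochner_integral_iff)
  have s1: "AE \<omega> in M. summable (\<lambda>k. norm (f k \<omega>))"
  proof (rule AE_I2)
    fix \<omega>
    show "summable (\<lambda>k. norm (f k \<omega>))"
      unfolding fn by (rule summable_finite[of "{..N Z a L \<omega>}"]) auto
  qed
  have s2: "summable (\<lambda>k. LINT \<omega>|M. norm (f k \<omega>))"
    unfolding fnint
  proof (rule summable_comparison_test'[OF Mb, of 0])
    fix k show "norm (cmod z ^ k * F k) \<le> Mb k"
      using Mbound[OF Fb[OF s(1)] F0, of k] F0[of k] by (simp add: norm_mult norm_power)
  qed
  have fi: "integrable M (f k)" for k using f[of k] by (simp add: has_bochner_integral_iff)
  have eq: "(\<lambda>\<omega>. \<Sum>k. f k \<omega>) = (\<lambda>\<omega>. (1 + z) ^ N Z a L \<omega>)"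
    using fsum by (auto simp: sums_iff)
  have "integrable M (\<lambda>\<omega>. \<Sum>k. f k \<omega>)" by (rule integrable_suminf[OF fi s1 s2])
  then show "integrable M (\<lambda>\<omega>. (1 + z) ^ N Z a (real j * \<eta>) \<omega>)" unfolding eq L_def .
  have "(LINT \<omega>|M. (\<Sum>k. f k \<omega>)) = (\<Sum>k. (LINT \<omega>|M. f k \<omega>))" by (rule integral_suminf[OF fi s1 s2])
  also have "\<dots> = (\<Sum>k. z ^ k * of_real (F k))" using f by (simp add: has_bochner_integral_iff)
  finally show "(\<lambda>q. grid_det a \<eta> j q z) \<longlonglongrightarrow> (LINT \<omega>|M. (1 + z) ^ N Z a (real j * \<eta>) \<omega>)"
    using lim unfolding eq L_def by simp
qed

subsection \<open>The logarithm on the strip\<close>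

definition strip_log :: "complex \<Rightarrow> real \<Rightarrow> complex" where
  "strip_log \<theta> p = Ln (1 + (exp \<theta> - 1) * of_real p)"

lemma S_pi_open: "open S_pi" and S_pi_convex: "convex S_pi" and zero_in_S_pi: "0 \<in> S_pi"
proof -
  have eq: "S_pi = {\<theta>. Im \<theta> < pi} \<inter> {\<theta>. - pi < Im \<theta>}" by (auto simp: S_pi_def abs_less_iff)
  show "open S_pi" unfolding eq by (intro open_Int open_Collect_less continuous_intros)
  show "convex S_pi" unfolding eq by (intro convex_Int convex_halfspace_Im_lt convex_halfspace_Im_gt)
  show "0 \<in> S_pi" by (simp add: S_pi_def)
qed

text \<open>For \<open>p\<close> from 0 to 1 these points fill the segment from 1 to
  \<open>exp \<theta>\<close>. It can meet the nonpositive axis only if it is contained in the real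
  line, which in the strip forces \<open>\<theta>\<close> to be real and both endpoints to be
  positive. Hence the principal logarithm is the continued branch.\<close>

lemma strip_nonpos:
  assumes "\<theta> \<in> S_pi" "0 \<le> p" "p \<le> 1"
  shows "1 + (exp \<theta> - 1) * of_real p \<notin> \<real>\<^sub>\<le>\<^sub>0"
proof
  assume "1 + (exp \<theta> - 1) * of_real p \<in> \<real>\<^sub>\<le>\<^sub>0"
  then have Re: "1 + (exp (Re \<theta>) * cos (Im \<theta>) - 1) * p \<le> 0" and Im: "exp (Re \<theta>) * sin (Im \<theta>) * p = 0"
    by (auto simp: complex_nonpos_Reals_iff Re_exp Im_exp)
  have "p \<noteq> 0" using Re by auto
  then have "sin (Im \<theta>) = 0" using Im by simp
  then have "Im \<theta> = 0" using assms(1) sin_eq_0_pi[of "Im \<theta>"] by (auto simp: S_pi_def abs_less_iff)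
  then have "1 + (exp (Re \<theta>) * cos (Im \<theta>) - 1) * p = (1 - p) + exp (Re \<theta>) * p" by (simp add: algebra_simps)
  moreover have "(1 - p) + exp (Re \<theta>) * p > 0" using assms \<open>p \<noteq> 0\<close> by (intro add_nonneg_pos) auto
  ultimately show False using Re by linarith
qed

lemma exp_strip_log:
  assumes "\<theta> \<in> S_pi" "0 \<le> p" "p \<le> 1"
  shows "exp (strip_log \<theta> p) = 1 + (exp \<theta> - 1) * of_real p"
proof -
  have "1 + (exp \<theta> - 1) * of_real p \<noteq> 0" using strip_nonpos[OF assms] by (metis nonpos_Reals_zero_I)
  then show ?thesis using assms by (simp add: strip_log_def)
qed

lemma strip_log_holomorphic:
  assumes "0 \<le> p" "p \<le> 1"
  shows "(\<lambda>\<theta>. strip_log \<theta> p) holomorphic_on S_pi"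
  unfolding strip_log_def by (intro holomorphic_intros) (use strip_nonpos assms in auto)

lemma strip_log_0: "strip_log 0 p = 0"
  by (simp add: strip_log_def)

lemma strip_log_measurable: "strip_log \<theta> \<in> borel_measurable borel"
  unfolding strip_log_def[abs_def] by measurable

lemma strip_log_real:
  assumes "\<theta> \<in> \<real>" "0 \<le> p" "p \<le> 1"
  shows "strip_log \<theta> p \<in> \<real>"
proof -
  obtain x where x: "\<theta> = of_real x" using assms(1) Reals_cases by blast
  have "\<theta> \<in> S_pi" by (simp add: x S_pi_def)
  from strip_nonpos[OF this assms(2,3)] have "1 + (exp \<theta> - 1) * of_real p \<notin> \<real>\<^sub>\<le>\<^sub>0" .
  moreover have e: "1 + (exp \<theta> - 1) * of_real p = of_real (1 + (exp x - 1) * p)" by (simp add: x exp_of_real)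
  ultimately have "1 + (exp x - 1) * p > 0" unfolding complex_nonpos_Reals_iff by auto
  then have "Ln (of_real (1 + (exp x - 1) * p)) = of_real (ln (1 + (exp x - 1) * p))" by (rule Ln_of_real)
  then show ?thesis unfolding strip_log_def e by simp
qed

text \<open>On a compact set \<open>1 + (exp \<theta> - 1) * p\<close> keeps a distance
  \<open>\<delta>\<close> from 0 and \<open>exp \<theta> - 1\<close> is bounded by \<open>R\<close>,
  so the second derivative in \<open>p\<close> is at most
  \<open>R\<^sup>2 / \<delta>\<^sup>2\<close>. The bound linear in \<open>p\<close> makes sums over
  eigenvalues controllable by the trace.\<close>

lemma strip_log_bounds:
  assumes K: "compact K" "K \<subseteq> S_pi"
  obtains B where "B \<ge> 0"
    "\<And>\<theta>. \<theta> \<in> K \<Longrightarrow> quadratic_taylor B (strip_log \<theta>) (\<lambda>p. (exp \<theta> - 1) / (1 + (exp \<theta> - 1) * of_real p))"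
    "\<And>\<theta> p. \<theta> \<in> K \<Longrightarrow> 0 \<le> p \<Longrightarrow> p \<le> 1 \<Longrightarrow> cmod (strip_log \<theta> p) \<le> B * p"
proof -
  \<comment> \<open>The point 0 makes the set nonempty, so that the minimum of \<open>m\<close> is
    attained.\<close>
  define K' where "K' = insert 0 K"
  have K': "compact K'" "K' \<subseteq> S_pi" "K' \<noteq> {}" using K zero_in_S_pi by (auto simp: K'_def)
  define m where "m = (\<lambda>y :: complex \<times> real. cmod (1 + (exp (fst y) - 1) * of_real (snd y)))"
  have cont: "continuous_on (K' \<times> {0..1}) m" unfolding m_def by (intro continuous_intros)
  have comp: "compact (K' \<times> {0..1::real})" using K' by (intro compact_Times) auto
  obtain y0 where y0: "y0 \<in> K' \<times> {0..1}" "\<And>y. y \<in> K' \<times> {0..1} \<Longrightarrow> m y0 \<le> m y"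
    using continuous_attains_inf[OF comp _ cont] K'(3) by auto
  define \<delta> where "\<delta> = m y0"
  have \<delta>: "\<delta> > 0"
  proof -
    have "1 + (exp (fst y0) - 1) * of_real (snd y0) \<notin> \<real>\<^sub>\<le>\<^sub>0" using y0(1) K'(2) by (intro strip_nonpos) auto
    then have "1 + (exp (fst y0) - 1) * of_real (snd y0) \<noteq> 0" by (metis nonpos_Reals_zero_I)
    then show ?thesis by (simp add: \<delta>_def m_def)
  qed
  have low: "\<delta> \<le> cmod (1 + (exp \<theta> - 1) * of_real p)" if "\<theta> \<in> K" "0 \<le> p" "p \<le> 1" for \<theta> p
    using y0(2)[of "(\<theta>, p)"] that by (simp add: \<delta>_def m_def K'_def)
  have "compact ((\<lambda>\<theta>. exp \<theta> - 1) ` K)" by (intro compact_continuous_image continuous_intros K)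
  then obtain R where R: "R > 0" "\<And>\<theta>. \<theta> \<in> K \<Longrightarrow> cmod (exp \<theta> - 1) \<le> R"
    using bounded_pos[of "(\<lambda>\<theta>. exp \<theta> - 1) ` K"] compact_imp_bounded by auto
  define B0 where "B0 = R\<^sup>2 / \<delta>\<^sup>2"
  have B0: "0 \<le> B0" by (simp add: B0_def)
  have taylor: "cmod (strip_log \<theta> x - strip_log \<theta> y - (exp \<theta> - 1) / (1 + (exp \<theta> - 1) * of_real y) * of_real (x - y)) \<le> B0 * (x - y)\<^sup>2"
    if \<theta>: "\<theta> \<in> K" and x: "0 \<le> x" "x \<le> 1" and y: "0 \<le> y" "y \<le> 1" for \<theta> x y
  proof -
    define z where "z = exp \<theta> - 1"
    define S where "S = closed_segment (0::complex) 1"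
    have S: "p \<in> S \<Longrightarrow> \<exists>t. p = complex_of_real t \<and> 0 \<le> t \<and> t \<le> 1" for p
      by (auto simp: S_def closed_segment_def scaleR_conv_of_real)
    have inS: "complex_of_real t \<in> S" if "0 \<le> t" "t \<le> 1" for t
      unfolding S_def closed_segment_def using that by (auto simp: scaleR_conv_of_real intro!: exI[of _ t])
    define g where "g = (\<lambda>(i::nat) p. if i = 0 then Ln (1 + z * p) else if i = 1 then z / (1 + z * p) else - z\<^sup>2 / (1 + z * p)\<^sup>2)"
    have nz: "1 + z * p \<notin> \<real>\<^sub>\<le>\<^sub>0" "1 + z * p \<noteq> 0" "\<delta> \<le> cmod (1 + z * p)" if p: "p \<in> S" for p
    proof -
      obtain t where t: "p = complex_of_real t" "0 \<le> t" "t \<le> 1" using S[OF p] by blast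
      show "1 + z * p \<notin> \<real>\<^sub>\<le>\<^sub>0" unfolding t z_def using \<theta> K t by (intro strip_nonpos) auto
      then show "1 + z * p \<noteq> 0" by (metis nonpos_Reals_zero_I)
      show "\<delta> \<le> cmod (1 + z * p)" unfolding t z_def using low[OF \<theta>] t by auto
    qed
    have "cmod (g 0 (of_real x) - (\<Sum>i\<le>1. g i (of_real y) * (of_real x - of_real y) ^ i / fact i)) \<le> B0 * cmod (of_real x - of_real y) ^ Suc 1 / fact 1"
    proof (rule complex_Taylor)
      show "convex S" by (simp add: S_def)
      fix i p assume p: "p \<in> S" and i: "i \<le> (1::nat)"
      show "(g i has_field_derivative g (Suc i) p) (at p within S)"
      proof (cases "i = 0")
        case True
        have "((\<lambda>p. Ln (1 + z * p)) has_field_derivative z / (1 + z * p)) (at p within S)"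
          using nz[OF p] by (auto intro!: derivative_eq_intros simp: divide_inverse)
        then show ?thesis by (simp add: g_def True)
      next
        case False
        then have i1: "i = 1" using i by simp
        have "((\<lambda>p. z / (1 + z * p)) has_field_derivative - z\<^sup>2 / (1 + z * p)\<^sup>2) (at p within S)"
          using nz[OF p] by (auto intro!: derivative_eq_intros simp: power2_eq_square)
        then show ?thesis by (simp add: g_def i1)
      qed
    next
      fix p assume p: "p \<in> S"
      have "(cmod z)\<^sup>2 / (cmod (1 + z * p))\<^sup>2 \<le> R\<^sup>2 / \<delta>\<^sup>2"
        using nz(3)[OF p] \<delta> R(2)[OF \<theta>] by (intro frac_le power_mono) (auto simp: z_def)
      then show "cmod (g (Suc 1) p) \<le> B0" by (simp add: g_def B0_def norm_divide norm_power)
    qed (use inS x y in auto)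
    then show ?thesis using x y
      by (simp add: g_def strip_log_def z_def norm_power algebra_simps power2_eq_square flip: of_real_diff)
  qed
  define B where "B = R + B0"
  have B: "B \<ge> 0" "B0 \<le> B" using R B0 by (auto simp: B_def)
  show ?thesis
  proof (rule that[OF B(1)])
    fix \<theta> assume \<theta>: "\<theta> \<in> K"
    have 0: "strip_log \<theta> 0 = 0" by (simp add: strip_log_def)
    show "quadratic_taylor B (strip_log \<theta>) (\<lambda>p. (exp \<theta> - 1) / (1 + (exp \<theta> - 1) * of_real p))"
      unfolding quadratic_taylor_def
    proof (intro conjI ballI 0)
      show "strip_log \<theta> \<in> borel_measurable borel" by (rule strip_log_measurable)
      fix x y :: real assume "x \<in> {0..1}" "y \<in> {0..1}"
      then have "cmod (strip_log \<theta> x - strip_log \<theta> y - (exp \<theta> - 1) / (1 + (exp \<theta> - 1) * of_real y) * of_real (x - y)) \<le> B0 * (x - y)\<^sup>2"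
        using taylor[OF \<theta>] by auto
      also have "\<dots> \<le> B * (x - y)\<^sup>2" using B by (intro mult_right_mono) auto
      finally show "cmod (strip_log \<theta> x - strip_log \<theta> y - (exp \<theta> - 1) / (1 + (exp \<theta> - 1) * of_real y) * of_real (x - y)) \<le> B * (x - y)\<^sup>2" .
    qed
    fix p :: real assume p: "0 \<le> p" "p \<le> 1"
    have "cmod (strip_log \<theta> p) \<le> cmod (strip_log \<theta> p - (exp \<theta> - 1) * of_real p) + cmod ((exp \<theta> - 1) * of_real p)"
      by norm
    also have "\<dots> \<le> B0 * p\<^sup>2 + R * p"
      using taylor[OF \<theta> p, of 0] R(2)[OF \<theta>] p 0 by (intro add_mono) (auto simp: norm_mult intro: mult_right_mono)
    also have "\<dots> \<le> B0 * p + R * p"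
      using p B0 R(1) by (intro add_mono mult_left_mono) (auto simp: power2_eq_square mult_left_le)
    finally show "cmod (strip_log \<theta> p) \<le> B * p" by (simp add: B_def algebra_simps)
  qed
qed

lemma strip_symbol_bounds: "a > 1 \<Longrightarrow> 0 \<le> \<xi> \<Longrightarrow> 0 \<le> strip_symbol a \<xi> \<and> strip_symbol a \<xi> \<le> 1"
  using strip_symbol_pos[of a \<xi>] strip_symbol_less_1[of \<xi> a] by (cases "\<xi> = 0") (auto simp: strip_symbol_def[of a 0])

text \<open>\<open>strip_log\<close> is a holomorphic logarithm vanishing at 0, and uniqueness on
  the connected strip identifies it with the branch in the definition.\<close>

lemma Lambda_eq:
  assumes a: "a > 1" and \<theta>: "\<theta> \<in> S_pi"
  shows "Lambda a \<theta> = 1 / (2 * of_real pi) * (LINT \<xi>|half_line. strip_log \<theta> (strip_symbol a \<xi>))"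
proof -
  have "(LBINT \<xi>:{0..}. holomorphic_log S_pi 0 (\<lambda>t. 1 + (exp t - 1) * of_real (exp (- 2 * \<xi>) - exp (- 2 * a * \<xi>))) \<theta>)
    = (LBINT \<xi>:{0..}. strip_log \<theta> (strip_symbol a \<xi>))"
  proof (rule set_lebesgue_integral_cong)
    show "\<forall>\<xi>. \<xi> \<in> {0..} \<longrightarrow> holomorphic_log S_pi 0 (\<lambda>t. 1 + (exp t - 1) * of_real (exp (- 2 * \<xi>) - exp (- 2 * a * \<xi>))) \<theta> = strip_log \<theta> (strip_symbol a \<xi>)"
    proof (intro allI impI)
      fix \<xi> :: real assume "\<xi> \<in> {0..}"
      then have b: "0 \<le> strip_symbol a \<xi>" "strip_symbol a \<xi> \<le> 1" using strip_symbol_bounds[OF a] by auto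
      show "holomorphic_log S_pi 0 (\<lambda>t. 1 + (exp t - 1) * of_real (exp (- 2 * \<xi>) - exp (- 2 * a * \<xi>))) \<theta> = strip_log \<theta> (strip_symbol a \<xi>)"
      proof (rule holomorphic_log_eq[OF S_pi_open convex_connected[OF S_pi_convex] zero_in_S_pi _ \<theta>])
        show "is_holomorphic_log S_pi 0 (\<lambda>t. 1 + (exp t - 1) * of_real (exp (- 2 * \<xi>) - exp (- 2 * a * \<xi>))) (\<lambda>\<theta>. strip_log \<theta> (strip_symbol a \<xi>))"
          unfolding is_holomorphic_log_def
          using strip_log_holomorphic[OF b] strip_log_0 exp_strip_log[OF _ b] by (simp add: strip_symbol_def)
      qed
    qed
  qed simp
  also have "\<dots> = (LINT \<xi>|half_line. strip_log \<theta> (strip_symbol a \<xi>))"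
  proof (rule half_line_closed(2)[symmetric])
    have "strip_symbol a \<in> borel_measurable borel" unfolding strip_symbol_def[abs_def] by measurable
    then show "(\<lambda>\<xi>. strip_log \<theta> (strip_symbol a \<xi>)) \<in> borel_measurable borel"
      using strip_log_measurable by (rule measurable_compose)
  qed
  finally show ?thesis unfolding Lambda_def by (rule arg_cong)
qed

text \<open>In the form given by \<open>eq\<close> the horizontal factor tends to 1, and the
  vertical factor is \<open>tanh (v / 2) / v\<close> with \<open>v = \<xi> * grid_w a q\<close>,
  which tends to \<open>1 / 2\<close>.\<close>

lemma mode_density_tendsto:
  assumes a: "a > 1" and \<eta>: "\<eta> > 0" and \<xi>: "\<xi> > 0"
  shows "(\<lambda>q. mesh.mode_density (grid_h \<eta> q) (grid_w a q) (j * Suc q) \<xi>) \<longlonglongrightarrow> real j * \<eta> / (2 * pi)"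
proof -
  have h: "filterlim (\<lambda>q. grid_h \<eta> q) (at_right 0) sequentially" and w: "filterlim (\<lambda>q. grid_w a q) (at_right 0) sequentially"
    using grid_mesh_tendsto_0 a \<eta> by (auto simp: filterlim_at grid_h_def grid_w_def)
  have "((\<lambda>h. (2 - 2 * cos (h * \<xi>)) / (h\<^sup>2 * \<xi>\<^sup>2)) \<longlongrightarrow> 1) (at_right 0)"
    using \<xi> by (real_asymp simp: field_simps power2_eq_square)
  from filterlim_compose[OF this h]
  have 1: "(\<lambda>q. (2 - 2 * cos (grid_h \<eta> q * \<xi>)) / ((grid_h \<eta> q)\<^sup>2 * \<xi>\<^sup>2)) \<longlonglongrightarrow> 1" .
  have "((\<lambda>w. (1 - exp (- \<xi> * w)) / (w * \<xi> * (1 + exp (- \<xi> * w)))) \<longlongrightarrow> 1 / 2) (at_right 0)"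
    using \<xi> by real_asymp
  from filterlim_compose[OF this w]
  have 2: "(\<lambda>q. (1 - exp (- \<xi> * grid_w a q)) / (grid_w a q * \<xi> * (1 + exp (- \<xi> * grid_w a q)))) \<longlonglongrightarrow> 1 / 2" .
  have eq: "mesh.mode_density (grid_h \<eta> q) (grid_w a q) (j * Suc q) \<xi>
    = real j * \<eta> / pi * ((2 - 2 * cos (grid_h \<eta> q * \<xi>)) / ((grid_h \<eta> q)\<^sup>2 * \<xi>\<^sup>2))
      * ((1 - exp (- \<xi> * grid_w a q)) / (grid_w a q * \<xi> * (1 + exp (- \<xi> * grid_w a q))))" for q
  proof -
    interpret mesh a "grid_h \<eta> q" "grid_w a q" "Suc q" by (rule mesh_grid[OF a \<eta>])
    have n: "real (j * Suc q) = real j * \<eta> / grid_h \<eta> q"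
      using grid_length[of j q \<eta>] mesh.h[OF mesh_axioms] by (simp add: field_simps)
    have "mode_density (j * Suc q) \<xi> = real (j * Suc q) * (\<xi> / pi) * fejer \<xi> * ((1 - exp (- \<xi> * grid_w a q)) / (grid_w a q * \<xi>\<^sup>2 * (1 + exp (- \<xi> * grid_w a q))))"
      by (rule mode_density_def)
    also have "\<dots> = real j * \<eta> / grid_h \<eta> q * (\<xi> / pi) * ((2 - 2 * cos (grid_h \<eta> q * \<xi>)) / (grid_h \<eta> q * \<xi>\<^sup>2))
        * ((1 - exp (- \<xi> * grid_w a q)) / (grid_w a q * \<xi>\<^sup>2 * (1 + exp (- \<xi> * grid_w a q))))"
      unfolding n fejer_def ..
    also have "\<dots> = real j * \<eta> / pi * ((2 - 2 * cos (grid_h \<eta> q * \<xi>)) / ((grid_h \<eta> q)\<^sup>2 * \<xi>\<^sup>2))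
      * ((1 - exp (- \<xi> * grid_w a q)) / (grid_w a q * \<xi> * (1 + exp (- \<xi> * grid_w a q))))"
      using \<xi> by (simp add: power2_eq_square mult_ac)
    finally show ?thesis .
  qed
  have "(\<lambda>q. real j * \<eta> / pi * ((2 - 2 * cos (grid_h \<eta> q * \<xi>)) / ((grid_h \<eta> q)\<^sup>2 * \<xi>\<^sup>2))
      * ((1 - exp (- \<xi> * grid_w a q)) / (grid_w a q * \<xi> * (1 + exp (- \<xi> * grid_w a q))))) \<longlonglongrightarrow> real j * \<eta> / pi * 1 * (1 / 2)"
    by (intro tendsto_mult tendsto_const 1 2)
  then show ?thesis unfolding eq by (simp add: field_simps)
qed

text \<open>For each mesh the sum of \<open>strip_log\<close> over the eigenvalues is a logarithm of
  the determinant. Montel's theorem extracts a convergent subsequence whose limit is a holomorphic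
  logarithm of the expectation, real on the real axis. The Taylor estimate passes to the limit for
  fixed \<open>L\<close>; each \<open>\<theta>\<close> may bring its own \<open>B\<close>, so
  uniformity is left to the choice of \<open>B\<close>.\<close>

lemma log_mgf_bound_grid:
  fixes M :: "'w measure" and Z :: "'w \<Rightarrow> complex set"
  assumes dpp: "determinantal_point_process M upper_half_plane lborel K_H Z" and a: "a > 1"
    and \<eta>: "\<eta> > 0" and j: "j > 0" and L: "L = real j * \<eta>"
  obtains g where "is_holomorphic_log S_pi 0 (\<lambda>\<theta>. LINT \<omega>|M. exp (\<theta> * of_nat (N Z a L \<omega>))) g"
    "\<And>\<theta>. \<theta> \<in> \<real> \<Longrightarrow> g \<theta> \<in> \<real>"
    "\<And>\<theta> B. \<theta> \<in> S_pi \<Longrightarrow> B \<ge> 0 \<Longrightarrow>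
      quadratic_taylor B (strip_log \<theta>) (\<lambda>p. (exp \<theta> - 1) / (1 + (exp \<theta> - 1) * of_real p)) \<Longrightarrow>
      (\<And>p. 0 \<le> p \<Longrightarrow> p \<le> 1 \<Longrightarrow> cmod (strip_log \<theta> p) \<le> B * p) \<Longrightarrow>
      cmod (g \<theta> - of_real L * Lambda a \<theta>) \<le> B * (2 * (a - 1)\<^sup>2)"
proof -
  let ?s = "strip_symbol a"
  let ?R = "\<lambda>q. mesh.mode_density (grid_h \<eta> q) (grid_w a q) (j * Suc q)"
  let ?N = "\<lambda>q. j * Suc q * Suc q"
  let ?V = "\<lambda>q. (a - 1)\<^sup>2 * (2 * (grid_h \<eta> q + 1) + L * grid_h \<eta> q / 16) + 2 * (grid_h \<eta> q + grid_w a q) * (L * (a - 1))\<^sup>2"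
  have L0: "L > 0" using \<eta> j by (simp add: L)
  define P where "P = (\<lambda>q (l :: nat \<Rightarrow> real). (\<forall>p<?N q. 0 \<le> l p \<and> l p \<le> 1)
    \<and> (\<forall>z. grid_det a \<eta> j q z = (\<Prod>p<?N q. 1 + z * of_real (l p))) \<and> (\<Sum>p<?N q. l p) \<le> L
    \<and> (\<forall>f f1 B. B \<ge> 0 \<longrightarrow> quadratic_taylor B f f1 \<longrightarrow>
        cmod ((\<Sum>p<?N q. f (l p)) - (LINT \<xi>|half_line. f (?s \<xi>) * of_real (?R q \<xi>))) \<le> B * ?V q))"
  have "\<exists>l. P q l" for q
  proof -
    interpret mesh a "grid_h \<eta> q" "grid_w a q" "Suc q" by (rule mesh_grid[OF a \<eta>])
    obtain l where l: "\<And>p. p < ?N q \<Longrightarrow> 0 \<le> l p \<and> l p \<le> 1"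
      "\<And>z. Determinant.det (Matrix.mat (?N q) (?N q) (\<lambda>(i, k). (if i = k then 1 else 0) + z * gram i k)) = (\<Prod>p<?N q. 1 + z * of_real (l p))"
      "(\<Sum>p<?N q. l p) = (LINT \<xi>|half_line. ?s \<xi> * mode_density (j * Suc q) \<xi>)"
      "\<And>f f1 B. quadratic_taylor B f f1 \<Longrightarrow>
      cmod ((\<Sum>p<?N q. f (l p)) - (LINT \<xi>|half_line. f (?s \<xi>) * of_real (mode_density (j * Suc q) \<xi>)))
      \<le> B * ((LINT \<xi>|half_line. (?s \<xi>)\<^sup>2 * mode_density (j * Suc q) \<xi>) - (\<Sum>i<?N q. \<Sum>k<?N q. (cmod (gram i k))\<^sup>2))"
      by (rule gram_spectrum[of "j * Suc q"]; rule that)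
    have "P q l"
      unfolding P_def
    proof (intro conjI allI impI)
      show "0 \<le> l p" "l p \<le> 1" if "p < ?N q" for p using l(1)[OF that] by auto
      show "grid_det a \<eta> j q z = (\<Prod>p<?N q. 1 + z * of_real (l p))" for z
        unfolding grid_det_def grid_gram_def by (rule l(2))
      show "(\<Sum>p<?N q. l p) \<le> L"
        using trace_le[of "j * Suc q"] unfolding l(3)[symmetric] grid_length L[symmetric] .
      fix f f1 and B :: real assume B: "B \<ge> 0" and f: "quadratic_taylor B f f1"
      show "cmod ((\<Sum>p<?N q. f (l p)) - (LINT \<xi>|half_line. f (?s \<xi>) * of_real (mode_density (j * Suc q) \<xi>))) \<le> B * ?V q"
        using variance_defect_le[of "j * Suc q"] unfolding grid_length L[symmetric]
        by (intro order_trans[OF l(4)[OF f]] mult_left_mono B)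
    qed
    then show ?thesis by blast
  qed
  then obtain l where "\<And>q. P q (l q)" by metis
  then have l01: "\<And>q p. p < ?N q \<Longrightarrow> 0 \<le> l q p" "\<And>q p. p < ?N q \<Longrightarrow> l q p \<le> 1"
    and ldet: "\<And>q z. grid_det a \<eta> j q z = (\<Prod>p<?N q. 1 + z * of_real (l q p))"
    and ltr: "\<And>q. (\<Sum>p<?N q. l q p) \<le> L"
    and lf: "\<And>q f f1 B. B \<ge> 0 \<Longrightarrow> quadratic_taylor B f f1 \<Longrightarrow>
        cmod ((\<Sum>p<?N q. f (l q p)) - (LINT \<xi>|half_line. f (?s \<xi>) * of_real (?R q \<xi>))) \<le> B * ?V q"
    unfolding P_def by blast+
  define G where "G = (\<lambda>q \<theta>. \<Sum>p<?N q. strip_log \<theta> (l q p))"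
  obtain g \<sigma> where g: "g holomorphic_on S_pi" and \<sigma>: "strict_mono (\<sigma> :: nat \<Rightarrow> nat)"
    and lim: "\<And>\<theta>. \<theta> \<in> S_pi \<Longrightarrow> (\<lambda>q. G (\<sigma> q) \<theta>) \<longlonglongrightarrow> g \<theta>"
  proof (rule Montel[OF S_pi_open, of "range G" G])
    show "h holomorphic_on S_pi" if "h \<in> range G" for h
      using that l01 unfolding G_def by (auto intro!: holomorphic_on_sum strip_log_holomorphic)
    show "\<exists>B. \<forall>h\<in>range G. \<forall>z\<in>K. cmod (h z) \<le> B" if K: "compact K" "K \<subseteq> S_pi" for K
    proof -
      obtain B where B: "B \<ge> 0" "\<And>\<theta> p. \<theta> \<in> K \<Longrightarrow> 0 \<le> p \<Longrightarrow> p \<le> 1 \<Longrightarrow> cmod (strip_log \<theta> p) \<le> B * p"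
        by (rule strip_log_bounds[OF K]; rule that)
      have "cmod (G q \<theta>) \<le> B * L" if "\<theta> \<in> K" for q \<theta>
      proof -
        have "cmod (G q \<theta>) \<le> (\<Sum>p<?N q. B * l q p)"
          unfolding G_def by (rule order_trans[OF norm_sum sum_mono]) (use B(2)[OF that] l01 in auto)
        also have "\<dots> = B * (\<Sum>p<?N q. l q p)" by (rule sum_distrib_left[symmetric])
        also have "\<dots> \<le> B * L" using ltr B(1) by (rule mult_left_mono)
        finally show ?thesis .
      qed
      then show ?thesis by blast
    qed
  qed auto
  have sub: "filterlim \<sigma> sequentially sequentially" using \<sigma> by (rule filterlim_subseq)
  have Gexp: "exp (G q \<theta>) = grid_det a \<eta> j q (exp \<theta> - 1)" if "\<theta> \<in> S_pi" for q \<theta>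
    unfolding G_def ldet exp_sum[OF finite_lessThan] by (rule prod.cong[OF refl]) (use that l01 in \<open>auto intro!: exp_strip_log\<close>)
  show ?thesis
  proof (rule that[of g])
    have "exp (g \<theta>) = (LINT \<omega>|M. exp (\<theta> * of_nat (N Z a L \<omega>)))" if \<theta>: "\<theta> \<in> S_pi" for \<theta>
    proof -
      have "(\<lambda>q. exp (G (\<sigma> q) \<theta>)) \<longlonglongrightarrow> exp (g \<theta>)" by (intro tendsto_intros lim \<theta>)
      moreover have "(\<lambda>q. grid_det a \<eta> j (\<sigma> q) (exp \<theta> - 1)) \<longlonglongrightarrow> (LINT \<omega>|M. (1 + (exp \<theta> - 1)) ^ N Z a L \<omega>)"
        unfolding L by (rule filterlim_compose[OF grid_det_tendsto(2)[OF dpp a \<eta> j] sub])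
      ultimately have "exp (g \<theta>) = (LINT \<omega>|M. (1 + (exp \<theta> - 1)) ^ N Z a L \<omega>)"
        unfolding Gexp[OF \<theta>] by (rule LIMSEQ_unique)
      then show ?thesis by (simp add: exp_of_nat2_mult)
    qed
    moreover have "g 0 = 0"
    proof -
      have "G q 0 = 0" for q by (simp add: G_def strip_log_0)
      then show ?thesis using lim[OF zero_in_S_pi] by (simp add: LIMSEQ_const_iff)
    qed
    ultimately show "is_holomorphic_log S_pi 0 (\<lambda>\<theta>. LINT \<omega>|M. exp (\<theta> * of_nat (N Z a L \<omega>))) g"
      using g by (simp add: is_holomorphic_log_def)
    show "g \<theta> \<in> \<real>" if \<theta>: "\<theta> \<in> \<real>" for \<theta>
    proof -
      have S: "\<theta> \<in> S_pi" using \<theta> by (auto simp: S_pi_def complex_is_Real_iff)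
      have "G q \<theta> \<in> \<real>" for q unfolding G_def using l01 \<theta> by (intro sum_in_Reals strip_log_real) auto
      then show ?thesis using closed_complex_Reals lim[OF S] by (metis closed_sequentially)
    qed
    fix \<theta> B assume \<theta>: "\<theta> \<in> S_pi" and B: "B \<ge> 0"
      and ll: "quadratic_taylor B (strip_log \<theta>) (\<lambda>p. (exp \<theta> - 1) / (1 + (exp \<theta> - 1) * of_real p))"
      and lb: "\<And>p. 0 \<le> p \<Longrightarrow> p \<le> 1 \<Longrightarrow> cmod (strip_log \<theta> p) \<le> B * p"
    have ms: "(\<lambda>\<xi>. strip_log \<theta> (?s \<xi>)) \<in> borel_measurable half_line"
    proof (rule measurable_half_line)
      have "?s \<in> borel_measurable lborel" unfolding strip_symbol_def[abs_def] by measurable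
      then show "(\<lambda>\<xi>. strip_log \<theta> (?s \<xi>)) \<in> borel_measurable lborel"
        using strip_log_measurable by (rule measurable_compose)
    qed
    have I: "(\<lambda>q. LINT \<xi>|half_line. strip_log \<theta> (?s \<xi>) * of_real (?R q \<xi>)) \<longlonglongrightarrow> (LINT \<xi>|half_line. strip_log \<theta> (?s \<xi>) * of_real (L / (2 * pi)))"
    proof (rule integral_dominated_convergence[where w = "\<lambda>\<xi>. B * (L / (2 * pi)) * ?s \<xi>"])
      show "integrable half_line (\<lambda>\<xi>. B * (L / (2 * pi)) * ?s \<xi>)"
        by (intro integrable_mult_right strip_symbol_moments(1) a)
      show "AE \<xi> in half_line. (\<lambda>q. strip_log \<theta> (?s \<xi>) * of_real (?R q \<xi>)) \<longlonglongrightarrow> strip_log \<theta> (?s \<xi>) * of_real (L / (2 * pi))"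
        unfolding L by (intro AE_I2 tendsto_mult tendsto_const tendsto_of_real mode_density_tendsto a \<eta>) (simp add: space_restrict_space)
      show "AE \<xi> in half_line. cmod (strip_log \<theta> (?s \<xi>) * of_real (?R q \<xi>)) \<le> B * (L / (2 * pi)) * ?s \<xi>" for q
      proof (intro AE_I2)
        fix \<xi> assume "\<xi> \<in> space half_line"
        then have \<xi>: "\<xi> > 0" by (simp add: space_restrict_space)
        interpret mesh a "grid_h \<eta> q" "grid_w a q" "Suc q" by (rule mesh_grid[OF a \<eta>])
        have s: "0 \<le> ?s \<xi>" "?s \<xi> \<le> 1" using strip_symbol_bounds[OF a, of \<xi>] \<xi> by auto
        have R: "0 \<le> mode_density (j * Suc q) \<xi>" "mode_density (j * Suc q) \<xi> \<le> L / (2 * pi)"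
          using mode_density_bounds[OF \<xi>, of "j * Suc q"] unfolding grid_length L by auto
        have "cmod (strip_log \<theta> (?s \<xi>)) * mode_density (j * Suc q) \<xi> \<le> (B * ?s \<xi>) * (L / (2 * pi))"
          using lb[OF s] s R B by (intro mult_mono) auto
        then show "cmod (strip_log \<theta> (?s \<xi>) * of_real (mode_density (j * Suc q) \<xi>)) \<le> B * (L / (2 * pi)) * ?s \<xi>"
          using R by (simp add: norm_mult mult_ac)
      qed
      show "(\<lambda>\<xi>. strip_log \<theta> (?s \<xi>) * of_real (?R q \<xi>)) \<in> borel_measurable half_line" for q
      proof -
        have [measurable]: "?R q \<in> borel_measurable half_line"
          by (rule mesh.mode_density_measurable[OF mesh_grid[OF a \<eta>]])
        show ?thesis using ms by measurable
      qed
      show "(\<lambda>\<xi>. strip_log \<theta> (?s \<xi>) * of_real (L / (2 * pi))) \<in> borel_measurable half_line"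
        using ms by (intro borel_measurable_times) auto
    qed
    have IL: "(LINT \<xi>|half_line. strip_log \<theta> (?s \<xi>) * of_real (L / (2 * pi))) = of_real L * Lambda a \<theta>"
      unfolding Lambda_eq[OF a \<theta>] by simp
    \<comment> \<open>Every term that contains \<open>L\<close> carries a factor
      \<open>grid_h\<close> or \<open>grid_w\<close> and vanishes; the boundary term
      survives.\<close>
    have V: "(\<lambda>q. B * ?V q) \<longlonglongrightarrow> B * ((a - 1)\<^sup>2 * (2 * (0 + 1) + L * 0 / 16) + 2 * (0 + 0) * (L * (a - 1))\<^sup>2)"
      by (intro tendsto_intros grid_mesh_tendsto_0) auto
    have "(\<lambda>q. cmod (G (\<sigma> q) \<theta> - (LINT \<xi>|half_line. strip_log \<theta> (?s \<xi>) * of_real (?R (\<sigma> q) \<xi>)))) \<longlonglongrightarrow> cmod (g \<theta> - of_real L * Lambda a \<theta>)"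
      using I unfolding IL by (intro tendsto_norm tendsto_diff lim \<theta> filterlim_compose[OF I[unfolded IL] sub])
    moreover have "(\<lambda>q. B * ?V (\<sigma> q)) \<longlonglongrightarrow> B * (2 * (a - 1)\<^sup>2)"
      using filterlim_compose[OF V sub] by (simp add: mult_ac)
    moreover have "cmod (G q \<theta> - (LINT \<xi>|half_line. strip_log \<theta> (?s \<xi>) * of_real (?R q \<xi>))) \<le> B * ?V q" for q
      unfolding G_def by (rule lf[OF B ll])
    ultimately show "cmod (g \<theta> - of_real L * Lambda a \<theta>) \<le> B * (2 * (a - 1)\<^sup>2)"
      by (intro LIMSEQ_le) auto
  qed
qed

subsection \<open>Convergence\<close>

text \<open>Along any sequence tending to infinity Montel's theorem gives a locally uniformly
  convergent subsequence, and the identity theorem fixes its limit by the values on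
  \<open>T\<close>. Were uniform convergence to fail on some \<open>K\<close>, a sequence witnessing
  the failure could have no such subsequence.\<close>

lemma vitali_at_top:
  fixes F :: "real \<Rightarrow> complex \<Rightarrow> complex"
  assumes S: "open S" "connected S"
    and hol: "\<And>L. L > 0 \<Longrightarrow> F L holomorphic_on S"
    and bdd: "\<And>K. compact K \<Longrightarrow> K \<subseteq> S \<Longrightarrow> \<exists>B. \<forall>L>0. \<forall>z\<in>K. cmod (F L z) \<le> B"
    and T: "T \<subseteq> S" "x0 \<in> S" "x0 islimpt T"
    and conv: "\<And>t. t \<in> T \<Longrightarrow> \<exists>c. ((\<lambda>L. F L t) \<longlongrightarrow> c) at_top"
  shows "\<exists>C. C holomorphic_on S \<and> (\<forall>K. compact K \<and> K \<subseteq> S \<longrightarrow> uniform_limit K F C at_top)"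
proof -
  define H where "H = F ` {0<..}"
  have Hhol: "\<And>h. h \<in> H \<Longrightarrow> h holomorphic_on S" using hol by (auto simp: H_def)
  have Hb: "\<exists>B. \<forall>h\<in>H. \<forall>z\<in>K. cmod (h z) \<le> B" if "compact K" "K \<subseteq> S" for K
    using bdd[OF that] by (auto simp: H_def)
  obtain c where c: "\<And>t. t \<in> T \<Longrightarrow> ((\<lambda>L. F L t) \<longlongrightarrow> c t) at_top" using conv by metis
  have montel: "\<exists>g \<sigma>. g holomorphic_on S \<and> strict_mono (\<sigma> :: nat \<Rightarrow> nat) \<and> (\<forall>t\<in>T. g t = c t)
      \<and> (\<forall>K. compact K \<longrightarrow> K \<subseteq> S \<longrightarrow> uniform_limit K (\<lambda>n. F (l (\<sigma> n))) g sequentially)"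
    if l: "\<And>n. l n > 0" "filterlim l at_top sequentially" for l :: "nat \<Rightarrow> real"
  proof -
    have rng: "range (\<lambda>n. F (l n)) \<subseteq> H" using l(1) by (auto simp: H_def)
    obtain g \<sigma> where g: "g holomorphic_on S" "strict_mono (\<sigma> :: nat \<Rightarrow> nat)"
      "\<And>x. x \<in> S \<Longrightarrow> ((\<lambda>n. F (l (\<sigma> n)) x) \<longlongrightarrow> g x) sequentially"
      "\<And>K. \<lbrakk>compact K; K \<subseteq> S\<rbrakk> \<Longrightarrow> uniform_limit K ((\<lambda>n. F (l n)) \<circ> \<sigma>) g sequentially"
      by (rule Montel[of S H "\<lambda>n. F (l n)", OF S(1) Hhol Hb rng]) (assumption | rule that)+
    have "g t = c t" if t: "t \<in> T" for t
    proof -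
      have "filterlim (\<lambda>n. l (\<sigma> n)) at_top sequentially"
        by (rule filterlim_compose[OF l(2) filterlim_subseq[OF g(2)]])
      from filterlim_compose[OF c[OF t] this] have "(\<lambda>n. F (l (\<sigma> n)) t) \<longlonglongrightarrow> c t" .
      with g(3)[of t] T(1) t show ?thesis by (intro LIMSEQ_unique[of "\<lambda>n. F (l (\<sigma> n)) t"]) auto
    qed
    then show ?thesis using g(1,2,4) by (auto simp: o_def)
  qed
  have "filterlim (\<lambda>n. real (Suc n)) at_top sequentially"
    by (rule filterlim_compose[OF filterlim_real_sequentially filterlim_Suc])
  then obtain C where C: "C holomorphic_on S" "\<And>t. t \<in> T \<Longrightarrow> C t = c t"
    using montel[of "\<lambda>n. real (Suc n)"] by auto
  have "uniform_limit K F C at_top" if K: "compact K" "K \<subseteq> S" for K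
  proof (rule ccontr)
    assume "\<not> uniform_limit K F C at_top"
    then obtain e where e: "e > 0" "\<not> (\<forall>\<^sub>F L in at_top. \<forall>x\<in>K. dist (F L x) (C x) < e)"
      unfolding uniform_limit_iff by blast
    have "\<exists>L. L \<ge> real (Suc n) \<and> \<not> (\<forall>x\<in>K. dist (F L x) (C x) < e)" for n
      using e(2) unfolding eventually_at_top_linorder by blast
    then obtain l where l: "\<And>n. l n \<ge> real (Suc n)" "\<And>n. \<not> (\<forall>x\<in>K. dist (F (l n) x) (C x) < e)"
      by metis
    have lpos: "l n > 0" for n using l(1)[of n] by (simp add: less_le_trans[of 0 "real (Suc n)"])
    have ltop: "filterlim l at_top sequentially"
      by (rule filterlim_at_top_mono[OF \<open>filterlim (\<lambda>n. real (Suc n)) at_top sequentially\<close>]) (use l(1) in auto)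
    obtain g \<sigma> where g: "g holomorphic_on S" "\<And>t. t \<in> T \<Longrightarrow> g t = c t"
      "uniform_limit K (\<lambda>n. F (l (\<sigma> n))) g sequentially"
      using montel[of l, OF lpos ltop] K by blast
    have gC: "g w = C w" if w: "w \<in> S" for w
    proof -
      have "g w - C w = 0"
        by (rule analytic_continuation[of "\<lambda>z. g z - C z" S T x0])
          (use g C S T w in \<open>auto intro!: holomorphic_intros\<close>)
      then show ?thesis by simp
    qed
    have "\<forall>\<^sub>F n in sequentially. \<forall>x\<in>K. dist (F (l (\<sigma> n)) x) (g x) < e"
      using g(3) e(1) unfolding uniform_limit_iff by blast
    then obtain n where "\<forall>x\<in>K. dist (F (l (\<sigma> n)) x) (g x) < e"
      by (auto simp: eventually_sequentially)
    then show False using l(2)[of "\<sigma> n"] gC K(2) by (metis subsetD)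
  qed
  then show ?thesis using C(1) by blast
qed

text \<open>The increments decrease. A negative one would force at least linear decay and contradict
  boundedness, so the sequence is increasing.\<close>

lemma concave_bounded_convergent:
  fixes b :: "nat \<Rightarrow> real"
  assumes concave: "\<And>j. b (Suc (Suc j)) + b j \<le> 2 * b (Suc j)" and bdd: "\<And>j. \<bar>b j\<bar> \<le> B"
  shows "convergent b"
proof -
  define d where "d = (\<lambda>j. b (Suc j) - b j)"
  have "decseq d" unfolding d_def using concave by (intro decseq_SucI) (simp add: algebra_simps)
  have d0: "d i \<ge> 0" for i
  proof (rule ccontr)
    assume "\<not> ?thesis"
    then have neg: "d i < 0" by simp
    have le: "b (i + n) \<le> b i + real n * d i" for n
    proof (induction n)
      case (Suc n)
      have "d (i + n) \<le> d i" using \<open>decseq d\<close> by (simp add: decseq_def)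
      then show ?case using Suc by (simp add: d_def algebra_simps)
    qed simp
    obtain n where n: "2 * B / (- d i) < real n" using reals_Archimedean2 by blast
    have "2 * B < real n * (- d i)" using n neg by (metis neg_0_less_iff_less pos_divide_less_eq)
    then show False using le[of n] bdd[of i] bdd[of "i + n"] by (simp add: abs_le_iff)
  qed
  have "incseq b" using d0 by (intro incseq_SucI) (simp add: d_def)
  moreover have "Bseq b" using bdd by (intro BseqI'[of b B]) auto
  ultimately show ?thesis using Bseq_mono_convergent[of b] by (auto simp: incseq_def)
qed

text \<open>Concavity along the multiples of \<open>1 / (p + 1)\<close> gives convergence on each of
  these grids, and all grids contain the positive integers, so they share one limit. Between
  neighbouring grid points monotonicity of \<open>\<psi>\<close> leaves an error of at most
  \<open>\<bar>l\<bar> / (p + 1)\<close>.\<close>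

lemma grid_concave_mono_convergent:
  fixes \<psi> :: "real \<Rightarrow> real"
  assumes concave: "\<And>\<eta> j. \<eta> > 0 \<Longrightarrow> j > 0 \<Longrightarrow> \<psi> (real (Suc (Suc j)) * \<eta>) + \<psi> (real j * \<eta>) \<le> 2 * \<psi> (real (Suc j) * \<eta>)"
    and mono: "\<And>x y. 0 < x \<Longrightarrow> x \<le> y \<Longrightarrow> \<psi> x \<le> \<psi> y"
    and bdd: "\<And>x. x > 0 \<Longrightarrow> \<bar>\<psi> x - x * l\<bar> \<le> B"
  shows "\<exists>c. ((\<lambda>x. \<psi> x - x * l) \<longlongrightarrow> c) at_top"
proof -
  define f where "f = (\<lambda>x. \<psi> x - x * l)"
  have conv: "convergent (\<lambda>j. f (real (Suc j) / real (Suc p)))" for p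
  proof (rule concave_bounded_convergent)
    fix j
    show "f (real (Suc (Suc (Suc j))) / real (Suc p)) + f (real (Suc j) / real (Suc p)) \<le> 2 * f (real (Suc (Suc j)) / real (Suc p))"
    proof -
      define \<eta> where "\<eta> = 1 / real (Suc p)"
      have n: "real k / real (Suc p) = real k * \<eta>" for k by (simp add: \<eta>_def)
      have "\<psi> (real (Suc (Suc (Suc j))) * \<eta>) + \<psi> (real (Suc j) * \<eta>) \<le> 2 * \<psi> (real (Suc (Suc j)) * \<eta>)"
        by (rule concave) (auto simp: \<eta>_def)
      then show ?thesis unfolding n f_def by (simp add: algebra_simps)
    qed
    show "\<bar>f (real (Suc j) / real (Suc p))\<bar> \<le> B" unfolding f_def by (rule bdd) simp
  qed
  define c where "c = lim (\<lambda>j. f (real (Suc j) / real (Suc 0)))"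
  have c: "(\<lambda>j. f (real (Suc j) / real (Suc p))) \<longlonglongrightarrow> c" for p
  proof -
    obtain c' where c': "(\<lambda>j. f (real (Suc j) / real (Suc p))) \<longlonglongrightarrow> c'" using conv[of p] by (auto simp: convergent_def)
    \<comment> \<open>Index \<open>Suc i * Suc p - 1\<close> belongs to the integer
      \<open>Suc i\<close>; the shift by one occurs because the sequence begins at the first grid
      point and not at 0.\<close>
    have sm: "strict_mono (\<lambda>i. Suc i * Suc p - 1)" by (intro strict_monoI) (simp, intro add_less_le_mono mult_le_mono1, auto)
    from LIMSEQ_subseq_LIMSEQ[OF c' this]
    have "(\<lambda>i. f (real (Suc (Suc i * Suc p - 1)) / real (Suc p))) \<longlonglongrightarrow> c'" by (simp add: o_def)
    moreover have "real (Suc (Suc i * Suc p - 1)) / real (Suc p) = real (Suc i) / real (Suc 0)" for i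
    proof -
      have "Suc (Suc i * Suc p - 1) = Suc i * Suc p" by simp
      moreover have "real (Suc 0) = 1" by simp
      ultimately show ?thesis by (simp only: of_nat_mult) (simp del: of_nat_Suc)
    qed
    ultimately have "(\<lambda>i. f (real (Suc i) / real (Suc 0))) \<longlonglongrightarrow> c'" by simp
    then have "c' = c" unfolding c_def by (simp add: limI)
    then show ?thesis using c' by simp
  qed
  have "(f \<longlongrightarrow> c) at_top"
  proof (rule tendstoI)
    fix e :: real assume e: "e > 0"
    obtain p where p: "real (Suc p) > 2 * \<bar>l\<bar> / e" using reals_Archimedean2 by (metis less_trans lessI of_nat_less_iff)
    then have lp: "\<bar>l\<bar> / real (Suc p) < e / 2" using e by (simp add: field_simps)
    obtain J where J: "\<And>j. j \<ge> J \<Longrightarrow> \<bar>f (real (Suc j) / real (Suc p)) - c\<bar> < e / 2"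
      using tendstoD[OF c[of p], of "e / 2"] e by (auto simp: eventually_sequentially dist_real_def)
    show "\<forall>\<^sub>F x in at_top. dist (f x) c < e"
      using eventually_ge_at_top[of "real (Suc (Suc J)) / real (Suc p)"]
    proof eventually_elim
      case (elim x)
      define k where "k = nat \<lfloor>x * real (Suc p)\<rfloor>"
      have xp: "real (Suc (Suc J)) \<le> x * real (Suc p)" using elim by (simp add: divide_le_eq del: of_nat_Suc)
      then have x0: "x * real (Suc p) > 0" by (smt (verit) of_nat_0_less_iff zero_less_Suc)
      have k: "real k \<le> x * real (Suc p)" "x * real (Suc p) < real k + 1"
        unfolding k_def using x0 by (auto simp del: of_nat_Suc)
      have "real (Suc (Suc J)) < real (Suc k)" using xp k(2) by simp
      then have kJ: "k \<ge> Suc (Suc J)" by simp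
      define i where "i = k - 1"
      have ki: "k = Suc i" "i \<ge> J" using kJ by (auto simp: i_def)
      have lo: "real (Suc i) / real (Suc p) \<le> x" using k ki by (simp add: divide_le_eq del: of_nat_Suc)
      have hi: "x \<le> real (Suc (Suc i)) / real (Suc p)" using k ki by (simp add: le_divide_eq) 
      have gap: "real (Suc (Suc i)) / real (Suc p) = real (Suc i) / real (Suc p) + 1 / real (Suc p)"
        by (simp add: add_divide_distrib[symmetric])
      have dl: "\<bar>(x - y) * l\<bar> \<le> \<bar>l\<bar> / real (Suc p)" if "\<bar>x - y\<bar> \<le> 1 / real (Suc p)" for y
        using mult_right_mono[OF that, of "\<bar>l\<bar>"] by (simp add: abs_mult)
      have "\<psi> (real (Suc i) / real (Suc p)) \<le> \<psi> x" by (rule mono[OF _ lo]) simp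
      moreover have "\<psi> x \<le> \<psi> (real (Suc (Suc i)) / real (Suc p))"
        by (rule mono[OF _ hi]) (use lo in \<open>smt (verit) divide_pos_pos of_nat_0_less_iff zero_less_Suc\<close>)
      moreover have "\<bar>(x - real (Suc i) / real (Suc p)) * l\<bar> \<le> \<bar>l\<bar> / real (Suc p)"
        by (rule dl) (use lo hi gap in linarith)
      moreover have "\<bar>(x - real (Suc (Suc i)) / real (Suc p)) * l\<bar> \<le> \<bar>l\<bar> / real (Suc p)"
        by (rule dl) (use lo hi gap in linarith)
      moreover have "f y1 - e / 2 \<le> f x \<and> f x \<le> f y2 + e / 2"
        if "\<psi> y1 \<le> \<psi> x" "\<psi> x \<le> \<psi> y2" "\<bar>(x - y1) * l\<bar> \<le> d" "\<bar>(x - y2) * l\<bar> \<le> d" "d < e / 2" for y1 y2 d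
        using that unfolding f_def left_diff_distrib by linarith
      ultimately have "f (real (Suc i) / real (Suc p)) - e / 2 \<le> f x \<and> f x \<le> f (real (Suc (Suc i)) / real (Suc p)) + e / 2"
        using lp by blast
      moreover have "\<bar>f (real (Suc i) / real (Suc p)) - c\<bar> < e / 2" "\<bar>f (real (Suc (Suc i)) / real (Suc p)) - c\<bar> < e / 2"
        by (rule J[OF ki(2)], rule J[OF le_SucI[OF ki(2)]])
      moreover have "\<bar>y - c\<bar> < e" if "y1 - e / 2 \<le> y \<and> y \<le> y2 + e / 2" "\<bar>y1 - c\<bar> < e / 2" "\<bar>y2 - c\<bar> < e / 2" for y y1 y2
        using that by linarith
      ultimately show ?case unfolding dist_real_def by blast
    qed
  qed
  then show ?thesis unfolding f_def by blast
qed

section \<open>Log-concavity of block minors\<close>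

context mesh
begin

definition shifted_gram :: "real \<Rightarrow> nat \<Rightarrow> nat \<Rightarrow> complex" where
  "shifted_gram z i j = (if i = j then 1 else 0) + of_real z * gram i j"

text \<open>The form of the Gram matrix is an integral of squared moduli, hence nonnegative, and the
  identity contributes the constant 1.\<close>

lemma coercive_shifted_gram:
  assumes z: "z > 0"
  shows "coercive_hermitian (shifted_gram z)"
proof
  show "shifted_gram z j i = cnj (shifted_gram z i j)" for i j
    using gram_herm[of j i] by (simp add: shifted_gram_def)
  show "(\<Sum>i<n. (cmod (v i))\<^sup>2) \<le> Re (herm_form (shifted_gram z) n v)" for n v
  proof -
    have row: "(\<Sum>j<n. shifted_gram z i j * v j) = v i + of_real z * (\<Sum>j<n. gram i j * v j)" if "i < n" for i
    proof -
      have "(\<Sum>j<n. shifted_gram z i j * v j) = (\<Sum>j<n. if j = i then v j else 0) + of_real z * (\<Sum>j<n. gram i j * v j)"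
        unfolding sum_distrib_left sum.distrib[symmetric]
        by (rule sum.cong[OF refl]) (simp add: shifted_gram_def distrib_right)
      then show ?thesis using that by simp
    qed
    have "herm_form (shifted_gram z) n v = (\<Sum>i<n. cnj (v i) * (v i + of_real z * (\<Sum>j<n. gram i j * v j)))"
      unfolding herm_form_def by (rule sum.cong[OF refl]) (simp add: row)
    also have "\<dots> = (\<Sum>i<n. v i * cnj (v i)) + of_real z * (\<Sum>i<n. cnj (v i) * (\<Sum>j<n. gram i j * v j))"
      unfolding sum_distrib_left[of "of_real z"] sum.distrib[symmetric]
      by (rule sum.cong[OF refl]) (simp only: distrib_left sum_distrib_left mult_ac)
    also have "\<dots> = of_real ((\<Sum>i<n. (cmod (v i))\<^sup>2) + z * (LINT \<xi>|half_line. (cmod (\<Sum>i<n. cnj (v i) * mode i \<xi>))\<^sup>2))"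
      unfolding gram_form(2) complex_norm_square[symmetric] by simp
    finally have "Re (herm_form (shifted_gram z) n v) = (\<Sum>i<n. (cmod (v i))\<^sup>2) + z * (LINT \<xi>|half_line. (cmod (\<Sum>i<n. cnj (v i) * mode i \<xi>))\<^sup>2)"
      by (simp only: Re_complex_of_real)
    moreover have "0 \<le> (LINT \<xi>|half_line. (cmod (\<Sum>i<n. cnj (v i) * mode i \<xi>))\<^sup>2)"
      by (rule Bochner_Integration.integral_nonneg) simp
    ultimately show ?thesis using z by simp
  qed
qed

lemma gram_toeplitz_multiple: "gram (i + m * r) (j + m * r) = gram i j"
proof (induction m)
  case (Suc m)
  have "gram (i + Suc m * r) (j + Suc m * r) = gram ((i + m * r) + r) ((j + m * r) + r)"
    by (simp add: ac_simps)
  then show ?case using Suc by (simp add: gram_toeplitz)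
qed simp

text \<open>Each ratio of consecutive minors is compared with the ratio one whole block of
  \<open>m * r\<close> indices earlier. Multiplied over a block, these comparisons telescope to the
  inequality between ratios of block minors.\<close>

lemma block_minor_log_concave:
  assumes z: "z > 0"
  shows "leading_minor (shifted_gram z) (Suc (Suc j) * (m * r)) * leading_minor (shifted_gram z) (j * (m * r))
    \<le> (leading_minor (shifted_gram z) (Suc j * (m * r)))\<^sup>2"
proof -
  interpret coercive_hermitian "shifted_gram z" by (rule coercive_shifted_gram[OF z])
  define D where "D = leading_minor (shifted_gram z)"
  define b where "b = m * r"
  have D: "D k > 0" for k using leading_minor(1)[of k] by (simp add: D_def)
  have sh: "shifted_gram z (i + b) (k + b) = shifted_gram z i k" for i k
    unfolding shifted_gram_def b_def gram_toeplitz_multiple by simp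
  have ratio: "D (Suc (k + b)) / D (k + b) \<le> D (Suc k) / D k" for k
    unfolding D_def by (rule toeplitz_minor_ratio_antimono[OF sh])
  have "D (k + i + b) / D (k + b) \<le> D (k + i) / D k" for k i
  proof (induction i)
    case (Suc i)
    have "D (k + Suc i + b) / D (k + b) = D (Suc (k + i + b)) / D (k + i + b) * (D (k + i + b) / D (k + b))"
      using D[of "k + i + b"] by simp
    also have "\<dots> \<le> D (Suc (k + i)) / D (k + i) * (D (k + i) / D k)"
      using Suc ratio[of "k + i"] D by (intro mult_mono) (auto intro!: divide_nonneg_nonneg less_imp_le)
    also have "\<dots> = D (k + Suc i) / D k" using D[of "k + i"] by simp
    finally show ?case .
  qed (use D in \<open>simp add: less_imp_neq[symmetric]\<close>)
  from this[of "j * b" b] have "D (Suc (Suc j) * b) / D (Suc j * b) \<le> D (Suc j * b) / D (j * b)"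
    by (simp add: ac_simps)
  then have "D (Suc (Suc j) * b) * D (j * b) \<le> D (Suc j * b) * D (Suc j * b)"
    using D[of "j * b"] D[of "Suc j * b"] by (simp add: divide_le_eq le_divide_eq mult_ac)
  then show ?thesis unfolding D_def b_def power2_eq_square .
qed

end

section \<open>Bounds, holomorphy and convergence of the logarithm\<close>

context
  fixes M :: "'w measure" and Z :: "'w \<Rightarrow> complex set" and a :: real
  assumes dpp: "determinantal_point_process M upper_half_plane lborel K_H Z" and a: "a > 1"
begin

interpretation simple_point_process M upper_half_plane Z
  using dpp unfolding determinantal_point_process_def by simp

text \<open>The whole rectangle is treated as one block, with \<open>j = 1\<close> and
  \<open>\<eta> = L\<close>; uniqueness of the holomorphic logarithm on the connected strip
  transfers the properties of the limit to \<open>log_mgf\<close>.\<close>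

lemma log_mgf_facts:
  assumes L: "L > 0"
  shows "log_mgf M (N Z a L) holomorphic_on S_pi"
    and "\<And>\<theta>. \<theta> \<in> S_pi \<Longrightarrow> exp (log_mgf M (N Z a L) \<theta>) = (LINT \<omega>|M. exp (\<theta> * of_nat (N Z a L \<omega>)))"
    and "\<And>\<theta>. \<theta> \<in> \<real> \<Longrightarrow> log_mgf M (N Z a L) \<theta> \<in> \<real>"
    and "\<And>\<theta> B. \<theta> \<in> S_pi \<Longrightarrow> B \<ge> 0 \<Longrightarrow>
      quadratic_taylor B (strip_log \<theta>) (\<lambda>p. (exp \<theta> - 1) / (1 + (exp \<theta> - 1) * of_real p)) \<Longrightarrow>
      (\<And>p. 0 \<le> p \<Longrightarrow> p \<le> 1 \<Longrightarrow> cmod (strip_log \<theta> p) \<le> B * p) \<Longrightarrow>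
      cmod (log_mgf M (N Z a L) \<theta> - of_real L * Lambda a \<theta>) \<le> B * (2 * (a - 1)\<^sup>2)"
proof -
  have L1: "L = real 1 * L" and one: "(1::nat) > 0" by simp_all
  obtain g where g: "is_holomorphic_log S_pi 0 (\<lambda>\<theta>. LINT \<omega>|M. exp (\<theta> * of_nat (N Z a L \<omega>))) g"
    and greal: "\<And>\<theta>. \<theta> \<in> \<real> \<Longrightarrow> g \<theta> \<in> \<real>"
    and gb: "\<And>\<theta> B. \<theta> \<in> S_pi \<Longrightarrow> B \<ge> 0 \<Longrightarrow>
      quadratic_taylor B (strip_log \<theta>) (\<lambda>p. (exp \<theta> - 1) / (1 + (exp \<theta> - 1) * of_real p)) \<Longrightarrow>
      (\<And>p. 0 \<le> p \<Longrightarrow> p \<le> 1 \<Longrightarrow> cmod (strip_log \<theta> p) \<le> B * p) \<Longrightarrow>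
      cmod (g \<theta> - of_real L * Lambda a \<theta>) \<le> B * (2 * (a - 1)\<^sup>2)"
    using log_mgf_bound_grid[OF dpp a L one L1] by blast
  have eq: "log_mgf M (N Z a L) \<theta> = g \<theta>" if "\<theta> \<in> S_pi" for \<theta>
    unfolding log_mgf_def
    by (rule holomorphic_log_eq[OF S_pi_open convex_connected[OF S_pi_convex] zero_in_S_pi g that])
  show "log_mgf M (N Z a L) holomorphic_on S_pi"
    by (rule holomorphic_transform[of g]) (use g eq in \<open>auto simp: is_holomorphic_log_def\<close>)
  show "exp (log_mgf M (N Z a L) \<theta>) = (LINT \<omega>|M. exp (\<theta> * of_nat (N Z a L \<omega>)))" if "\<theta> \<in> S_pi" for \<theta>
    using g that by (simp add: eq is_holomorphic_log_def)
  show "log_mgf M (N Z a L) \<theta> \<in> \<real>" if "\<theta> \<in> \<real>" for \<theta>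
  proof -
    have "\<theta> \<in> S_pi" using that by (auto simp: S_pi_def complex_is_Real_iff)
    then show ?thesis using greal[OF that] by (simp add: eq)
  qed
  show "cmod (log_mgf M (N Z a L) \<theta> - of_real L * Lambda a \<theta>) \<le> B * (2 * (a - 1)\<^sup>2)"
    if "\<theta> \<in> S_pi" "B \<ge> 0" "quadratic_taylor B (strip_log \<theta>) (\<lambda>p. (exp \<theta> - 1) / (1 + (exp \<theta> - 1) * of_real p))"
      "\<And>p. 0 \<le> p \<Longrightarrow> p \<le> 1 \<Longrightarrow> cmod (strip_log \<theta> p) \<le> B * p" for \<theta> B
    unfolding eq[OF that(1)] by (rule gb[OF that])
qed

lemma log_mgf_locally_bounded:
  assumes "compact K" "K \<subseteq> S_pi"
  shows "\<exists>B. \<forall>L>0. \<forall>\<theta>\<in>K. cmod (log_mgf M (N Z a L) \<theta> - of_real L * Lambda a \<theta>) \<le> B"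
proof -
  obtain B where B: "B \<ge> 0"
    "\<And>\<theta>. \<theta> \<in> K \<Longrightarrow> quadratic_taylor B (strip_log \<theta>) (\<lambda>p. (exp \<theta> - 1) / (1 + (exp \<theta> - 1) * of_real p))"
    "\<And>\<theta> p. \<theta> \<in> K \<Longrightarrow> 0 \<le> p \<Longrightarrow> p \<le> 1 \<Longrightarrow> cmod (strip_log \<theta> p) \<le> B * p"
    by (rule strip_log_bounds[OF assms]; rule that)
  show ?thesis
    using log_mgf_facts(4)[OF _ _ B(1) B(2) B(3)] assms(2) by (intro exI[of _ "B * (2 * (a - 1)\<^sup>2)"]) blast
qed

text \<open>Because the difference from \<open>L * Lambda a \<theta>\<close> is bounded locally
  uniformly, \<open>log_mgf\<close> divided by \<open>L\<close> converges locally uniformly to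
  \<open>Lambda a\<close>, which inherits holomorphy without differentiation under the
  integral.\<close>

lemma Lambda_holomorphic: "Lambda a holomorphic_on S_pi"
proof (rule holomorphic_uniform_sequence[OF S_pi_open, where f = "\<lambda>n \<theta>. log_mgf M (N Z a (real (Suc n))) \<theta> / of_nat (Suc n)"])
  show "(\<lambda>\<theta>. log_mgf M (N Z a (real (Suc n))) \<theta> / of_nat (Suc n)) holomorphic_on S_pi" for n
    by (intro holomorphic_intros log_mgf_facts(1)) auto
  fix x assume x: "x \<in> S_pi"
  obtain d where d: "d > 0" "cball x d \<subseteq> S_pi" using S_pi_open x open_contains_cball by blast
  obtain B where B: "\<And>L \<theta>. L > 0 \<Longrightarrow> \<theta> \<in> cball x d \<Longrightarrow> cmod (log_mgf M (N Z a L) \<theta> - of_real L * Lambda a \<theta>) \<le> B"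
    using log_mgf_locally_bounded[OF compact_cball d(2)] by blast
  have "uniform_limit (cball x d) (\<lambda>n \<theta>. log_mgf M (N Z a (real (Suc n))) \<theta> / of_nat (Suc n)) (Lambda a) sequentially"
    unfolding uniform_limit_iff
  proof (intro allI impI)
    fix e :: real assume e: "e > 0"
    have "(\<lambda>n. B / real (Suc n)) \<longlonglongrightarrow> 0" using LIMSEQ_Suc[OF lim_const_over_n[of B]] by simp
    then have "\<forall>\<^sub>F n in sequentially. B / real (Suc n) < e" using e by (rule order_tendstoD)
    then show "\<forall>\<^sub>F n in sequentially. \<forall>\<theta>\<in>cball x d. dist (log_mgf M (N Z a (real (Suc n))) \<theta> / of_nat (Suc n)) (Lambda a \<theta>) < e"
    proof eventually_elim
      case (elim n)
      show ?case
      proof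
        fix \<theta> assume \<theta>: "\<theta> \<in> cball x d"
        have "log_mgf M (N Z a (real (Suc n))) \<theta> / of_nat (Suc n) - Lambda a \<theta>
          = (log_mgf M (N Z a (real (Suc n))) \<theta> - of_real (real (Suc n)) * Lambda a \<theta>) / of_nat (Suc n)"
          by (simp add: diff_divide_distrib del: of_nat_Suc)
        then have "dist (log_mgf M (N Z a (real (Suc n))) \<theta> / of_nat (Suc n)) (Lambda a \<theta>)
          = cmod (log_mgf M (N Z a (real (Suc n))) \<theta> - of_real (real (Suc n)) * Lambda a \<theta>) / real (Suc n)"
          by (simp add: dist_norm norm_divide del: of_nat_Suc)
        also have "\<dots> \<le> B / real (Suc n)" using B[OF _ \<theta>, of "real (Suc n)"] by (intro divide_right_mono) auto
        also have "\<dots> < e" by (rule elim)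
        finally show "dist (log_mgf M (N Z a (real (Suc n))) \<theta> / of_nat (Suc n)) (Lambda a \<theta>) < e" .
      qed
    qed
  qed
  then show "\<exists>d>0. cball x d \<subseteq> S_pi \<and> uniform_limit (cball x d) (\<lambda>n \<theta>. log_mgf M (N Z a (real (Suc n))) \<theta> / of_nat (Suc n)) (Lambda a) sequentially"
    using d by blast
qed

text \<open>For \<open>t > 0\<close> the number \<open>exp t - 1\<close> is positive, so the shifted
  Gram matrix is coercive and its block minors are log-concave; the mesh limit carries this over to
  the expectations. These also increase with \<open>L\<close>, because the rectangles grow and
  \<open>exp t \<ge> 1\<close>.\<close>

lemma real_log_mgf_converges:
  assumes t: "t > 0"
  shows "\<exists>c. ((\<lambda>L. log_mgf M (N Z a L) (of_real t) - of_real L * Lambda a (of_real t)) \<longlongrightarrow> c) at_top"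
proof -
  define \<psi> where "\<psi> = (\<lambda>L. Re (log_mgf M (N Z a L) (of_real t)))"
  define E where "E = (\<lambda>L. LINT \<omega>|M. exp t ^ N Z a L \<omega>)"
  have tS: "complex_of_real t \<in> S_pi" by (simp add: S_pi_def)
  have psi: "log_mgf M (N Z a L) (of_real t) = of_real (\<psi> L)" if "L > 0" for L
    using log_mgf_facts(3)[OF that, of "of_real t"] by (simp add: \<psi>_def)
  have z: "exp t - 1 > 0" using t by simp
  have intE: "integrable M (\<lambda>\<omega>. exp t ^ N Z a L \<omega>)" and EL: "exp (\<psi> L) = E L" if L: "L > 0" for L
  proof -
    have e: "1 + (exp (complex_of_real t) - 1) = of_real (exp t)" by (simp add: exp_of_real)
    have "integrable M (\<lambda>\<omega>. (1 + (exp (complex_of_real t) - 1)) ^ N Z a (real 1 * L) \<omega>)"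
      by (rule grid_det_tendsto(1)[OF dpp a L]) simp
    then have "integrable M (\<lambda>\<omega>. complex_of_real (exp t ^ N Z a L \<omega>))" unfolding e by simp
    then show i: "integrable M (\<lambda>\<omega>. exp t ^ N Z a L \<omega>)" by (simp only: complex_of_real_integrable_eq)
    have "complex_of_real (exp (\<psi> L)) = exp (log_mgf M (N Z a L) (of_real t))" by (simp add: psi[OF L] exp_of_real)
    also have "\<dots> = (LINT \<omega>|M. exp (of_real t * of_nat (N Z a L \<omega>)))" by (rule log_mgf_facts(2)[OF L tS])
    also have "\<dots> = (LINT \<omega>|M. complex_of_real (exp t ^ N Z a L \<omega>))"
      by (rule Bochner_Integration.integral_cong[OF refl]) (simp add: exp_of_nat2_mult exp_of_real)
    also have "\<dots> = of_real (E L)" unfolding E_def by (rule integral_complex_of_real)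
    finally show "exp (\<psi> L) = E L" by (simp only: of_real_eq_iff)
  qed
  have det_lim: "(\<lambda>q. leading_minor (mesh.shifted_gram (grid_h \<eta> q) (grid_w a q) (Suc q) (exp t - 1)) (j * Suc q * Suc q)) \<longlonglongrightarrow> E (real j * \<eta>)"
    if \<eta>: "\<eta> > 0" and j: "j > 0" for \<eta> j
  proof -
    have "(\<lambda>q. grid_det a \<eta> j q (of_real (exp t - 1))) \<longlonglongrightarrow> (LINT \<omega>|M. (1 + of_real (exp t - 1)) ^ N Z a (real j * \<eta>) \<omega>)"
      by (rule grid_det_tendsto(2)[OF dpp a \<eta> j])
    moreover have "(LINT \<omega>|M. (1 + of_real (exp t - 1)) ^ N Z a (real j * \<eta>) \<omega>) = complex_of_real (E (real j * \<eta>))"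
      unfolding E_def integral_complex_of_real[symmetric] by simp
    ultimately have "(\<lambda>q. Re (grid_det a \<eta> j q (of_real (exp t - 1)))) \<longlonglongrightarrow> Re (complex_of_real (E (real j * \<eta>)))"
      by (intro tendsto_Re) simp
    moreover have "Re (grid_det a \<eta> j q (of_real (exp t - 1)))
      = leading_minor (mesh.shifted_gram (grid_h \<eta> q) (grid_w a q) (Suc q) (exp t - 1)) (j * Suc q * Suc q)" for q
      unfolding grid_det_def leading_minor_def grid_gram_def mesh.shifted_gram_def[OF mesh_grid[OF a \<eta>]] ..
    ultimately show ?thesis by simp
  qed
  have "\<exists>c. ((\<lambda>L. \<psi> L - L * Re (Lambda a (of_real t))) \<longlongrightarrow> c) at_top"
  proof -
    obtain B where B: "\<And>L. L > 0 \<Longrightarrow> cmod (log_mgf M (N Z a L) (of_real t) - of_real L * Lambda a (of_real t)) \<le> B"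
      using log_mgf_locally_bounded[of "{complex_of_real t}"] tS by auto
    show ?thesis
    proof (rule grid_concave_mono_convergent)
      fix \<eta> :: real and j :: nat assume \<eta>: "\<eta> > 0" and j: "j > 0"
      let ?D = "\<lambda>q. leading_minor (mesh.shifted_gram (grid_h \<eta> q) (grid_w a q) (Suc q) (exp t - 1))"
      have "?D q (Suc (Suc j) * Suc q * Suc q) * ?D q (j * Suc q * Suc q) \<le> (?D q (Suc j * Suc q * Suc q))\<^sup>2" for q
        using mesh.block_minor_log_concave[OF mesh_grid[OF a \<eta>, of q] z, where j = j and m = "Suc q"] by (simp only: mult.assoc)
      then have "E (real (Suc (Suc j)) * \<eta>) * E (real j * \<eta>) \<le> (E (real (Suc j) * \<eta>))\<^sup>2"
        by (intro LIMSEQ_le[OF tendsto_mult[OF det_lim[OF \<eta>] det_lim[OF \<eta> j]] tendsto_power[OF det_lim[OF \<eta>]]]) auto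
      moreover have pos: "real (Suc (Suc j)) * \<eta> > 0" "real j * \<eta> > 0" "real (Suc j) * \<eta> > 0" using \<eta> j by auto
      ultimately have "exp (\<psi> (real (Suc (Suc j)) * \<eta>) + \<psi> (real j * \<eta>)) \<le> exp (2 * \<psi> (real (Suc j) * \<eta>))"
        by (simp only: exp_add exp_double EL)
      then show "\<psi> (real (Suc (Suc j)) * \<eta>) + \<psi> (real j * \<eta>) \<le> 2 * \<psi> (real (Suc j) * \<eta>)" by simp
    next
      fix x y :: real assume xy: "0 < x" "x \<le> y"
      have "E x \<le> E y" unfolding E_def
      proof (rule integral_mono[OF intE intE])
        fix \<omega> assume \<omega>: "\<omega> \<in> space M"
        have "N Z a x \<omega> \<le> N Z a y \<omega>"
          unfolding N_eq_card using xy by (intro card_mono finite_points[OF dpp a \<omega>]) (auto simp: rectangle_def)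
        then show "exp t ^ N Z a x \<omega> \<le> exp t ^ N Z a y \<omega>" using t by (intro power_increasing) auto
      qed (use xy in auto)
      then have "exp (\<psi> x) \<le> exp (\<psi> y)" using xy by (simp only: EL)
      then show "\<psi> x \<le> \<psi> y" by simp
    next
      fix x :: real assume x: "x > 0"
      have "\<bar>Re (log_mgf M (N Z a x) (of_real t) - of_real x * Lambda a (of_real t))\<bar> \<le> B"
        using abs_Re_le_cmod B[OF x] by (rule order_trans)
      then show "\<bar>\<psi> x - x * Re (Lambda a (of_real t))\<bar> \<le> B" by (simp add: \<psi>_def)
    qed
  qed
  then obtain c where c: "((\<lambda>L. \<psi> L - L * Re (Lambda a (of_real t))) \<longlongrightarrow> c) at_top" by blast
  \<comment> \<open>Like \<open>log_mgf\<close>, \<open>Lambda a\<close> is real at real points, so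
    the convergence of the real parts is enough.\<close>
  have ImL: "Im (Lambda a (of_real t)) = 0"
  proof -
    have "strip_log (of_real t) (strip_symbol a \<xi>) \<in> \<real>" if "\<xi> \<in> space half_line" for \<xi>
      using strip_symbol_bounds[OF a, of \<xi>] that by (intro strip_log_real) (auto simp: space_restrict_space)
    then have "(LINT \<xi>|half_line. strip_log (of_real t) (strip_symbol a \<xi>))
      = (LINT \<xi>|half_line. complex_of_real (Re (strip_log (of_real t) (strip_symbol a \<xi>))))"
      by (intro Bochner_Integration.integral_cong[OF refl]) simp
    then show ?thesis unfolding Lambda_eq[OF a tS] by (simp add: integral_complex_of_real)
  qed
  have "\<forall>\<^sub>F L in at_top. complex_of_real (\<psi> L - L * Re (Lambda a (of_real t))) = log_mgf M (N Z a L) (of_real t) - of_real L * Lambda a (of_real t)"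
    using eventually_gt_at_top[of 0]
  proof eventually_elim
    case (elim L)
    have "Lambda a (of_real t) = of_real (Re (Lambda a (of_real t)))" using ImL by (simp add: complex_eq_iff)
    then show ?case unfolding psi[OF elim] by (metis of_real_diff of_real_mult)
  qed
  from Lim_transform_eventually[OF tendsto_of_real[OF c] this] show ?thesis by blast
qed

end

theorem theorem1p4:
  fixes M :: "'w measure" and Z :: "'w \<Rightarrow> complex set" and a :: real
  assumes "determinantal_point_process M upper_half_plane lborel K_H Z"
    and "a > 1"
  shows "\<exists>C. C holomorphic_on S_pi \<and>
           (\<forall>K. compact K \<and> K \<subseteq> S_pi \<longrightarrow>
              uniform_limit K
                (\<lambda>L \<theta>. log_mgf M (N Z a L) \<theta> - of_real L * Lambda a \<theta>) C at_top)"
proof (rule vitali_at_top[OF S_pi_open convex_connected[OF S_pi_convex]])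
  show "(\<lambda>\<theta>. log_mgf M (N Z a L) \<theta> - of_real L * Lambda a \<theta>) holomorphic_on S_pi" if "L > 0" for L
    by (intro holomorphic_intros log_mgf_facts(1)[OF assms that] Lambda_holomorphic[OF assms])
  show "\<exists>B. \<forall>L>0. \<forall>\<theta>\<in>K. cmod (log_mgf M (N Z a L) \<theta> - of_real L * Lambda a \<theta>) \<le> B"
    if "compact K" "K \<subseteq> S_pi" for K
    by (rule log_mgf_locally_bounded[OF assms that])
  show "complex_of_real ` {0<..} \<subseteq> S_pi" by (auto simp: S_pi_def)
  show "1 \<in> S_pi" by (simp add: S_pi_def)
  show "1 islimpt complex_of_real ` {0<..}"
    unfolding islimpt_approachable
  proof (intro allI impI)
    fix e :: real assume "e > 0"
    then show "\<exists>x'\<in>complex_of_real ` {0<..}. x' \<noteq> 1 \<and> dist x' 1 < e"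
      by (intro bexI[of _ "complex_of_real (1 + e / 2)"] imageI) (auto simp: dist_norm norm_divide)
  qed
  show "\<exists>c. ((\<lambda>L. log_mgf M (N Z a L) t - of_real L * Lambda a t) \<longlongrightarrow> c) at_top"
    if "t \<in> complex_of_real ` {0<..}" for t
    using that real_log_mgf_converges[OF assms] by auto
qed

end
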